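(* Under the standing assumptions in the context, with full $\mathbb P$-probability (i.e. for all $\omega$ in a set of $\mathbb P$-probability one), the sequences of functionals $(\mathcal J_{\omega,N})_{N\in\mathbb N}$ and $(J_{\omega,N})_{N\in\mathbb N}$ (closed-loop potentials in mixed and in pure strategies) converge to $\mathcal J$ as $N\to\infty$ in the sense of $\Gamma$-convergence for the narrow topology of $\mathscr P(\mathcal X\times\mathcal Y)$.
   Context: Standing assumptions: $\mathcal X,\mathcal Y$ are Polish spaces; $\mu\in\mathscr P(\mathcal X)$ (Borel probability measures) is atomless; $c:\mathcal X\times\mathcal Y\to[0,+\infty]$, $L:\mathcal Y\to[0,+\infty]$, $H:\mathcal Y\times\mathcal Y\to[0,+\infty]$ are lower semi-continuous; $H$ is symmetric; $\{L\le\kappa\}$ is compact for every $\kappa>0$. $(\Omega,\mathcal F,\mathbb P)$ is a probability space carrying an i.i.d. sequence $(X_i)_{i\in\mathbb N}$ of $\mathcal X$-valued random variables with law $\mu$. Notation: $\mathcal L(\nu)=\int L\,d\nu$, $\mathcal H(\nu,\bar\nu)=\int H\,d\nu\otimes\bar\nu$; for $m\in\mathscr P(\mathcal X)$, $\mathscr P_m(\mathcal X\times\mathcal Y)$ is the set of $\gamma\in\mathscr P(\mathcal X\times\mathcal Y)$ with first marginal $m$. $\mathcal J(\gamma)=\int c\,d\gamma+\mathcal L(\nu)+\mathcal H(\nu,\nu)$ if $\gamma\in\mathscr P_\mu(\mathcal X\times\mathcal Y)$ with second marginal $\nu$, and $\mathcal J(\gamma)=+\infty$ otherwise. For $\omega\in\Omega$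 put $x_i=X_i(\omega)$ and $\mu_N(\omega)=\frac1N\sum_{i=1}^N\delta_{x_i}$. For $\mathbb P$-a.e. $\omega$ the $x_i$ are pairwise distinct, and then each $\gamma_N\in\mathscr P_{\mu_N(\omega)}(\mathcal X\times\mathcal Y)$ is uniquely written $\gamma_N=\frac1N\sum_{i=1}^N\delta_{x_i}\otimes\nu_i$ with $\nu_i\in\mathscr P(\mathcal Y)$. Define $$\mathcal J_{\omega,N}(\gamma_N)=\int c\,d\gamma_N+\frac1N\sum_{i=1}^N\mathcal L(\nu_i)+\frac1{N^2}\sum_{i\neq j}\mathcal H(\nu_i,\nu_j)$$ for $\gamma_N\in\mathscr P_{\mu_N(\omega)}(\mathcal X\times\mathcal Y)$, and $+\infty$ otherwise. The pure-strategy potential is $J_{\omega,N}(y_1,\dots,y_N)=\mathcal J_{\omega,N}\big(\frac1N\sum_{i=1}^N\delta_{(x_i,y_i)}\big)$, and it is regarded as a functional on $\mathscr P(\mathcal X\times\mathcal Y)$ by restricting $\mathcal J_{\omega,N}$ to the set $\mathscr P^{\mathrm{pure}}_{\mu_N}(\mathcal X\times\mathcal Y)$ of measures of the form $\frac1N\sum_i\delta_{(x_i,y_i)}$, $y_i\in\mathcal Y$, and setting it to $+\infty$ outside this set. $\Gamma$-convergence of $\mathscr F_N$ to $\mathscr F$: (liminf) for every sequence $z_N\to z$, $\mathscr F(z)\le\liminf_N\mathscr F_N(z_N)$; (limsup) for every $z$ there is a sequence $z_N\to z$ with $\limsup_N\mathscr F_N(z_N)\le\mathscr F(z)$. The narrow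 topology is that of duality with bounded continuous functions. *)

theory Defs
  imports "HOL-Probability.Probability"
begin

section \<open>Borel probability measures and the narrow topology\<close>

abbreviation Prob :: "'a::topological_space measure set" where
  "Prob \<equiv> space (prob_algebra borel)"

text \<open>The coarsest topology on \<^term>\<open>Prob\<close> that makes \<open>M \<mapsto> \<integral>f dM\<close> continuous for every
  bounded continuous \<open>f\<close>.\<close>

definition narrow_topology :: "'a::topological_space measure topology" where
  "narrow_topology = topology_generated_by
     {{M \<in> Prob. integral\<^sup>L M f \<in> U} | (f :: 'a \<Rightarrow> real) U.
        continuous_on UNIV f \<and> bounded (range f) \<and> open U}"

lemma topspace_narrow_topology: "topspace narrow_topology = (Prob :: 'a::topological_space measure set)"
proof -
  have "(Prob :: 'a measure set) \<in> {{M \<in> Prob. integral\<^sup>L M f \<in> U} | (f :: 'a \<Rightarrow> real) U.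
        continuous_on UNIV f \<and> bounded (range f) \<and> open U}"
    by (intro CollectI exI[of _ "\<lambda>_. 0"] exI[of _ UNIV]) auto
  then show ?thesis
    unfolding narrow_topology_def topology_generated_by_topspace by blast
qed

lemma limitin_narrow_topology:
  fixes M :: "'a::topological_space measure" and z :: "nat \<Rightarrow> 'a measure"
  assumes "range z \<subseteq> Prob"
  shows "limitin narrow_topology z M sequentially \<longleftrightarrow>
    M \<in> Prob \<and> (\<forall>f :: 'a \<Rightarrow> real. continuous_on UNIV f \<longrightarrow> bounded (range f) \<longrightarrow>
      (\<lambda>n. integral\<^sup>L (z n) f) \<longlonglongrightarrow> integral\<^sup>L M f)"
    (is "?L \<longleftrightarrow> ?R")
proof
  assume L: ?L
  then have M: "M \<in> Prob"
    using limitin_topspace[OF L] by (simp only: topspace_narrow_topology)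
  moreover have "(\<lambda>n. integral\<^sup>L (z n) f) \<longlonglongrightarrow> integral\<^sup>L M f"
    if f: "continuous_on UNIV f" "bounded (range f)" for f :: "'a \<Rightarrow> real"
  proof (rule topological_tendstoI)
    fix U :: "real set" assume U: "open U" "integral\<^sup>L M f \<in> U"
    have "openin narrow_topology {M \<in> Prob. integral\<^sup>L M f \<in> U}"
      unfolding narrow_topology_def using f U by (intro topology_generated_by_Basis) blast
    then have "\<forall>\<^sub>F n in sequentially. z n \<in> {M \<in> Prob. integral\<^sup>L M f \<in> U}"
      using L U M unfolding limitin_def by blast
    then show "\<forall>\<^sub>F n in sequentially. integral\<^sup>L (z n) f \<in> U"
      by eventually_elim simp
  qed
  ultimately show ?R by blast
next
  assume R: ?R
  let ?S = "{{M \<in> Prob. integral\<^sup>L M f \<in> U} | (f :: 'a \<Rightarrow> real) U.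
        continuous_on UNIV f \<and> bounded (range f) \<and> open U}"
  have "\<forall>\<^sub>F n in sequentially. z n \<in> V" if "openin narrow_topology V" "M \<in> V" for V
  proof -
    have "generate_topology_on ?S V"
      using that(1) unfolding narrow_topology_def openin_topology_generated_by_iff .
    then show ?thesis using that(2)
    proof induction
      case (Int a b)
      then show ?case by (simp add: eventually_conj_iff)
    next
      case (UN K)
      then obtain k where "k \<in> K" "M \<in> k" by auto
      then have "\<forall>\<^sub>F n in sequentially. z n \<in> k" using UN by auto
      then show ?case using \<open>k \<in> K\<close> by (auto elim: eventually_mono)
    next
      case (Basis s)
      then obtain f U where f: "continuous_on UNIV f" "bounded (range f)" "open U"
        and s: "s = {M \<in> Prob. integral\<^sup>L M (f :: 'a \<Rightarrow> real) \<in> U}" by auto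
      have "\<forall>\<^sub>F n in sequentially. integral\<^sup>L (z n) f \<in> U"
        using R f Basis(2) s by (auto intro: topological_tendstoD)
      then show ?case using assms s by (auto elim!: eventually_mono)
    qed simp
  qed
  then show ?L
    using R by (auto simp: limitin_def topspace_narrow_topology)
qed


section \<open>Gamma-convergence and semicontinuity\<close>

definition gamma_converges ::
  "'z topology \<Rightarrow> (nat \<Rightarrow> 'z \<Rightarrow> 'e::complete_linorder) \<Rightarrow> ('z \<Rightarrow> 'e) \<Rightarrow> bool" where
  "gamma_converges T F G \<longleftrightarrow>
     (\<forall>z \<zeta>. range \<zeta> \<subseteq> topspace T \<longrightarrow> limitin T \<zeta> z sequentially \<longrightarrow>
        G z \<le> liminf (\<lambda>N. F N (\<zeta> N))) \<and>
     (\<forall>z\<in>topspace T. \<exists>\<zeta>. range \<zeta> \<subseteq> topspace T \<and> limitin T \<zeta> z sequentially \<and>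
        limsup (\<lambda>N. F N (\<zeta> N)) \<le> G z)"

definition lower_semicontinuous :: "('a::topological_space \<Rightarrow> 'e::complete_linorder) \<Rightarrow> bool" where
  "lower_semicontinuous f \<longleftrightarrow> (\<forall>a. open {x. a < f x})"

definition atomless :: "'a measure \<Rightarrow> bool" where
  "atomless M \<longleftrightarrow> (\<forall>A\<in>sets M. 0 < emeasure M A \<longrightarrow>
     (\<exists>B\<in>sets M. B \<subseteq> A \<and> 0 < emeasure M B \<and> emeasure M B < emeasure M A))"


section \<open>Averages of measures\<close>

text \<open>\<open>average N m\<close> is \<open>1/N (m 0 + \<dots> + m (N-1))\<close>. Samples and players are numbered from \<open>0\<close>.\<close>

definition average :: "nat \<Rightarrow> (nat \<Rightarrow> 'a::topological_space measure) \<Rightarrow> 'a measure" where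
  "average N m = measure_of UNIV (sets borel) (\<lambda>A. (\<Sum>i<N. emeasure (m i) A) / of_nat N)"

lemma space_average [simp]: "space (average N m) = UNIV"
  by (simp add: average_def space_measure_of_conv)

lemma sets_average [simp, measurable_cong]: "sets (average N m) = sets borel"
  using sets.sigma_sets_eq[of borel] by (simp add: average_def sets_measure_of_conv)

lemma emeasure_average:
  assumes "\<And>i. i < N \<Longrightarrow> sets (m i) = sets borel" and A: "A \<in> sets borel"
  shows "emeasure (average N m) A = (\<Sum>i<N. emeasure (m i) A) / of_nat N"
  unfolding average_def
proof (rule emeasure_measure_of_sigma)
  show "sigma_algebra UNIV (sets borel)"
    using sets.sigma_algebra_axioms[of borel] by simp
  show "positive (sets borel) (\<lambda>A. (\<Sum>i<N. emeasure (m i) A) / of_nat N)"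
    by (simp add: positive_def)
  show "countably_additive (sets borel) (\<lambda>A. (\<Sum>i<N. emeasure (m i) A) / of_nat N)"
  proof (rule countably_additiveI)
    fix B :: "nat \<Rightarrow> 'a set"
    assume B: "range B \<subseteq> sets borel" "disjoint_family B"
    have "(\<Sum>k. \<Sum>i<N. emeasure (m i) (B k)) = (\<Sum>i<N. \<Sum>k. emeasure (m i) (B k))"
      by (intro suminf_sum) auto
    also have "\<dots> = (\<Sum>i<N. emeasure (m i) (\<Union>k. B k))"
      using B assms(1) by (intro sum.cong refl suminf_emeasure) auto
    finally show "(\<Sum>k. (\<Sum>i<N. emeasure (m i) (B k)) / of_nat N) =
        (\<Sum>i<N. emeasure (m i) (\<Union>k. B k)) / of_nat N"
      by (simp add: ennreal_suminf_divide)
  qed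
qed (rule A)

definition empirical :: "nat \<Rightarrow> (nat \<Rightarrow> 'a::topological_space) \<Rightarrow> 'a measure" where
  "empirical N x = average N (\<lambda>i. return borel (x i))"


section \<open>The limit potential\<close>

definition Prob_marginal ::
  "'a::topological_space measure \<Rightarrow> ('a \<times> 'b::topological_space) measure set" where
  "Prob_marginal m = {\<gamma> \<in> Prob. distr \<gamma> borel fst = m}"

definition mean_interaction ::
  "('b::topological_space \<times> 'b \<Rightarrow> ennreal) \<Rightarrow> 'b measure \<Rightarrow> 'b measure \<Rightarrow> ennreal" where
  "mean_interaction H \<nu> \<nu>' = (\<integral>\<^sup>+ z. H z \<partial>(\<nu> \<Otimes>\<^sub>M \<nu>'))"

definition limit_potential ::
  "'a::topological_space measure \<Rightarrow> ('a \<times> 'b::topological_space \<Rightarrow> ennreal) \<Rightarrow> ('b \<Rightarrow> ennreal) \<Rightarrow>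
   ('b \<times> 'b \<Rightarrow> ennreal) \<Rightarrow> ('a \<times> 'b) measure \<Rightarrow> ennreal" where
  "limit_potential \<mu> c L H \<gamma> =
     (if \<gamma> \<in> Prob_marginal \<mu> then
        let \<nu> = distr \<gamma> borel snd in
        (\<integral>\<^sup>+ z. c z \<partial>\<gamma>) + (\<integral>\<^sup>+ y. L y \<partial>\<nu>) + mean_interaction H \<nu> \<nu>
      else \<infinity>)"


section \<open>The closed-loop potentials of the \<open>N\<close>-player game\<close>

definition mixed_profile ::
  "nat \<Rightarrow> (nat \<Rightarrow> 'a::topological_space) \<Rightarrow> (nat \<Rightarrow> 'b::topological_space measure) \<Rightarrow>
   ('a \<times> 'b) measure" where
  "mixed_profile N x \<nu> = average N (\<lambda>i. return borel (x i) \<Otimes>\<^sub>M \<nu> i)"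

text \<open>If \<open>x 0, \<dots>, x (N-1)\<close> are pairwise distinct, the choice is unique on \<open>{..<N}\<close>
  (lemmas \<open>strategies_unique\<close> and \<open>strategies_exist\<close> below), and only these
  indices are used. For \<open>N = 0\<close> the potentials below are constantly \<open>\<infinity>\<close>, since
  \<open>empirical 0 x\<close> is the zero measure; this does not affect Gamma-convergence.\<close>

definition strategies ::
  "nat \<Rightarrow> (nat \<Rightarrow> 'a::topological_space) \<Rightarrow> ('a \<times> 'b::topological_space) measure \<Rightarrow>
   nat \<Rightarrow> 'b measure" where
  "strategies N x \<gamma> = (SOME \<nu>. (\<forall>i<N. \<nu> i \<in> Prob) \<and> \<gamma> = mixed_profile N x \<nu>)"

definition mixed_potential ::
  "('a::topological_space \<times> 'b::topological_space \<Rightarrow> ennreal) \<Rightarrow> ('b \<Rightarrow> ennreal) \<Rightarrow>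
   ('b \<times> 'b \<Rightarrow> ennreal) \<Rightarrow> (nat \<Rightarrow> 'a) \<Rightarrow> nat \<Rightarrow> ('a \<times> 'b) measure \<Rightarrow> ennreal" where
  "mixed_potential c L H x N \<gamma> =
     (if \<gamma> \<in> Prob_marginal (empirical N x) then
        let \<nu> = strategies N x \<gamma> in
        (\<integral>\<^sup>+ z. c z \<partial>\<gamma>)
        + (\<Sum>i<N. \<integral>\<^sup>+ y. L y \<partial>\<nu> i) / of_nat N
        + (\<Sum>i<N. \<Sum>j\<in>{..<N} - {i}. mean_interaction H (\<nu> i) (\<nu> j)) / (of_nat N)\<^sup>2
      else \<infinity>)"

definition pure_profiles ::
  "nat \<Rightarrow> (nat \<Rightarrow> 'a::topological_space) \<Rightarrow> ('a \<times> 'b::topological_space) measure set" where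
  "pure_profiles N x = {empirical N (\<lambda>i. (x i, y i)) | y. True}"

definition pure_potential ::
  "('a::topological_space \<times> 'b::topological_space \<Rightarrow> ennreal) \<Rightarrow> ('b \<Rightarrow> ennreal) \<Rightarrow>
   ('b \<times> 'b \<Rightarrow> ennreal) \<Rightarrow> (nat \<Rightarrow> 'a) \<Rightarrow> nat \<Rightarrow> ('a \<times> 'b) measure \<Rightarrow> ennreal" where
  "pure_potential c L H x N \<gamma> =
     (if \<gamma> \<in> pure_profiles N x then mixed_potential c L H x N \<gamma> else \<infinity>)"


subsection \<open>Strategies are well defined\<close>

lemma ennreal_divide_of_nat_cancel:
  assumes "(a::ennreal) / of_nat N = b / of_nat N" "N > 0"
  shows "a = b"
proof -
  have "(of_nat N :: ennreal) / of_nat N = 1"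
    using assms(2) by (intro ennreal_divide_self) (auto simp: top.not_eq_extremum[symmetric])
  then have "a / of_nat N * of_nat N = a" "b / of_nat N * of_nat N = b"
    by (simp_all add: ennreal_divide_times)
  then show ?thesis using assms(1) by metis
qed

lemma sets_borel_prod: "sets (borel \<Otimes>\<^sub>M borel) =
    sets (borel :: ('a::second_countable_topology \<times> 'b::second_countable_topology) measure)"
  by (simp only: borel_prod)

lemma emeasure_return_pair:
  fixes x :: "'a::second_countable_topology" and \<nu> :: "'b::second_countable_topology measure"
  assumes "\<nu> \<in> Prob" "A \<in> sets borel"
  shows "emeasure (return borel x \<Otimes>\<^sub>M \<nu>) A = emeasure \<nu> (Pair x -` A)"
proof -
  have [measurable_cong]: "sets \<nu> = sets borel" and "prob_space \<nu>"
    using assms(1) by (auto simp: space_prob_algebra)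
  then interpret prob_space \<nu> by simp
  have A [measurable]: "A \<in> sets (borel \<Otimes>\<^sub>M \<nu>)"
    using assms(2) sets_borel_prod sets_pair_measure_cong[OF refl \<open>sets \<nu> = _\<close>] by blast
  then have A': "A \<in> sets (return borel x \<Otimes>\<^sub>M \<nu>)"
    by (simp cong: sets_pair_measure_cong)
  have "emeasure (return borel x \<Otimes>\<^sub>M \<nu>) A =
      (\<integral>\<^sup>+ x. emeasure \<nu> (Pair x -` A) \<partial>return borel x)"
    by (rule emeasure_pair_measure_alt[OF A'])
  also have "\<dots> = emeasure \<nu> (Pair x -` A)"
    using measurable_emeasure_Pair[OF A] by (intro nn_integral_return) auto
  finally show ?thesis .
qed

lemma sets_return_pair:
  fixes x :: "'a::second_countable_topology" and \<nu> :: "'b::second_countable_topology measure"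
  assumes "\<nu> \<in> Prob"
  shows "sets (return borel x \<Otimes>\<^sub>M \<nu>) = sets borel"
proof -
  have "sets (return borel x \<Otimes>\<^sub>M \<nu>) = sets (borel \<Otimes>\<^sub>M borel)"
    using assms by (intro sets_pair_measure_cong) (auto simp: space_prob_algebra)
  then show ?thesis by (simp only: sets_borel_prod)
qed

lemma emeasure_mixed_profile:
  fixes x :: "nat \<Rightarrow> 'a::second_countable_topology"
    and \<nu> :: "nat \<Rightarrow> 'b::second_countable_topology measure"
  assumes "\<And>i. i < N \<Longrightarrow> \<nu> i \<in> Prob" "A \<in> sets borel"
  shows "emeasure (mixed_profile N x \<nu>) A = (\<Sum>i<N. emeasure (\<nu> i) (Pair (x i) -` A)) / of_nat N"
  unfolding mixed_profile_def
proof (subst emeasure_average)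
  show "sets (return borel (x i) \<Otimes>\<^sub>M \<nu> i) = sets borel" if "i < N" for i
    using sets_return_pair assms(1) that by blast
qed (use assms in \<open>auto simp: emeasure_return_pair\<close>)

lemma strategies_unique:
  fixes x :: "nat \<Rightarrow> 'a::polish_space" and \<nu> \<nu>' :: "nat \<Rightarrow> 'b::polish_space measure"
  assumes inj: "inj_on x {..<N}"
    and \<nu>: "\<And>i. i < N \<Longrightarrow> \<nu> i \<in> Prob" and \<nu>': "\<And>i. i < N \<Longrightarrow> \<nu>' i \<in> Prob"
    and eq: "mixed_profile N x \<nu> = mixed_profile N x \<nu>'" and "i < N"
  shows "\<nu> i = \<nu>' i"
proof (rule measure_eqI)
  show "sets (\<nu> i) = sets (\<nu>' i)"
    using \<nu> \<nu>' \<open>i < N\<close> by (simp add: space_prob_algebra)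
  fix B assume "B \<in> sets (\<nu> i)"
  then have B: "B \<in> sets borel"
    using \<nu> \<open>i < N\<close> by (simp add: space_prob_algebra)
  have *: "emeasure (mixed_profile N x \<rho>) ({x i} \<times> B) = emeasure (\<rho> i) B / of_nat N"
    if \<rho>: "\<And>i. i < N \<Longrightarrow> \<rho> i \<in> Prob" for \<rho> :: "nat \<Rightarrow> 'b measure"
  proof -
    have "{x i} \<times> B \<in> sets (borel \<Otimes>\<^sub>M borel)" using B by (intro pair_measureI) auto
    then have "{x i} \<times> B \<in> sets borel" by (simp only: sets_borel_prod)
    then have "emeasure (mixed_profile N x \<rho>) ({x i} \<times> B) =
        (\<Sum>j<N. emeasure (\<rho> j) (Pair (x j) -` ({x i} \<times> B))) / of_nat N"
      using \<rho> by (intro emeasure_mixed_profile) auto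
    also have "(\<Sum>j<N. emeasure (\<rho> j) (Pair (x j) -` ({x i} \<times> B))) =
        (\<Sum>j<N. if j = i then emeasure (\<rho> i) B else 0)"
    proof (intro sum.cong refl)
      fix j assume "j \<in> {..<N}"
      then show "emeasure (\<rho> j) (Pair (x j) -` ({x i} \<times> B)) = (if j = i then emeasure (\<rho> i) B else 0)"
        using inj_on_eq_iff[OF inj, of j i] \<open>i < N\<close> by (cases "j = i") (auto simp: vimage_def)
    qed
    finally show ?thesis using \<open>i < N\<close> by simp
  qed
  show "emeasure (\<nu> i) B = emeasure (\<nu>' i) B"
    using *[of \<nu>, OF \<nu>] *[of \<nu>', OF \<nu>'] eq \<open>i < N\<close>
    by (auto intro: ennreal_divide_of_nat_cancel[of _ N])
qed

lemma strategies_exist: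
  fixes x :: "nat \<Rightarrow> 'a::polish_space" and \<gamma> :: "('a \<times> 'b::polish_space) measure"
  assumes inj: "inj_on x {..<N}" and "N > 0" and \<gamma>: "\<gamma> \<in> Prob_marginal (empirical N x)"
  shows "\<exists>\<nu>. (\<forall>i<N. \<nu> i \<in> Prob) \<and> \<gamma> = mixed_profile N x \<nu>"
proof -
  have sets [simp, measurable_cong]: "sets \<gamma> = sets borel" and "prob_space \<gamma>"
    and marg: "distr \<gamma> borel fst = empirical N x"
    using \<gamma> by (auto simp: Prob_marginal_def space_prob_algebra)
  then interpret prob_space \<gamma> by simp
  have sp [simp]: "space \<gamma> = UNIV" using sets_eq_imp_space_eq[OF sets] by simp
  have N: "(of_nat N :: ennreal) \<noteq> 0" "(of_nat N :: ennreal) \<noteq> top"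
    using \<open>N > 0\<close> by auto
  have fst [measurable]: "fst \<in> borel_measurable \<gamma>" and snd [measurable]: "snd \<in> borel_measurable \<gamma>"
    using measurable_cong_sets[OF sets refl] borel_measurable_continuous_onI
      continuous_on_fst[OF continuous_on_id] continuous_on_snd[OF continuous_on_id] by blast+
  have R: "A \<times> B \<in> sets borel" if "A \<in> sets borel" "B \<in> sets borel" for A :: "'a set" and B :: "'b set"
    using pair_measureI[OF that] by (simp only: sets_borel_prod)
  have S: "A \<times> (UNIV :: 'b set) \<in> sets borel" if "A \<in> sets borel" for A :: "'a set"
    using R[OF that] by simp
  have emp: "emeasure \<gamma> (A \<times> UNIV) = (\<Sum>j<N. indicator A (x j)) / of_nat N"
    if "A \<in> sets borel" for A
  proof -
    have "emeasure \<gamma> (A \<times> UNIV) = emeasure (distr \<gamma> borel fst) A"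
      using that by (subst emeasure_distr) (auto intro!: arg_cong[of _ _ "emeasure \<gamma>"])
    then show ?thesis
      unfolding marg empirical_def using that by (simp add: emeasure_average)
  qed
  define \<nu> where "\<nu> i = scale_measure (of_nat N)
      (distr (density \<gamma> (indicator ({x i} \<times> UNIV))) borel snd)" for i
  have em: "emeasure (\<nu> i) B = of_nat N * emeasure \<gamma> ({x i} \<times> B)" if B: "B \<in> sets borel" for i B
  proof -
    have "emeasure (distr (density \<gamma> (indicator ({x i} \<times> UNIV))) borel snd) B
        = emeasure (density \<gamma> (indicator ({x i} \<times> UNIV))) (UNIV \<times> B)"
      using B by (subst emeasure_distr) (auto intro!: arg_cong[of _ _ "emeasure _"])
    also have "\<dots> = emeasure \<gamma> (({x i} \<times> UNIV) \<inter> (UNIV \<times> B))"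
      using S[of "{x i}"] B R[of UNIV B] by (intro emeasure_restricted) auto
    also have "({x i} \<times> UNIV) \<inter> (UNIV \<times> B) = {x i} \<times> B" by auto
    finally show ?thesis by (simp add: \<nu>_def)
  qed
  have one: "emeasure \<gamma> ({x i} \<times> UNIV) = 1 / of_nat N" if "i < N" for i
  proof -
    have "(\<Sum>j<N. indicator {x i} (x j) :: ennreal) = (\<Sum>j<N. if j = i then 1 else 0)"
      using that inj by (intro sum.cong) (auto simp: indicator_def inj_on_def)
    then show ?thesis using emp[of "{x i}"] that by simp
  qed
  have \<nu>: "\<nu> i \<in> Prob" if "i < N" for i
  proof -
    have "emeasure (\<nu> i) (space (\<nu> i)) = of_nat N * (1 / of_nat N)"
    proof -
      have "space (\<nu> i) = UNIV" by (simp add: \<nu>_def space_scale_measure)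
      then show ?thesis using em[of UNIV i] one[OF that] by simp
    qed
    also have "\<dots> = 1"
      by (metis N ennreal_times_divide mult_1_right top.not_eq_extremum ennreal_divide_self)
    finally show ?thesis
      by (auto simp: space_prob_algebra \<nu>_def intro!: prob_spaceI)
  qed
  have "\<gamma> = mixed_profile N x \<nu>"
  proof (rule measure_eqI)
    show "sets \<gamma> = sets (mixed_profile N x \<nu>)" by (simp add: mixed_profile_def)
    fix A assume "A \<in> sets \<gamma>"
    then have A [measurable]: "A \<in> sets borel" by simp
    let ?X = "x ` {..<N}"
    have cX: "- ?X \<in> sets borel" and X: "?X \<in> sets borel"
    proof -
      have "closed ?X" by (intro finite_imp_closed finite_imageI finite_lessThan)
      then show "- ?X \<in> sets borel" "?X \<in> sets borel"
        by (auto intro: borel_open borel_closed open_Compl)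
    qed
    have "(\<Sum>j<N. indicator (- ?X) (x j) :: ennreal) = 0"
      by (intro sum.neutral) auto
    then have "emeasure \<gamma> ((- ?X) \<times> UNIV) = 0"
      by (simp only: emp[OF cX] ennreal_zero_divide)
    then have null: "(- ?X) \<times> UNIV \<in> null_sets \<gamma>"
      using S[OF cX] by (intro null_setsI) simp_all
    have "A \<union> (- ?X) \<times> UNIV = (A \<inter> ?X \<times> UNIV) \<union> (- ?X) \<times> UNIV" by auto
    moreover have "emeasure \<gamma> (A \<union> (- ?X) \<times> UNIV) = emeasure \<gamma> A"
      by (rule emeasure_Un_null_set[OF _ null]) (simp add: A)
    moreover have "emeasure \<gamma> ((A \<inter> ?X \<times> UNIV) \<union> (- ?X) \<times> UNIV) = emeasure \<gamma> (A \<inter> ?X \<times> UNIV)"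
      using S[OF X] by (intro emeasure_Un_null_set[OF _ null] sets.Int) (simp_all add: A)
    ultimately have "emeasure \<gamma> A = emeasure \<gamma> (A \<inter> ?X \<times> UNIV)" by metis
    also have "A \<inter> ?X \<times> UNIV = (\<Union>i\<in>{..<N}. A \<inter> {x i} \<times> UNIV)" by auto
    also have "emeasure \<gamma> \<dots> = (\<Sum>i<N. emeasure \<gamma> (A \<inter> {x i} \<times> UNIV))"
    proof (rule sum_emeasure[symmetric])
      show "(\<lambda>i. A \<inter> {x i} \<times> UNIV) ` {..<N} \<subseteq> sets \<gamma>"
        using A S[OF borel_singleton[OF sets.empty_sets]] by (auto intro!: sets.Int)
      show "disjoint_family_on (\<lambda>i. A \<inter> {x i} \<times> UNIV) {..<N}"
        using inj by (fastforce simp: disjoint_family_on_def inj_on_def)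
    qed simp
    also have "\<dots> = (\<Sum>i<N. emeasure (\<nu> i) (Pair (x i) -` A) / of_nat N)"
    proof (intro sum.cong refl)
      fix i
      have "Pair (x i) -` A \<in> sets borel"
        using sets_Pair1[of A borel borel "x i"] A by (simp only: sets_borel_prod)
      then have "emeasure (\<nu> i) (Pair (x i) -` A) = of_nat N * emeasure \<gamma> ({x i} \<times> (Pair (x i) -` A))"
        by (rule em)
      also have "{x i} \<times> (Pair (x i) -` A) = A \<inter> {x i} \<times> UNIV" by auto
      finally show "emeasure \<gamma> (A \<inter> {x i} \<times> UNIV) = emeasure (\<nu> i) (Pair (x i) -` A) / of_nat N"
        by (metis N mult_divide_eq_ennreal mult.commute)
    qed
    also have "\<dots> = emeasure (mixed_profile N x \<nu>) A"
      using emeasure_mixed_profile[OF \<nu> A] by (simp add: divide_ennreal_def sum_distrib_right)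
    finally show "emeasure \<gamma> A = emeasure (mixed_profile N x \<nu>) A" .
  qed
  with \<nu> show ?thesis by blast
qed

end

theory Submission
  imports Defs
begin

text \<open>
Write \<open>z = (x, y)\<close> for a type with its action and \<open>f z = c z + L y\<close> for the individual cost. The
symmetric lower semicontinuous kernel \<open>K (z, z') = (f z + f z') / 2 + H (y, y')\<close> turns the limit
potential of a \<open>\<gamma>\<close> with first marginal \<open>\<mu>\<close> into the quadratic form \<open>\<integral>\<integral> K d\<gamma> d\<gamma>\<close>
(lemma \<open>limit_potential_eq_pair_energy\<close>), and the \<open>N\<close>-player potentials into sums of \<open>K\<close> over
the pairs of distinct players, up to factors that tend to \<open>1\<close>. So both halves of the theorem are
statements about pair sums.

Lower bound. Every lower semicontinuous function is an increasing limit of functions from one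
countable family of bounded Lipschitz functions. Replacing \<open>K\<close> by such a \<open>\<kappa> \<le> K\<close>, the missing
diagonal pairs cost at most \<open>sup \<kappa> / N\<close>, and \<open>\<gamma> \<mapsto> \<integral>\<integral> \<kappa> d\<gamma> d\<gamma>\<close> is lower semicontinuous
(lemma \<open>pair_energy_liminf\<close>). That the limit has first marginal \<open>\<mu>\<close> is the narrow convergence
of the empirical measures of the types.

Upper bound. If \<open>Z i = (X i, Y i)\<close> were i.i.d. with law \<open>\<gamma>\<close>, the empirical measures of \<open>Z\<close> would
converge to \<open>\<gamma>\<close>, and the averages of \<open>K\<close> over pairs would have upper limit at most
\<open>\<integral>\<integral> K d\<gamma> d\<gamma>\<close>. The latter is one half of the strong law for U-statistics with a merely
integrable kernel, which cannot be avoided: if \<open>c\<close> is \<open>0\<close> on the graph of a continuous map and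
\<open>\<infinity>\<close> elsewhere, the actions are forced and the claim amounts to this law for \<open>H\<close>. It is proved in
\<open>U_statistic_upper_law\<close> by truncation and second moments along dyadic blocks, in the way of
Etemadi's proof of the strong law; monotonicity in \<open>N\<close> of the pair sums fills the gaps.
The \<open>Y i\<close> do not live on the given probability space, but only their existence for almost every
\<open>\<omega>\<close> matters. On the countable power of \<open>\<gamma>\<close> the good sequences contain a countable union of compact sets of
full measure, and the projections of these to the types are compact; this gives, for almost every
sequence of types, actions that make a good sequence (lemma \<open>AE_choose_second_coordinates\<close>).

One null set for all \<open>\<gamma>\<close>. The exceptional set above depends on \<open>\<gamma>\<close>, and \<open>c\<close>, \<open>L\<close>, \<open>H\<close> are not
continuous. But the graph of the limit potential, seen through the integrals of the countable family
as a subset of \<open>(nat \<Rightarrow> real) \<times> real\<close>, is separable. Good actions for countably many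
\<open>\<gamma>'\<close>, dense in the sense of the graph, yield recovery sequences for every \<open>\<gamma>\<close> by a diagonal choice
(lemma \<open>recovery_sequence\<close>).
\<close>

section \<open>Lower semicontinuous functions as suprema of countably many Lipschitz functions\<close>

instance prod :: (polish_space, polish_space) polish_space ..

lemma lower_semicontinuous_measurable:
  fixes f :: "'a::topological_space \<Rightarrow> ennreal"
  assumes "lower_semicontinuous f"
  shows "f \<in> borel_measurable borel"
proof (rule borel_measurableI_greater)
  fix y show "{x \<in> space borel. y < f x} \<in> sets borel"
    using assms by (auto simp: lower_semicontinuous_def)
qed

lemma lower_semicontinuous_SUP_continuous:
  fixes g :: "'i \<Rightarrow> 'a::topological_space \<Rightarrow> real"
  assumes "\<And>j. continuous_on UNIV (g j)" "\<And>x. f x = (SUP j\<in>I. ennreal (g j x))"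
  shows "lower_semicontinuous f"
proof -
  have "open {x. a < f x}" for a
  proof -
    have "{x. a < f x} = (\<Union>j\<in>I. (\<lambda>x. ennreal (g j x)) -` {a<..})"
      by (auto simp: assms(2) less_SUP_iff)
    moreover have "open ((\<lambda>x. ennreal (g j x)) -` {a<..})" for j
      by (intro open_vimage continuous_on_ennreal assms(1)) auto
    ultimately show ?thesis by auto
  qed
  then show ?thesis by (simp add: lower_semicontinuous_def)
qed

lemma lower_semicontinuous_ennreal:
  fixes g :: "'a::topological_space \<Rightarrow> real"
  assumes "continuous_on UNIV g"
  shows "lower_semicontinuous (\<lambda>x. ennreal (g x))"
  using assms by (intro lower_semicontinuous_SUP_continuous[of "\<lambda>_. g" _ "{()}"]) auto

lemma lower_semicontinuous_compose:
  assumes "lower_semicontinuous f" "continuous_on UNIV h"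
  shows "lower_semicontinuous (\<lambda>x. f (h x))"
  unfolding lower_semicontinuous_def
proof
  fix a
  have "{x. a < f (h x)} = h -` {y. a < f y}" by auto
  moreover have "open (h -` {y. a < f y})"
    using assms by (intro open_vimage) (auto simp: lower_semicontinuous_def)
  ultimately show "open {x. a < f (h x)}" by simp
qed

lemma lower_semicontinuous_half:
  assumes "lower_semicontinuous (f :: 'a::topological_space \<Rightarrow> ennreal)"
  shows "lower_semicontinuous (\<lambda>x. f x / 2)"
proof -
  have two: "2 * (y / 2) = y" for y :: ennreal
    using mult_divide_eq_ennreal[of 2 y] by (simp add: ennreal_times_divide mult.commute)
  have "a < y / 2 \<longleftrightarrow> 2 * a < y" for a y :: ennreal
  proof
    assume "a < y / 2"
    then have "2 * a < 2 * (y / 2)" by (intro ennreal_mult_strict_left_mono) auto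
    then show "2 * a < y" by (simp only: two)
  next
    assume *: "2 * a < y"
    show "a < y / 2"
    proof (rule ccontr)
      assume "\<not> a < y / 2"
      then have "2 * (y / 2) \<le> 2 * a" by (intro mult_left_mono) auto
      then show False using * by (simp only: two)
    qed
  qed
  then show ?thesis using assms by (simp add: lower_semicontinuous_def)
qed

text \<open>
The Lipschitz bound is written without subtraction, so that \<open>F\<close> may take the value \<open>\<infinity>\<close>.
\<close>

lemma lower_semicontinuous_of_Lipschitz:
  fixes F :: "'a::metric_space \<Rightarrow> ennreal"
  assumes L: "\<And>x y. F x \<le> F y + ennreal (C * dist x y)" and C: "0 \<le> C"
  shows "lower_semicontinuous F"
  unfolding lower_semicontinuous_def
proof
  fix a
  show "open {x. a < F x}"
    unfolding open_dist
  proof (intro ballI)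
    fix x assume "x \<in> {x. a < F x}"
    then obtain b where b: "a < b" "b < F x" using dense by auto
    obtain s where s: "a = ennreal s" "0 \<le> s" using b by (cases a) auto
    obtain t where t: "b = ennreal t" "0 \<le> t" using b by (cases b) auto
    have st: "s < t" using b s t by (simp add: ennreal_less_iff)
    show "\<exists>e>0. \<forall>y. dist y x < e \<longrightarrow> y \<in> {x. a < F x}"
    proof (intro exI[of _ "(t - s) / (C + 1)"] conjI allI impI)
      fix y assume y: "dist y x < (t - s) / (C + 1)"
      have "(C + 1) * dist y x \<le> t - s" using y C by (simp add: field_simps)
      then have "C * dist x y + dist x y \<le> t - s" by (simp add: distrib_right dist_commute)
      then have Ct: "C * dist x y \<le> t - s" using zero_le_dist[of x y] by linarith
      show "y \<in> {x. a < F x}"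
      proof (rule ccontr)
        assume "y \<notin> {x. a < F x}"
        then have "F x \<le> a + ennreal (C * dist x y)" using L[of x y] by (auto simp: not_less intro: order_trans add_right_mono)
        also have "\<dots> = ennreal (s + C * dist x y)" using s C by simp
        also have "\<dots> \<le> b" unfolding t(1) using Ct by (intro ennreal_leI) simp
        finally show False using b by simp
      qed
    qed (use st C in auto)
  qed
qed

text \<open>
A cone of height \<open>q\<close> and slope \<open>m\<close> over the ball of radius \<open>q / m\<close> around \<open>d\<close>. With rational heights,
natural slopes and centres in a dense set there are only countably many.
\<close>

definition bump :: "'a::metric_space \<times> rat \<times> nat \<Rightarrow> 'a \<Rightarrow> real" where
  "bump = (\<lambda>(d, q, m) x. max 0 (real_of_rat q - real m * dist x d))"

primrec bump_max :: "('a::metric_space \<times> rat \<times> nat) list \<Rightarrow> 'a \<Rightarrow> real" where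
  "bump_max [] = (\<lambda>_. 0)"
| "bump_max (p # ps) = (\<lambda>x. max (bump p x) (bump_max ps x))"

definition dense_set :: "'a::polish_space set" where
  "dense_set = (SOME D. countable D \<and> (\<forall>U. open U \<longrightarrow> U \<noteq> {} \<longrightarrow> (\<exists>d\<in>D. d \<in> U)))"

lemma dense_set: "countable (dense_set :: 'a::polish_space set)"
  "open U \<Longrightarrow> U \<noteq> {} \<Longrightarrow> \<exists>d\<in>dense_set. d \<in> (U :: 'a set)"
proof -
  have "\<exists>D :: 'a set. countable D \<and> (\<forall>U. open U \<longrightarrow> U \<noteq> {} \<longrightarrow> (\<exists>d\<in>D. d \<in> U))"
    using countable_dense_setE by metis
  from someI_ex[OF this] show "countable (dense_set :: 'a::polish_space set)"
    "open U \<Longrightarrow> U \<noteq> {} \<Longrightarrow> \<exists>d\<in>dense_set. d \<in> (U :: 'a set)"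
    unfolding dense_set_def by blast+
qed

text \<open>
Finite maxima of cones: a countable family, closed under maxima, of nonnegative bounded Lipschitz
functions.
\<close>

definition test_functions :: "('a::polish_space \<Rightarrow> real) set" where
  "test_functions = bump_max ` lists (dense_set \<times> UNIV \<times> UNIV)"

lemma countable_test_functions: "countable (test_functions :: ('a::polish_space \<Rightarrow> real) set)"
  unfolding test_functions_def by (intro countable_image countable_lists countable_SIGMA dense_set) auto

lemma test_functions_nonempty: "test_functions \<noteq> {}"
  by (auto simp: test_functions_def)

lemma bump_bounds: "0 \<le> bump p x" "bump p x \<le> \<bar>real_of_rat (fst (snd p))\<bar>"
proof -
  have "0 \<le> real (snd (snd p)) * dist x (fst p)" by simp
  then show "0 \<le> bump p x" "bump p x \<le> \<bar>real_of_rat (fst (snd p))\<bar>"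
    unfolding bump_def case_prod_beta by linarith+
qed

text \<open>
The one-sided inequality for all \<open>x\<close>, \<open>y\<close> is the Lipschitz property; it is the form in which it
passes to maxima and to integrals with values in \<open>ennreal\<close>.
\<close>

lemma bump_Lipschitz: "bump p x \<le> bump p y + real (snd (snd p)) * dist x y"
proof -
  have "real (snd (snd p)) * dist y (fst p) \<le> real (snd (snd p)) * (dist x (fst p) + dist x y)"
    using dist_triangle[of y "fst p" x] by (intro mult_left_mono) (auto simp: dist_commute)
  moreover have "0 \<le> real (snd (snd p)) * dist x y" by simp
  ultimately show ?thesis unfolding bump_def case_prod_beta by (simp add: algebra_simps max_def)
qed

lemma test_function_bounded_Lipschitz:
  assumes "g \<in> test_functions"
  obtains B C where "0 \<le> C" "\<And>x. 0 \<le> g x" "\<And>x. g x \<le> B" "\<And>x y. g x \<le> g y + C * dist x y"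
proof -
  obtain ps where "g = bump_max ps" using assms by (auto simp: test_functions_def)
  moreover have "\<exists>B C. 0 \<le> C \<and> (\<forall>x. 0 \<le> bump_max ps x \<and> bump_max ps x \<le> B) \<and>
    (\<forall>x y. bump_max ps x \<le> bump_max ps y + C * dist x y)"
  proof (induction ps)
    case Nil
    show ?case by (intro exI[of _ 0]) simp
  next
    case (Cons p ps)
    then obtain B C where C: "0 \<le> C" and B: "\<And>x. 0 \<le> bump_max ps x" "\<And>x. bump_max ps x \<le> B"
      and L: "\<And>x y. bump_max ps x \<le> bump_max ps y + C * dist x y" by blast
    let ?C = "real (snd (snd p)) + C"
    have "bump p x \<le> bump p y + ?C * dist x y" "bump_max ps x \<le> bump_max ps y + ?C * dist x y" for x y
    proof -
      have "0 \<le> C * dist x y" "0 \<le> real (snd (snd p)) * dist x y" using C by simp_all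
      then show "bump p x \<le> bump p y + ?C * dist x y" "bump_max ps x \<le> bump_max ps y + ?C * dist x y"
        using bump_Lipschitz[of p x y] L[of x y] unfolding distrib_right by linarith+
    qed
    then have "bump_max (p # ps) x \<le> bump_max (p # ps) y + ?C * dist x y" for x y
      unfolding bump_max.simps max_add_distrib_left by (rule max.mono)
    moreover have "0 \<le> bump_max (p # ps) x \<and> bump_max (p # ps) x \<le> max \<bar>real_of_rat (fst (snd p))\<bar> B" for x
      using B[of x] bump_bounds[of p x] by (auto simp: max_def)
    ultimately show ?case using C by (intro exI[of _ "max \<bar>real_of_rat (fst (snd p))\<bar> B"] exI[of _ ?C]) auto
  qed
  ultimately show ?thesis using that by blast
qed

lemma Lipschitz_continuous:
  fixes g :: "'a::metric_space \<Rightarrow> real"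
  assumes "0 \<le> C" and L: "\<And>x y. g x \<le> g y + C * dist x y"
  shows "continuous_on UNIV g"
proof -
  have "C-lipschitz_on UNIV g"
  proof (rule lipschitz_onI)
    fix x y show "dist (g x) (g y) \<le> C * dist x y"
      using L[of x y] L[of y x] by (auto simp: dist_real_def abs_le_iff dist_commute)
  qed fact
  then show ?thesis by (rule lipschitz_on_continuous_on)
qed

lemma test_function_continuous: "g \<in> test_functions \<Longrightarrow> continuous_on UNIV g"
  by (metis Lipschitz_continuous test_function_bounded_Lipschitz)

lemma test_function_nonneg: "g \<in> test_functions \<Longrightarrow> 0 \<le> g x"
  by (metis test_function_bounded_Lipschitz)

lemma test_function_bounded: "g \<in> test_functions \<Longrightarrow> bounded (range g)"
  by (rule test_function_bounded_Lipschitz[of g]) (auto simp: bounded_iff intro!: exI)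

lemma max_test_functions:
  assumes "g \<in> test_functions" "h \<in> test_functions"
  shows "(\<lambda>x. max (g x) (h x)) \<in> test_functions"
proof -
  obtain ps qs where ps: "ps \<in> lists (dense_set \<times> UNIV \<times> UNIV)" "g = bump_max ps"
    and qs: "qs \<in> lists (dense_set \<times> UNIV \<times> UNIV)" "h = bump_max qs"
    using assms by (auto simp: test_functions_def)
  have "bump_max (ps @ qs) = (\<lambda>x. max (bump_max ps x) (bump_max qs x))"
  proof (induction ps)
    case Nil
    have "0 \<le> bump_max qs x" for x using test_function_nonneg[OF assms(2)] qs by simp
    then show ?case by (simp add: max_absorb2)
  qed (simp add: max.assoc)
  then have "(\<lambda>x. max (g x) (h x)) = bump_max (ps @ qs)" using ps qs by simp
  moreover have "ps @ qs \<in> lists (dense_set \<times> UNIV \<times> UNIV)" using ps qs by simp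
  ultimately show ?thesis unfolding test_functions_def by (rule image_eqI)
qed

text \<open>
Near \<open>x\<close> the function \<open>f\<close> stays above some \<open>b > a\<close>. A cone of height between \<open>a\<close> and \<open>b\<close> that is steep enough
has its support in that neighbourhood, and its value at \<open>x\<close> still exceeds \<open>a\<close> if its centre is
close to \<open>x\<close>.
\<close>

lemma test_function_below:
  fixes f :: "'a::polish_space \<Rightarrow> ennreal"
  assumes f: "lower_semicontinuous f" and a: "a < f x"
  obtains g where "g \<in> test_functions" "\<And>y. ennreal (g y) \<le> f y" "a < ennreal (g x)"
proof -
  obtain b where b: "a < b" "b < f x" using a dense by blast
  obtain s where s: "a = ennreal s" "0 \<le> s" using b by (cases a) auto
  obtain t where t: "b = ennreal t" "0 \<le> t" using b by (cases b) auto
  have "s < t" using b s t by (simp add: ennreal_less_iff)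
  then obtain q where q: "s < real_of_rat q" "real_of_rat q < t" using of_rat_dense by blast
  have "open {y. b < f y}" using f by (simp add: lower_semicontinuous_def)
  then obtain r where r: "0 < r" "\<And>y. dist y x < r \<Longrightarrow> b < f y"
    using b openE by (metis mem_Collect_eq open_dist)
  \<comment> \<open>With this slope the cone has radius below \<open>r / 2\<close>; its centre will lie within \<open>r / 2\<close> of \<open>x\<close>.\<close>
  obtain m :: nat where m: "real_of_rat q / (r / 2) < real m" using reals_Archimedean2 by blast
  have m0: "0 < real m" using m q s r by (meson divide_nonneg_pos half_gt_zero le_less_trans less_imp_le)
  define \<delta> where "\<delta> = min (r / 2) ((real_of_rat q - s) / real m)"
  have "0 < \<delta>" using r q m0 by (simp add: \<delta>_def)
  then obtain d where d: "d \<in> dense_set" "d \<in> ball x \<delta>" using dense_set(2)[of "ball x \<delta>"] by auto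
  have dx: "dist x d < r / 2" "real m * dist x d < real_of_rat q - s"
    using d m0 by (auto simp: \<delta>_def field_simps)
  have "bump_max [(d, q, m)] \<in> test_functions" using d unfolding test_functions_def by (intro imageI) auto
  moreover have "ennreal (bump_max [(d, q, m)] y) \<le> f y" for y
  proof (cases "dist y x < r")
    case True
    have "bump_max [(d, q, m)] y \<le> t"
    proof -
      have "0 \<le> real m * dist y d" by simp
      then show ?thesis using q s t unfolding bump_max.simps bump_def prod.case by linarith
    qed
    then have "ennreal (bump_max [(d, q, m)] y) \<le> b" using t by (simp add: ennreal_leI)
    then show ?thesis using r(2)[OF True] by simp
  next
    case False
    have "r / 2 \<le> dist y d" using False dx dist_triangle[of y x d] by (simp add: dist_commute)
    then have "real m * (r / 2) \<le> real m * dist y d" by (intro mult_left_mono) auto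
    moreover have "real_of_rat q < real m * (r / 2)" using m r by (simp add: field_simps)
    ultimately have "bump_max [(d, q, m)] y = 0" by (simp add: bump_def)
    then show ?thesis by simp
  qed
  moreover have "a < ennreal (bump_max [(d, q, m)] x)"
    using dx s q by (simp add: bump_def ennreal_less_iff)
  ultimately show ?thesis using that by blast
qed

text \<open>
By \<open>test_function_below\<close>, \<open>f\<close> is the pointwise supremum of the test functions below it. There
are countably many of them, and running maxima make the supremum monotone.
\<close>

lemma lower_semicontinuous_approx:
  fixes f :: "'a::polish_space \<Rightarrow> ennreal"
  assumes f: "lower_semicontinuous f"
  obtains g where "\<And>j :: nat. g j \<in> test_functions" "\<And>x. incseq (\<lambda>j. g j x)"
    "\<And>x. f x = (SUP j. ennreal (g j x))"
proof -
  define S where "S = {g \<in> test_functions. \<forall>y. ennreal (g y) \<le> f y}"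
  have "(\<lambda>_. 0) \<in> S" unfolding S_def test_functions_def by (auto intro!: image_eqI[of _ _ "[]"])
  moreover have "countable S" unfolding S_def by (rule countable_subset[OF _ countable_test_functions]) auto
  ultimately obtain e :: "nat \<Rightarrow> 'a \<Rightarrow> real" where e: "range e = S"
    by (metis empty_iff uncountable_def)
  define g where "g = rec_nat (e 0) (\<lambda>j h x. max (h x) (e (Suc j) x))"
  have g_simps: "g 0 = e 0" "\<And>j. g (Suc j) = (\<lambda>x. max (g j x) (e (Suc j) x))" by (simp_all add: g_def)
  have eS: "e j \<in> S" for j using e by auto
  have gS: "g j \<in> S" for j
  proof (induction j)
    case (Suc j)
    then show ?case using eS[of "Suc j"] max_test_functions unfolding S_def g_simps
      by (auto simp: max_def)
  qed (use eS g_simps in simp)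
  have ge: "e j x \<le> g j x" for j x by (cases j) (auto simp: g_simps)
  have "f x = (SUP j. ennreal (g j x))" for x
  proof (rule antisym)
    show "f x \<le> (SUP j. ennreal (g j x))"
    proof (rule dense_le)
      fix a assume "a < f x"
      then obtain h where "h \<in> S" "a < ennreal (h x)"
        unfolding S_def by (elim test_function_below[OF f]) blast
      then obtain j where "a < ennreal (e j x)" using e by blast
      then have "a \<le> ennreal (g j x)" using ge[of j x] by (meson ennreal_leI less_imp_le order_trans)
      then show "a \<le> (SUP j. ennreal (g j x))" by (rule SUP_upper2[rotated]) simp
    qed
    show "(SUP j. ennreal (g j x)) \<le> f x" using gS by (intro SUP_least) (auto simp: S_def)
  qed
  moreover have "incseq (\<lambda>j. g j x)" for x by (intro incseq_SucI) (simp add: g_simps)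
  ultimately show ?thesis using that[of g] gS by (auto simp: S_def)
qed

text \<open>
Increasing approximations from below by continuous functions may be added termwise.
\<close>

lemma lower_semicontinuous_add:
  fixes f g :: "'a::polish_space \<Rightarrow> ennreal"
  assumes "lower_semicontinuous f" "lower_semicontinuous g"
  shows "lower_semicontinuous (\<lambda>x. f x + g x)"
proof -
  obtain u where u: "\<And>j :: nat. u j \<in> test_functions" "\<And>x. incseq (\<lambda>j. u j x)" "\<And>x. f x = (SUP j. ennreal (u j x))"
    using lower_semicontinuous_approx[OF assms(1)] by metis
  obtain v where v: "\<And>j :: nat. v j \<in> test_functions" "\<And>x. incseq (\<lambda>j. v j x)" "\<And>x. g x = (SUP j. ennreal (v j x))"
    using lower_semicontinuous_approx[OF assms(2)] by metis
  show ?thesis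
  proof (rule lower_semicontinuous_SUP_continuous[of "\<lambda>j x. u j x + v j x" _ UNIV])
    show "continuous_on UNIV (\<lambda>x. u j x + v j x)" for j
      using u v by (intro continuous_on_add test_function_continuous)
    show "f x + g x = (SUP j. ennreal (u j x + v j x))" for x
      using u(2)[of x] v(2)[of x] test_function_nonneg[OF u(1)] test_function_nonneg[OF v(1)]
      by (simp add: u(3) v(3) ennreal_plus) (intro ennreal_SUP_add[symmetric]; auto simp: incseq_def ennreal_leI)
  qed
qed

section \<open>Narrow convergence through test functions\<close>

lemma ProbD:
  assumes "M \<in> (Prob :: 'a::topological_space measure set)"
  shows "prob_space M" "sets M = sets borel" "space M = UNIV"
  using assms sets_eq_imp_space_eq[of M borel] by (auto simp: space_prob_algebra)

lemma test_function_nn_integral: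
  assumes "M \<in> Prob" "g \<in> test_functions"
  shows "(\<integral>\<^sup>+ x. ennreal (g x) \<partial>M) = ennreal (\<integral> x. g x \<partial>M)"
proof -
  interpret prob_space M using assms ProbD by auto
  obtain B where "\<And>x. 0 \<le> g x" "\<And>x. g x \<le> B" using test_function_bounded_Lipschitz[OF assms(2)] by metis
  moreover have "g \<in> borel_measurable M"
    using borel_measurable_continuous_onI[OF test_function_continuous[OF assms(2)]] ProbD(2)[OF assms(1)]
    by (simp cong: measurable_cong_sets)
  ultimately show ?thesis
    by (intro nn_integral_eq_integral integrable_const_bound[of _ B]) auto
qed

text \<open>
The easy half of the portmanteau theorem, from the test functions alone: monotone convergence
writes \<open>\<integral> f dM\<close> as a supremum of integrals of test functions below \<open>f\<close>.
\<close>

lemma nn_integral_lower_semicontinuous_liminf: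
  fixes f :: "'a::polish_space \<Rightarrow> ennreal"
  assumes M: "sets M = sets borel" and f: "lower_semicontinuous f"
    and test: "\<And>g. g \<in> test_functions \<Longrightarrow> (\<integral>\<^sup>+ x. ennreal (g x) \<partial>M) \<le> liminf (\<lambda>n. \<integral>\<^sup>+ x. ennreal (g x) \<partial>(z n))"
  shows "(\<integral>\<^sup>+ x. f x \<partial>M) \<le> liminf (\<lambda>n. \<integral>\<^sup>+ x. f x \<partial>(z n))"
proof -
  obtain g where g: "\<And>j :: nat. g j \<in> test_functions" "\<And>x. incseq (\<lambda>j. g j x)" "\<And>x. f x = (SUP j. ennreal (g j x))"
    using lower_semicontinuous_approx[OF f] by metis
  have gm: "(\<lambda>x. ennreal (g j x)) \<in> borel_measurable M" for j
    using borel_measurable_continuous_onI[OF test_function_continuous[OF g(1)]] M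
    by (simp cong: measurable_cong_sets)
  have "(\<integral>\<^sup>+ x. f x \<partial>M) = (SUP j. \<integral>\<^sup>+ x. ennreal (g j x) \<partial>M)"
    unfolding g(3) using g(2) gm
    by (intro nn_integral_monotone_convergence_SUP) (auto simp: incseq_def le_fun_def ennreal_leI)
  also have "\<dots> \<le> liminf (\<lambda>n. \<integral>\<^sup>+ x. f x \<partial>(z n))"
  proof (rule SUP_least)
    fix j
    have "liminf (\<lambda>n. \<integral>\<^sup>+ x. ennreal (g j x) \<partial>(z n)) \<le> liminf (\<lambda>n. \<integral>\<^sup>+ x. f x \<partial>(z n))"
      unfolding g(3) by (intro Liminf_mono always_eventually allI nn_integral_mono SUP_upper) simp
    then show "(\<integral>\<^sup>+ x. ennreal (g j x) \<partial>M) \<le> liminf (\<lambda>n. \<integral>\<^sup>+ x. f x \<partial>(z n))"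
      using test[OF g(1)] by (rule order_trans[rotated])
  qed
  finally show ?thesis .
qed

lemma narrow_limit_test_function:
  assumes z: "range z \<subseteq> Prob" and lim: "limitin narrow_topology z M sequentially" and g: "g \<in> test_functions"
  shows "(\<integral>\<^sup>+ x. ennreal (g x) \<partial>M) \<le> liminf (\<lambda>n. \<integral>\<^sup>+ x. ennreal (g x) \<partial>(z n))"
proof -
  have M: "M \<in> Prob" and "(\<lambda>n. \<integral>x. g x \<partial>(z n)) \<longlonglongrightarrow> (\<integral>x. g x \<partial>M)"
    using lim test_function_continuous[OF g] test_function_bounded[OF g] unfolding limitin_narrow_topology[OF z] by auto
  then have "(\<lambda>n. \<integral>\<^sup>+ x. ennreal (g x) \<partial>(z n)) \<longlonglongrightarrow> (\<integral>\<^sup>+ x. ennreal (g x) \<partial>M)"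
    using z by (subst (1 2) test_function_nn_integral[OF _ g]) (auto intro!: tendsto_ennrealI)
  then show ?thesis by (simp add: lim_imp_Liminf)
qed

lemma narrow_limit_liminf:
  fixes f :: "'a::polish_space \<Rightarrow> ennreal"
  assumes z: "range z \<subseteq> Prob" and lim: "limitin narrow_topology z M sequentially" and f: "lower_semicontinuous f"
  shows "(\<integral>\<^sup>+ x. f x \<partial>M) \<le> liminf (\<lambda>n. \<integral>\<^sup>+ x. f x \<partial>(z n))"
proof -
  have M: "M \<in> Prob" using lim unfolding limitin_narrow_topology[OF z] by simp
  show ?thesis
    by (rule nn_integral_lower_semicontinuous_liminf[OF ProbD(2)[OF M] f])
      (rule narrow_limit_test_function[OF z lim])
qed

text \<open>
One-sided information on nonnegative test functions suffices for narrow convergence: for \<open>\<bar>f\<bar> \<le> B\<close>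
continuous, both \<open>f + B\<close> and \<open>- f + B\<close> are nonnegative and lower semicontinuous, and their lower
bounds are the two halves of the convergence of \<open>\<integral> f\<close>.
\<close>

lemma narrow_limitI:
  fixes M :: "'a::polish_space measure"
  assumes z: "range z \<subseteq> Prob" and M: "M \<in> Prob"
    and test: "\<And>g. g \<in> test_functions \<Longrightarrow> (\<integral>\<^sup>+ x. ennreal (g x) \<partial>M) \<le> liminf (\<lambda>n. \<integral>\<^sup>+ x. ennreal (g x) \<partial>(z n))"
  shows "limitin narrow_topology z M sequentially"
proof -
  have lower: "\<forall>\<^sub>F n in sequentially. a < (\<integral> x. f x \<partial>(z n))"
    if f: "continuous_on UNIV f" "bounded (range f)" and a: "a < (\<integral> x. f x \<partial>M)" for f :: "'a \<Rightarrow> real" and a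
  proof -
    obtain B where B: "\<And>x. \<bar>f x\<bar> \<le> B" using f(2) by (auto simp: bounded_iff)
    have eq: "(\<integral>\<^sup>+ x. ennreal (f x + B) \<partial>P) = ennreal ((\<integral> x. f x \<partial>P) + B)"
      and ge: "- B \<le> (\<integral> x. f x \<partial>P)" if P: "P \<in> Prob" for P
    proof -
      interpret prob_space P using P ProbD by auto
      have [measurable]: "f \<in> borel_measurable P"
        using borel_measurable_continuous_onI[OF f(1)] ProbD(2)[OF P] by (simp cong: measurable_cong_sets)
      have int: "integrable P f" using B by (intro integrable_const_bound[of _ B]) auto
      have nonneg: "0 \<le> f x + B" for x using B[of x] by (simp add: abs_le_iff)
      have "(\<integral>\<^sup>+ x. ennreal (f x + B) \<partial>P) = ennreal (\<integral> x. f x + B \<partial>P)"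
        using int nonneg by (intro nn_integral_eq_integral) auto
      then show "(\<integral>\<^sup>+ x. ennreal (f x + B) \<partial>P) = ennreal ((\<integral> x. f x \<partial>P) + B)"
        using int by (simp add: prob_space)
      have "0 \<le> (\<integral> x. f x + B \<partial>P)" using nonneg by (intro integral_nonneg_AE) auto
      then show "- B \<le> (\<integral> x. f x \<partial>P)" using int by (simp add: prob_space)
    qed
    have "lower_semicontinuous (\<lambda>x. ennreal (f x + B))"
      using f(1) by (intro lower_semicontinuous_ennreal continuous_intros)
    from nn_integral_lower_semicontinuous_liminf[OF ProbD(2)[OF M] this test]
    have le: "ennreal ((\<integral> x. f x \<partial>M) + B) \<le> liminf (\<lambda>n. ennreal ((\<integral> x. f x \<partial>(z n)) + B))"
      using eq M z by (simp add: image_subset_iff)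
    \<comment> \<open>\<open>ennreal\<close> truncates negative reals to \<open>0\<close>, so levels \<open>a\<close> below \<open>- B\<close> are treated apart.\<close>
    have "ennreal (max 0 (a + B)) < ennreal ((\<integral> x. f x \<partial>M) + B) \<or> a < - B"
      using a by (auto simp: ennreal_less_iff)
    then show ?thesis
    proof
      assume "a < - B"
      then show ?thesis using ge z by (intro always_eventually allI) (auto simp: image_subset_iff intro: less_le_trans)
    next
      assume "ennreal (max 0 (a + B)) < ennreal ((\<integral> x. f x \<partial>M) + B)"
      then have "ennreal (max 0 (a + B)) < liminf (\<lambda>n. ennreal ((\<integral> x. f x \<partial>(z n)) + B))"
        using le by (rule less_le_trans)
      then have "\<forall>\<^sub>F n in sequentially. ennreal (max 0 (a + B)) < ennreal ((\<integral> x. f x \<partial>(z n)) + B)"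
        by (rule less_LiminfD)
      then show ?thesis
      proof eventually_elim
        case (elim n)
        then have "max 0 (a + B) < (\<integral> x. f x \<partial>(z n)) + B" by (subst (asm) ennreal_less_iff) auto
        then show ?case by simp
      qed
    qed
  qed
  show ?thesis
    unfolding limitin_narrow_topology[OF z]
  proof (intro conjI M allI impI order_tendstoI lower)
    fix f :: "'a \<Rightarrow> real" and a
    assume f: "continuous_on UNIV f" "bounded (range f)" and a: "(\<integral> x. f x \<partial>M) < a"
    have "bounded (range (\<lambda>x. - f x))" using f(2) by (auto simp: bounded_iff)
    then have "\<forall>\<^sub>F n in sequentially. - a < (\<integral> x. - f x \<partial>(z n))"
      using f a by (intro lower continuous_on_minus) auto
    then show "\<forall>\<^sub>F n in sequentially. (\<integral> x. f x \<partial>(z n)) < a" by simp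
  qed auto
qed

text \<open>
Indicators of open sets are lower semicontinuous, hence determined by test functions, and open sets
form a generator of the Borel sets that is stable under intersection.
\<close>

lemma Prob_eqI_test_functions:
  fixes M M' :: "'a::polish_space measure"
  assumes M: "M \<in> Prob" "M' \<in> Prob"
    and eq: "\<And>g. g \<in> test_functions \<Longrightarrow> (\<integral> x. g x \<partial>M) = (\<integral> x. g x \<partial>M')"
  shows "M = M'"
proof (rule measure_eqI_generator_eq[of "{U. open U}" UNIV _ _ "\<lambda>_. UNIV"])
  have le: "emeasure P U \<le> emeasure P' U"
    if U: "open U" and P: "P \<in> Prob" "P' \<in> Prob" and eq: "\<And>g. g \<in> test_functions \<Longrightarrow> (\<integral> x. g x \<partial>P) = (\<integral> x. g x \<partial>P')"
    for U and P P' :: "'a measure"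
  proof -
    have "lower_semicontinuous (indicator U :: 'a \<Rightarrow> ennreal)"
      unfolding lower_semicontinuous_def
    proof
      fix a :: ennreal
      have "{x. a < indicator U x} = (if a < 1 then if a < 0 then UNIV else U else {})"
        by (auto simp: indicator_def)
      then show "open {x. a < indicator U x}" using U by simp
    qed
    from nn_integral_lower_semicontinuous_liminf[OF ProbD(2)[OF P(1)] this, of "\<lambda>_. P'"]
    have "(\<integral>\<^sup>+ x. indicator U x \<partial>P) \<le> (\<integral>\<^sup>+ x. indicator U x \<partial>P')"
      using eq P by (simp add: test_function_nn_integral Liminf_const)
    then show ?thesis using U ProbD(2)[OF P(1)] ProbD(2)[OF P(2)] by simp
  qed
  show "emeasure M U = emeasure M' U" if "U \<in> {U. open U}" for U
    using le[of U M M'] le[of U M' M] that M eq by (simp add: antisym)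
  show "sets M = sigma_sets UNIV {U. open U}" "sets M' = sigma_sets UNIV {U. open U}"
    using ProbD(2)[OF M(1)] ProbD(2)[OF M(2)] by (simp_all add: borel_def)
  interpret prob_space M using M ProbD by auto
  show "emeasure M UNIV \<noteq> \<infinity>" by simp
qed (auto simp: Int_stable_def)

text \<open>
The coordinates that embed the probability measures, with the narrow topology, into the separable metric
space \<open>nat \<Rightarrow> real\<close>.
\<close>

definition test_vector :: "'a::polish_space measure \<Rightarrow> nat \<Rightarrow> real" where
  "test_vector M k = (\<integral> x. from_nat_into test_functions k x \<partial>M)"

lemma range_from_nat_into_test_functions:
  "range (from_nat_into test_functions) = (test_functions :: ('a::polish_space \<Rightarrow> real) set)"
  using countable_test_functions test_functions_nonempty by (rule range_from_nat_into[rotated])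

lemma limitin_narrow_iff_test_vector:
  fixes M :: "'a::polish_space measure"
  assumes z: "range z \<subseteq> Prob" and M: "M \<in> Prob"
  shows "limitin narrow_topology z M sequentially \<longleftrightarrow> (\<lambda>n. test_vector (z n)) \<longlonglongrightarrow> test_vector M"
proof -
  have "(\<lambda>n. test_vector (z n)) \<longlonglongrightarrow> test_vector M \<longleftrightarrow> (\<forall>k. (\<lambda>n. test_vector (z n) k) \<longlonglongrightarrow> test_vector M k)"
    using limitin_componentwise[of "\<lambda>_::nat. euclidean :: real topology" UNIV "\<lambda>n. test_vector (z n)" "test_vector M" sequentially]
    by (simp add: euclidean_product_topology)
  also have "\<dots> \<longleftrightarrow> (\<forall>g\<in>test_functions. (\<lambda>n. \<integral> x. g x \<partial>(z n)) \<longlonglongrightarrow> (\<integral> x. g x \<partial>M))"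
    unfolding test_vector_def by (subst (3) range_from_nat_into_test_functions[symmetric]) simp
  also have "\<dots> \<longleftrightarrow> limitin narrow_topology z M sequentially"
  proof
    assume conv: "\<forall>g\<in>test_functions. (\<lambda>n. \<integral> x. g x \<partial>(z n)) \<longlonglongrightarrow> (\<integral> x. g x \<partial>M)"
    show "limitin narrow_topology z M sequentially"
    proof (rule narrow_limitI[OF z M])
      fix g :: "'a \<Rightarrow> real" assume g: "g \<in> test_functions"
      have "(\<lambda>n. \<integral>\<^sup>+ x. ennreal (g x) \<partial>(z n)) \<longlonglongrightarrow> (\<integral>\<^sup>+ x. ennreal (g x) \<partial>M)"
        using z M g conv by (subst (1 2) test_function_nn_integral[OF _ g]) (auto intro!: tendsto_ennrealI)
      then show "(\<integral>\<^sup>+ x. ennreal (g x) \<partial>M) \<le> liminf (\<lambda>n. \<integral>\<^sup>+ x. ennreal (g x) \<partial>(z n))"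
        by (simp add: lim_imp_Liminf)
    qed
  next
    assume "limitin narrow_topology z M sequentially"
    then show "\<forall>g\<in>test_functions. (\<lambda>n. \<integral> x. g x \<partial>(z n)) \<longlonglongrightarrow> (\<integral> x. g x \<partial>M)"
      unfolding limitin_narrow_topology[OF z] by (simp add: test_function_continuous test_function_bounded)
  qed
  finally show ?thesis by simp
qed

section \<open>Lower semicontinuity of pair energies\<close>

text \<open>
Iterated, so that limits and averages can be taken in one variable while the other one is frozen.
\<close>

definition pair_energy :: "('z \<times> 'z \<Rightarrow> ennreal) \<Rightarrow> 'z measure \<Rightarrow> 'z measure \<Rightarrow> ennreal" where
  "pair_energy k M M' = (\<integral>\<^sup>+ z. \<integral>\<^sup>+ z'. k (z, z') \<partial>M' \<partial>M)"

text \<open>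
Narrow convergence of \<open>z n\<close> gives convergence of the product measures without tightness: the
functions \<open>F n x = \<integral> \<kappa> (x, y) d(z n)(y)\<close> are Lipschitz with one constant, so their tail infima
\<open>I m\<close> are Lipschitz too and can be integrated against \<open>z n\<close> in the limit, for each fixed \<open>m\<close>;
and \<open>I m\<close> increases to at least \<open>\<integral> \<kappa> (x, y) dM(y)\<close>.
\<close>

lemma pair_integral_liminf:
  fixes M :: "'a::polish_space measure" and \<kappa> :: "'a \<times> 'a \<Rightarrow> real"
  assumes z: "range z \<subseteq> Prob" and lim: "limitin narrow_topology z M sequentially" and \<kappa>: "\<kappa> \<in> test_functions"
  shows "(\<integral>\<^sup>+ x. \<integral>\<^sup>+ y. \<kappa> (x, y) \<partial>M \<partial>M) \<le> liminf (\<lambda>n. \<integral>\<^sup>+ x. \<integral>\<^sup>+ y. \<kappa> (x, y) \<partial>(z n) \<partial>(z n))"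
proof -
  have M: "M \<in> Prob" using lim unfolding limitin_narrow_topology[OF z] by simp
  obtain C where C: "0 \<le> C" and L: "\<And>p q. \<kappa> p \<le> \<kappa> q + C * dist p q" and \<kappa>0: "\<And>p. 0 \<le> \<kappa> p"
    using test_function_bounded_Lipschitz[OF \<kappa>] by metis
  define F where "F n x = (\<integral>\<^sup>+ y. \<kappa> (x, y) \<partial>(z n))" for n x
  define I where "I m x = (INF n\<in>{m..}. F n x)" for m x
  have FL: "F n x \<le> F n x' + ennreal (C * dist x x')" for n x x'
  proof -
    have P: "z n \<in> Prob" using z by auto
    interpret prob_space "z n" using P ProbD by auto
    have "continuous_on UNIV (\<lambda>y. \<kappa> (x', y))"
      by (intro continuous_on_compose2[OF test_function_continuous[OF \<kappa>]] continuous_intros) auto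
    then have [measurable]: "(\<lambda>y. \<kappa> (x', y)) \<in> borel_measurable (z n)"
      using borel_measurable_continuous_onI ProbD(2)[OF P] by (auto cong: measurable_cong_sets)
    have "F n x \<le> (\<integral>\<^sup>+ y. ennreal (\<kappa> (x', y)) + ennreal (C * dist x x') \<partial>(z n))"
      unfolding F_def
    proof (intro nn_integral_mono)
      fix y
      have "\<kappa> (x, y) \<le> \<kappa> (x', y) + C * dist x x'"
        using L[of "(x, y)" "(x', y)"] by (simp add: dist_Pair_Pair)
      then have "ennreal (\<kappa> (x, y)) \<le> ennreal (\<kappa> (x', y) + C * dist x x')" by (rule ennreal_leI)
      also have "\<dots> = ennreal (\<kappa> (x', y)) + ennreal (C * dist x x')"
        by (rule ennreal_plus) (use C \<kappa>0 in auto)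
      finally show "ennreal (\<kappa> (x, y)) \<le> ennreal (\<kappa> (x', y)) + ennreal (C * dist x x')" .
    qed
    also have "\<dots> = F n x' + ennreal (C * dist x x')"
      unfolding F_def by (subst nn_integral_add) (auto simp: emeasure_space_1)
    finally show ?thesis .
  qed
  have IL: "I m x \<le> I m x' + ennreal (C * dist x x')" for m x x'
  proof -
    have "I m x \<le> (INF n\<in>{m..}. F n x' + ennreal (C * dist x x'))"
      unfolding I_def by (intro INF_mono) (use FL in blast)
    also have "\<dots> = I m x' + ennreal (C * dist x x')"
    proof -
      have "{m..} = range (\<lambda>n. n + m)" using image_add_atLeast[of m 0] by (simp add: add.commute)
      then show ?thesis unfolding I_def by (simp add: image_image INF_ennreal_add_const)
    qed
    finally show ?thesis .
  qed
  have Ilsc: "lower_semicontinuous (I m)" for m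
    by (rule lower_semicontinuous_of_Lipschitz[OF IL C])
  have Im: "I m \<in> borel_measurable M" for m
    using lower_semicontinuous_measurable[OF Ilsc] ProbD(2)[OF M] by (simp cong: measurable_cong_sets)
  have inc: "incseq I" by (auto simp: incseq_def le_fun_def I_def intro!: INF_superset_mono)
  have "(\<integral>\<^sup>+ y. \<kappa> (x, y) \<partial>M) \<le> (SUP m. I m x)" for x
  proof -
    have "lower_semicontinuous (\<lambda>y. ennreal (\<kappa> (x, y)))"
      by (intro lower_semicontinuous_ennreal continuous_on_compose2[OF test_function_continuous[OF \<kappa>]]
          continuous_intros subset_UNIV)
    then have "(\<integral>\<^sup>+ y. \<kappa> (x, y) \<partial>M) \<le> liminf (\<lambda>n. F n x)"
      unfolding F_def by (rule narrow_limit_liminf[OF z lim])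
    then show ?thesis by (simp add: liminf_SUP_INF I_def)
  qed
  then have "(\<integral>\<^sup>+ x. \<integral>\<^sup>+ y. \<kappa> (x, y) \<partial>M \<partial>M) \<le> (\<integral>\<^sup>+ x. (SUP m. I m x) \<partial>M)"
    by (intro nn_integral_mono)
  also have "\<dots> = (SUP m. \<integral>\<^sup>+ x. I m x \<partial>M)"
    by (intro nn_integral_monotone_convergence_SUP inc Im)
  also have "\<dots> \<le> liminf (\<lambda>n. \<integral>\<^sup>+ x. F n x \<partial>(z n))"
  proof (rule SUP_least)
    fix m
    have "(\<integral>\<^sup>+ x. I m x \<partial>M) \<le> liminf (\<lambda>n. \<integral>\<^sup>+ x. I m x \<partial>(z n))"
      by (rule narrow_limit_liminf[OF z lim Ilsc])
    also have "\<dots> \<le> liminf (\<lambda>n. \<integral>\<^sup>+ x. F n x \<partial>(z n))"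
    proof (intro Liminf_mono eventually_sequentiallyI[of m] nn_integral_mono)
      show "I m x \<le> F n x" if "m \<le> n" for n x using that unfolding I_def by (intro INF_lower) simp
    qed
    finally show "(\<integral>\<^sup>+ x. I m x \<partial>M) \<le> liminf (\<lambda>n. \<integral>\<^sup>+ x. F n x \<partial>(z n))" .
  qed
  finally show ?thesis unfolding F_def .
qed

text \<open>
The quantity \<open>U n\<close> need only dominate the energies of bounded kernels below \<open>K\<close> up to an error
\<open>B / n\<close>. This room absorbs the diagonal, where \<open>K\<close> itself may be infinite.
\<close>

lemma pair_energy_liminf:
  fixes M :: "'a::polish_space measure" and K :: "'a \<times> 'a \<Rightarrow> ennreal" and U :: "nat \<Rightarrow> ennreal"
  assumes z: "range z \<subseteq> Prob" and lim: "limitin narrow_topology z M sequentially" and K: "lower_semicontinuous K"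
    and U: "\<And>\<kappa> B. \<kappa> \<in> test_functions \<Longrightarrow> (\<And>p. ennreal (\<kappa> p) \<le> K p) \<Longrightarrow> (\<And>p. \<kappa> p \<le> B) \<Longrightarrow>
      \<forall>\<^sub>F n in sequentially. (\<integral>\<^sup>+ x. \<integral>\<^sup>+ y. \<kappa> (x, y) \<partial>(z n) \<partial>(z n)) \<le> U n + ennreal (B / real n)"
  shows "(\<integral>\<^sup>+ x. \<integral>\<^sup>+ y. K (x, y) \<partial>M \<partial>M) \<le> liminf U"
proof -
  have M: "M \<in> Prob" using lim unfolding limitin_narrow_topology[OF z] by simp
  interpret prob_space M using M ProbD by auto
  note [measurable_cong] = ProbD(2)[OF M]
  obtain \<kappa> where \<kappa>: "\<And>j :: nat. \<kappa> j \<in> test_functions" "\<And>p. incseq (\<lambda>j. \<kappa> j p)" "\<And>p. K p = (SUP j. ennreal (\<kappa> j p))"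
    using lower_semicontinuous_approx[OF K] by metis
  have [measurable]: "\<kappa> j \<in> borel_measurable (borel \<Otimes>\<^sub>M borel)" for j
    unfolding borel_prod by (intro borel_measurable_continuous_onI test_function_continuous \<kappa>)
  have inner: "(\<integral>\<^sup>+ y. K (x, y) \<partial>M) = (SUP j. \<integral>\<^sup>+ y. \<kappa> j (x, y) \<partial>M)" for x
    unfolding \<kappa>(3) using \<kappa>(2)
    by (intro nn_integral_monotone_convergence_SUP) (auto simp: incseq_def le_fun_def ennreal_leI)
  have "(\<integral>\<^sup>+ x. \<integral>\<^sup>+ y. K (x, y) \<partial>M \<partial>M) = (SUP j. \<integral>\<^sup>+ x. \<integral>\<^sup>+ y. \<kappa> j (x, y) \<partial>M \<partial>M)"
    unfolding inner using \<kappa>(2)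
    by (intro nn_integral_monotone_convergence_SUP) (auto simp: incseq_def le_fun_def intro!: nn_integral_mono ennreal_leI)
  also have "\<dots> \<le> liminf U"
  proof (rule SUP_least)
    fix j
    obtain B where B: "\<And>p. \<kappa> j p \<le> B" using test_function_bounded_Lipschitz[OF \<kappa>(1)] by metis
    have le: "ennreal (\<kappa> j p) \<le> K p" for p unfolding \<kappa>(3) by (intro SUP_upper) simp
    show "(\<integral>\<^sup>+ x. \<integral>\<^sup>+ y. \<kappa> j (x, y) \<partial>M \<partial>M) \<le> liminf U"
    proof (rule ennreal_le_epsilon)
      fix e :: real assume e: "0 < e"
      have "(\<lambda>n. B / real n) \<longlonglongrightarrow> 0" by (rule lim_const_over_n)
      then have "\<forall>\<^sub>F n in sequentially. B / real n < e" using e by (rule order_tendstoD)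
      with U[OF \<kappa>(1) le B] have ev: "\<forall>\<^sub>F n in sequentially. (\<integral>\<^sup>+ x. \<integral>\<^sup>+ y. \<kappa> j (x, y) \<partial>(z n) \<partial>(z n)) \<le> ennreal e + U n"
      proof eventually_elim
        case (elim n)
        note elim(1)
        also have "U n + ennreal (B / real n) \<le> U n + ennreal e"
          using elim(2) by (intro add_left_mono ennreal_leI) simp
        finally show ?case by (simp add: add.commute)
      qed
      have "(\<integral>\<^sup>+ x. \<integral>\<^sup>+ y. \<kappa> j (x, y) \<partial>M \<partial>M) \<le> liminf (\<lambda>n. \<integral>\<^sup>+ x. \<integral>\<^sup>+ y. \<kappa> j (x, y) \<partial>(z n) \<partial>(z n))"
        by (rule pair_integral_liminf[OF z lim \<kappa>(1)])
      also have "\<dots> \<le> liminf (\<lambda>n. ennreal e + U n)" by (rule Liminf_mono[OF ev])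
      also have "\<dots> = ennreal e + liminf U"
        by (rule Liminf_const_add) auto
      finally show "(\<integral>\<^sup>+ x. \<integral>\<^sup>+ y. \<kappa> j (x, y) \<partial>M \<partial>M) \<le> liminf U + ennreal e" by (simp add: add.commute)
    qed
  qed
  finally show ?thesis .
qed

section \<open>Second moments of sums over pairs\<close>

definition off_diagonal :: "nat \<Rightarrow> (nat \<times> nat) set" where
  "off_diagonal n = {(i, j). i < n \<and> j < n \<and> i \<noteq> j}"

lemma finite_off_diagonal [simp]: "finite (off_diagonal n)"
  by (rule finite_subset[of _ "{..<n} \<times> {..<n}"]) (auto simp: off_diagonal_def)

lemma off_diagonal_eq_Sigma: "off_diagonal n = (SIGMA i:{..<n}. {..<n} - {i})"
  by (auto simp: off_diagonal_def)

lemma card_off_diagonal: "card (off_diagonal n) = n * (n - 1)"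
  by (simp add: off_diagonal_eq_Sigma)

lemma off_diagonal_mono: "n \<le> n' \<Longrightarrow> off_diagonal n \<subseteq> off_diagonal n'"
  by (auto simp: off_diagonal_def)

lemma ennreal_half_double: "((x::ennreal) + x) / 2 = x"
  using mult_divide_eq_ennreal[of 2 x] by (simp add: mult_2_right)

lemma sum_off_diagonal_pairs:
  fixes a :: "nat \<Rightarrow> ennreal" and h :: "nat \<Rightarrow> nat \<Rightarrow> ennreal"
  shows "(\<Sum>i<N. \<Sum>j\<in>{..<N} - {i}. (a i + a j) / 2 + h i j) =
    of_nat (N - 1) * (\<Sum>i<N. a i) + (\<Sum>i<N. \<Sum>j\<in>{..<N} - {i}. h i j)"
proof -
  have set: "{..<N} - {i} = {j. j \<in> {..<N} \<and> j \<noteq> i}" for i by auto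
  have s1: "(\<Sum>i<N. \<Sum>j\<in>{..<N} - {i}. a i) = of_nat (N - 1) * (\<Sum>i<N. a i)"
    by (simp add: sum_distrib_left)
  have "(\<Sum>i<N. \<Sum>j\<in>{..<N} - {i}. a j) = (\<Sum>j<N. \<Sum>i\<in>{..<N} - {j}. a j)"
    unfolding set using sum.swap_restrict[where A = "{..<N}" and B = "{..<N}" and g = "\<lambda>i j. a j" and R = "\<lambda>i j. j \<noteq> i"] by (simp add: eq_commute)
  then have s2: "(\<Sum>i<N. \<Sum>j\<in>{..<N} - {i}. a j) = of_nat (N - 1) * (\<Sum>i<N. a i)"
    using s1 by simp
  have "(\<Sum>i<N. \<Sum>j\<in>{..<N} - {i}. (a i + a j) / 2) =
      ((\<Sum>i<N. \<Sum>j\<in>{..<N} - {i}. a i) + (\<Sum>i<N. \<Sum>j\<in>{..<N} - {i}. a j)) / 2"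
    unfolding divide_ennreal_def by (simp only: sum.distrib sum_distrib_right distrib_right)
  then show ?thesis unfolding s1 s2 ennreal_half_double by (simp add: sum.distrib)
qed

text \<open>
The measure \<open>N\<close> only carries the \<open>\<sigma>\<close>-algebra of the values; \<open>\<gamma>\<close> is their common law.
\<close>

locale iid_sequence = prob_space M for M :: "'w measure" +
  fixes N \<gamma> :: "'z measure" and Z :: "nat \<Rightarrow> 'w \<Rightarrow> 'z"
  assumes indep: "indep_vars (\<lambda>_. N) Z UNIV"
    and law: "\<And>i. distr M N (Z i) = \<gamma>"
begin

lemma sets_law [measurable_cong]: "sets \<gamma> = sets N"
  by (metis law sets_distr)

lemma Z_measurable [measurable]: "Z i \<in> measurable M N"
  using indep by (simp add: indep_vars_def)

lemma prob_space_law: "prob_space \<gamma>"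
  using prob_space_distr[OF Z_measurable] law by metis

lemma indep_var_pairs:
  fixes f g :: "'z \<times> 'z \<Rightarrow> real"
  assumes [measurable]: "f \<in> borel_measurable (N \<Otimes>\<^sub>M N)" "g \<in> borel_measurable (N \<Otimes>\<^sub>M N)"
    and "{i, j} \<inter> {k, l} = {}"
  shows "indep_var borel (\<lambda>\<omega>. f (Z i \<omega>, Z j \<omega>)) borel (\<lambda>\<omega>. g (Z k \<omega>, Z l \<omega>))"
proof -
  have "indep_var (PiM {i, j} (\<lambda>_. N)) (\<lambda>\<omega>. restrict (\<lambda>i. Z i \<omega>) {i, j})
      (PiM {k, l} (\<lambda>_. N)) (\<lambda>\<omega>. restrict (\<lambda>i. Z i \<omega>) {k, l})"
    using indep assms(3) by (intro indep_var_restrict) auto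
  then have "indep_var borel ((\<lambda>v. f (v i, v j)) \<circ> (\<lambda>\<omega>. restrict (\<lambda>i. Z i \<omega>) {i, j}))
      borel ((\<lambda>v. g (v k, v l)) \<circ> (\<lambda>\<omega>. restrict (\<lambda>i. Z i \<omega>) {k, l}))"
    by (rule indep_var_compose) measurable
  then show ?thesis by (simp add: comp_def)
qed

lemma pair_law:
  assumes "i \<noteq> j"
  shows "distr M (N \<Otimes>\<^sub>M N) (\<lambda>\<omega>. (Z i \<omega>, Z j \<omega>)) = \<gamma> \<Otimes>\<^sub>M \<gamma>"
proof -
  have "indep_var (PiM {i} (\<lambda>_. N)) (\<lambda>\<omega>. restrict (\<lambda>i. Z i \<omega>) {i})
      (PiM {j} (\<lambda>_. N)) (\<lambda>\<omega>. restrict (\<lambda>i. Z i \<omega>) {j})"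
    using indep assms by (intro indep_var_restrict) auto
  then have "indep_var N ((\<lambda>v. v i) \<circ> (\<lambda>\<omega>. restrict (\<lambda>i. Z i \<omega>) {i}))
      N ((\<lambda>v. v j) \<circ> (\<lambda>\<omega>. restrict (\<lambda>i. Z i \<omega>) {j}))"
    by (rule indep_var_compose) measurable
  then have "indep_var N (Z i) N (Z j)" by (simp add: comp_def)
  then show ?thesis by (simp add: indep_var_distribution_eq law)
qed

text \<open>
The indices within one pair may coincide. With \<open>i = j\<close> this describes three independent variables,
the first of them taken twice, while both components keep the same type.
\<close>

lemma joint_law_pairs:
  assumes "{i, j} \<inter> {k, l} = {}"
  shows "distr M ((N \<Otimes>\<^sub>M N) \<Otimes>\<^sub>M (N \<Otimes>\<^sub>M N)) (\<lambda>\<omega>. ((Z i \<omega>, Z j \<omega>), (Z k \<omega>, Z l \<omega>))) =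
    distr M (N \<Otimes>\<^sub>M N) (\<lambda>\<omega>. (Z i \<omega>, Z j \<omega>)) \<Otimes>\<^sub>M distr M (N \<Otimes>\<^sub>M N) (\<lambda>\<omega>. (Z k \<omega>, Z l \<omega>))"
proof -
  have "indep_var (PiM {i, j} (\<lambda>_. N)) (\<lambda>\<omega>. restrict (\<lambda>i. Z i \<omega>) {i, j})
      (PiM {k, l} (\<lambda>_. N)) (\<lambda>\<omega>. restrict (\<lambda>i. Z i \<omega>) {k, l})"
    using indep assms by (intro indep_var_restrict) auto
  then have "indep_var (N \<Otimes>\<^sub>M N) ((\<lambda>v. (v i, v j)) \<circ> (\<lambda>\<omega>. restrict (\<lambda>i. Z i \<omega>) {i, j}))
      (N \<Otimes>\<^sub>M N) ((\<lambda>v. (v k, v l)) \<circ> (\<lambda>\<omega>. restrict (\<lambda>i. Z i \<omega>) {k, l}))"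
    by (rule indep_var_compose) measurable
  then show ?thesis by (simp add: comp_def indep_var_distribution_eq)
qed

lemma nn_integral_pair:
  assumes [measurable]: "f \<in> borel_measurable (N \<Otimes>\<^sub>M N)" and "i \<noteq> j"
  shows "(\<integral>\<^sup>+ \<omega>. f (Z i \<omega>, Z j \<omega>) \<partial>M) = (\<integral>\<^sup>+ p. f p \<partial>(\<gamma> \<Otimes>\<^sub>M \<gamma>))"
  unfolding pair_law[OF assms(2), symmetric] by (subst nn_integral_distr) auto

lemma nn_integral_single:
  assumes [measurable]: "f \<in> borel_measurable N"
  shows "(\<integral>\<^sup>+ \<omega>. f (Z i \<omega>) \<partial>M) = (\<integral>\<^sup>+ z. f z \<partial>\<gamma>)"
  unfolding law[of i, symmetric] by (subst nn_integral_distr) auto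

lemma integral_pair:
  fixes f :: "'z \<times> 'z \<Rightarrow> real"
  assumes [measurable]: "f \<in> borel_measurable (N \<Otimes>\<^sub>M N)" and "i \<noteq> j"
  shows "(\<integral> \<omega>. f (Z i \<omega>, Z j \<omega>) \<partial>M) = (\<integral> p. f p \<partial>(\<gamma> \<Otimes>\<^sub>M \<gamma>))"
  unfolding pair_law[OF assms(2), symmetric] by (subst integral_distr) auto

lemma integral_common_index:
  fixes f :: "'z \<times> 'z \<Rightarrow> real"
  assumes f [measurable]: "f \<in> borel_measurable (N \<Otimes>\<^sub>M N)" and f0: "\<And>p. 0 \<le> f p" and fB: "\<And>p. f p \<le> B"
    and "i \<noteq> j" "i \<noteq> l" "j \<noteq> l"
  shows "(\<integral> \<omega>. f (Z i \<omega>, Z j \<omega>) * f (Z i \<omega>, Z l \<omega>) \<partial>M) = (\<integral> z. (\<integral> z'. f (z, z') \<partial>\<gamma>)\<^sup>2 \<partial>\<gamma>)"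
proof -
  interpret G: prob_space \<gamma> by (rule prob_space_law)
  interpret GG: pair_prob_space \<gamma> \<gamma> ..
  have bd: "norm (f p * f q) \<le> B * B" for p q
    using mult_mono[of "f p" B "f q" B] fB[of p] fB[of q] f0[of p] f0[of q] by (simp add: abs_mult)
  \<comment> \<open>The shared variable is doubled so that the two independent blocks are pairs of the same type.\<close>
  define D where "D = distr M (N \<Otimes>\<^sub>M N) (\<lambda>\<omega>. (Z i \<omega>, Z i \<omega>))"
  have [measurable_cong]: "sets D = sets (N \<Otimes>\<^sub>M N)" by (simp add: D_def)
  interpret D: prob_space D unfolding D_def by (rule prob_space_distr) measurable
  interpret T: pair_prob_space D "\<gamma> \<Otimes>\<^sub>M \<gamma>" ..
  have "D \<Otimes>\<^sub>M (\<gamma> \<Otimes>\<^sub>M \<gamma>) = distr M ((N \<Otimes>\<^sub>M N) \<Otimes>\<^sub>M (N \<Otimes>\<^sub>M N)) (\<lambda>\<omega>. ((Z i \<omega>, Z i \<omega>), (Z j \<omega>, Z l \<omega>)))"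
    using joint_law_pairs[of i i j l] pair_law[of j l] assms(4-6) by (simp add: D_def)
  then have "(\<integral> \<omega>. f (Z i \<omega>, Z j \<omega>) * f (Z i \<omega>, Z l \<omega>) \<partial>M) =
      (\<integral> t. f (fst (fst t), fst (snd t)) * f (fst (fst t), snd (snd t)) \<partial>(D \<Otimes>\<^sub>M (\<gamma> \<Otimes>\<^sub>M \<gamma>)))"
    by (simp add: integral_distr)
  also have "\<dots> = (\<integral> p. (\<integral> q. f (fst p, fst q) * f (fst p, snd q) \<partial>(\<gamma> \<Otimes>\<^sub>M \<gamma>)) \<partial>D)"
    using bd by (subst T.integral_fst'[symmetric]) (auto intro!: T.P.integrable_const_bound[of _ "B*B"])
  also have "\<dots> = (\<integral> z. (\<integral> q. f (z, fst q) * f (z, snd q) \<partial>(\<gamma> \<Otimes>\<^sub>M \<gamma>)) \<partial>\<gamma>)"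
  proof -
    have "distr D N fst = \<gamma>"
      unfolding D_def by (subst distr_distr) (auto simp: comp_def law)
    moreover have "(\<integral> z. (\<integral> q. f (z, fst q) * f (z, snd q) \<partial>(\<gamma> \<Otimes>\<^sub>M \<gamma>)) \<partial>(distr D N fst)) =
        (\<integral> p. (\<integral> q. f (fst p, fst q) * f (fst p, snd q) \<partial>(\<gamma> \<Otimes>\<^sub>M \<gamma>)) \<partial>D)"
      by (intro integral_distr) measurable
    ultimately show ?thesis by simp
  qed
  also have "\<dots> = (\<integral> z. (\<integral> z'. f (z, z') \<partial>\<gamma>)\<^sup>2 \<partial>\<gamma>)"
  proof (intro Bochner_Integration.integral_cong refl)
    fix z assume "z \<in> space \<gamma>"
    then have [measurable]: "(\<lambda>z'. f (z, z')) \<in> borel_measurable N"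
      using sets_eq_imp_space_eq[OF sets_law] by simp
    have int: "integrable (\<gamma> \<Otimes>\<^sub>M \<gamma>) (\<lambda>q. f (z, fst q) * f (z, snd q))"
      using bd by (intro GG.P.integrable_const_bound[of _ "B*B"]) auto
    show "(\<integral> q. f (z, fst q) * f (z, snd q) \<partial>(\<gamma> \<Otimes>\<^sub>M \<gamma>)) = (\<integral> z'. f (z, z') \<partial>\<gamma>)\<^sup>2"
      using GG.integral_fst'[OF int] by (simp add: power2_eq_square)
  qed
  finally show ?thesis .
qed

text \<open>
A pair sum of \<open>n\<^sup>2\<close> terms has variance of order \<open>n\<^sup>2 a + n\<^sup>3 b\<close>: disjoint pairs are
uncorrelated, pairs with one common index have covariance at most \<open>b\<close>, and equal pairs at most \<open>a\<close>.
\<close>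

lemma second_moment_pair_sum:
  fixes f :: "'z \<times> 'z \<Rightarrow> real" and n :: nat
  assumes f [measurable]: "f \<in> borel_measurable (N \<Otimes>\<^sub>M N)" and f0: "\<And>p. 0 \<le> f p" and fB: "\<And>p. f p \<le> B"
    and sym: "\<And>z z'. f (z, z') = f (z', z)"
  defines "m \<equiv> \<integral> p. f p \<partial>(\<gamma> \<Otimes>\<^sub>M \<gamma>)"
    and "a \<equiv> \<integral> p. (f p)\<^sup>2 \<partial>(\<gamma> \<Otimes>\<^sub>M \<gamma>)"
    and "b \<equiv> \<integral> z. (\<integral> z'. f (z, z') \<partial>\<gamma>)\<^sup>2 \<partial>\<gamma>"
  shows "(\<integral> \<omega>. (\<Sum>(i, j)\<in>off_diagonal n. f (Z i \<omega>, Z j \<omega>) - m)\<^sup>2 \<partial>M)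
    \<le> real n ^ 2 * (2 * a + 4 * real n * b)"
proof -
  let ?I = "off_diagonal n"
  define X where "X i j \<omega> = f (Z i \<omega>, Z j \<omega>)" for i j \<omega>
  have X [measurable]: "X i j \<in> borel_measurable M" for i j unfolding X_def by measurable
  have Xs: "X i j = X j i" for i j unfolding X_def using sym by auto
  have bd: "norm (X i j \<omega>) \<le> B" "norm (X i j \<omega> * X k l \<omega>) \<le> B * B" for i j k l \<omega>
    unfolding X_def using fB[of "(Z i \<omega>, Z j \<omega>)"] fB[of "(Z k \<omega>, Z l \<omega>)"]
      f0[of "(Z i \<omega>, Z j \<omega>)"] f0[of "(Z k \<omega>, Z l \<omega>)"] by (auto simp: abs_mult intro!: mult_mono)
  have int [simp]: "integrable M (X i j)" "integrable M (\<lambda>\<omega>. X i j \<omega> * X k l \<omega>)" for i j k l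
    by (rule integrable_const_bound[of _ B] integrable_const_bound[of _ "B*B"]; use bd in simp)+
  have EX: "(\<integral> \<omega>. X i j \<omega> \<partial>M) = m" if "i \<noteq> j" for i j
    unfolding X_def m_def using that by (rule integral_pair[OF f])
  define cov where "cov i j k l = (\<integral> \<omega>. (X i j \<omega> - m) * (X k l \<omega> - m) \<partial>M)" for i j k l
  have m0: "0 \<le> m" unfolding m_def using f0 by simp
  have a0: "0 \<le> a" and b0: "0 \<le> b" unfolding a_def b_def by simp_all
  have cov_eq: "cov i j k l = (\<integral> \<omega>. X i j \<omega> * X k l \<omega> \<partial>M) - m\<^sup>2" if "i \<noteq> j" "k \<noteq> l" for i j k l
  proof -
    have "cov i j k l = (\<integral> \<omega>. X i j \<omega> * X k l \<omega> - m * X i j \<omega> - m * X k l \<omega> + m\<^sup>2 \<partial>M)"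
      unfolding cov_def by (intro Bochner_Integration.integral_cong) (auto simp: algebra_simps power2_eq_square)
    also have "\<dots> = (\<integral> \<omega>. X i j \<omega> * X k l \<omega> \<partial>M) - m\<^sup>2"
      using EX that by (simp add: power2_eq_square prob_space)
    finally show ?thesis .
  qed
  have diag: "cov i j i j \<le> a" if "i \<noteq> j" for i j
  proof -
    have "(\<integral> \<omega>. X i j \<omega> * X i j \<omega> \<partial>M) = a"
      unfolding X_def a_def power2_eq_square using that by (intro integral_pair) measurable
    then show ?thesis using that by (simp add: cov_eq)
  qed
  have common: "cov i j i l \<le> b" if "i \<noteq> j" "i \<noteq> l" "j \<noteq> l" for i j l
  proof -
    have "(\<integral> \<omega>. X i j \<omega> * X i l \<omega> \<partial>M) = b"
      unfolding X_def b_def using that by (intro integral_common_index[OF f f0 fB])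
    then show ?thesis using that by (simp add: cov_eq)
  qed
  have disj: "cov i j k l = 0" if "i \<noteq> j" "k \<noteq> l" "{i, j} \<inter> {k, l} = {}" for i j k l
    using indep_var_lebesgue_integral[OF indep_var_pairs[OF f f that(3)]] int(1) EX that
    by (simp add: cov_eq X_def[abs_def] power2_eq_square)
  have cs: "cov i j k l = cov j i k l" "cov i j k l = cov i j l k" for i j k l
    unfolding cov_def by (simp_all add: Xs[of i j] Xs[of k l])
  \<comment> \<open>Indicators do the counting: summed over \<open>k, l < n\<close>, those after \<open>a\<close> give \<open>2\<close> and
    those after \<open>b\<close> give \<open>4 n\<close>.\<close>
  have cov_le: "cov i j k l \<le> a * (of_bool (k = i \<and> l = j) + of_bool (k = j \<and> l = i)) +
      b * (of_bool (k = i) + of_bool (k = j) + of_bool (l = i) + of_bool (l = j))"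
    if ij: "i \<noteq> j" "k \<noteq> l" for i j k l
  proof -
    consider "k = i" "l = j" | "k = j" "l = i" | "k = i" "l \<noteq> j" | "k = j" "l \<noteq> i"
      | "l = i" "k \<noteq> j" | "l = j" "k \<noteq> i" | "{i, j} \<inter> {k, l} = {}" by auto
    then show ?thesis
    proof cases
      case 1 then show ?thesis using diag[OF ij(1)] a0 b0 ij by simp
    next
      case 2 then show ?thesis using diag[OF ij(1)] cs(2)[of i j j i] a0 b0 ij by simp
    next
      case 3 then show ?thesis using common[of i j l] a0 b0 ij by auto
    next
      case 4 then show ?thesis using common[of j i l] cs(1)[of i j j l] a0 b0 ij by auto
    next
      case 5 then show ?thesis using common[of i j k] cs(2)[of i j k i] a0 b0 ij by auto
    next
      case 6 then show ?thesis using common[of j i k] cs(2)[of i j k j] cs(1)[of i j j k] a0 b0 ij by auto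
    next
      case 7 then show ?thesis using disj[OF ij 7] a0 b0 by auto
    qed
  qed
  have inner: "(\<Sum>(k, l)\<in>?I. cov i j k l) \<le> 2 * a + 4 * real n * b" if ij: "i < n" "j < n" "i \<noteq> j" for i j
  proof -
    let ?h = "\<lambda>k l. a * (of_bool (k = i \<and> l = j) + of_bool (k = j \<and> l = i)) +
      b * (of_bool (k = i) + of_bool (k = j) + of_bool (l = i) + of_bool (l = j)) :: real"
    have "(\<Sum>(k, l)\<in>?I. cov i j k l) \<le> (\<Sum>(k, l)\<in>?I. ?h k l)"
      using cov_le ij by (intro sum_mono) (auto simp: off_diagonal_def)
    also have "\<dots> \<le> (\<Sum>(k, l)\<in>{..<n} \<times> {..<n}. ?h k l)"
      using a0 b0 by (intro sum_mono2) (auto simp: off_diagonal_def)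
    also have "\<dots> = (\<Sum>k<n. \<Sum>l<n. ?h k l)" by (simp add: sum.cartesian_product)
    also have "\<dots> = 2 * a + 4 * real n * b"
    proof -
      have one: "(\<Sum>l<n. of_bool (l = u) :: real) = 1" if "u < n" for u
        using that by (simp add: of_bool_def)
      have two: "(\<Sum>k<n. \<Sum>l<n. of_bool (k = u \<and> l = v) :: real) = 1" if "u < n" "v < n" for u v
        using one that by (simp add: of_bool_conj flip: sum_distrib_left sum_distrib_right)
      show ?thesis
        using one two ij by (simp add: sum.distrib flip: sum_distrib_left sum_distrib_right)
    qed
    finally show ?thesis .
  qed
  have "(\<integral> \<omega>. (\<Sum>(i, j)\<in>?I. f (Z i \<omega>, Z j \<omega>) - m)\<^sup>2 \<partial>M) =
      (\<integral> \<omega>. (\<Sum>p\<in>?I. \<Sum>q\<in>?I. (X (fst p) (snd p) \<omega> - m) * (X (fst q) (snd q) \<omega> - m)) \<partial>M)"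
    unfolding X_def by (simp add: power2_eq_square sum_product case_prod_beta)
  also have "\<dots> = (\<Sum>p\<in>?I. \<Sum>q\<in>?I. cov (fst p) (snd p) (fst q) (snd q))"
  proof -
    have "integrable M (\<lambda>\<omega>. (X i j \<omega> - m) * (X k l \<omega> - m))" for i j k l
      by (simp add: algebra_simps)
    then show ?thesis unfolding cov_def by (simp add: integral_sum)
  qed
  also have "\<dots> \<le> (\<Sum>p\<in>?I. 2 * a + 4 * real n * b)"
    using inner by (intro sum_mono) (auto simp: case_prod_beta off_diagonal_def)
  also have "\<dots> \<le> (\<Sum>p\<in>{..<n} \<times> {..<n}. 2 * a + 4 * real n * b)"
    using a0 b0 by (intro sum_mono2) (auto simp: off_diagonal_def)
  also have "\<dots> = real n ^ 2 * (2 * a + 4 * real n * b)" by (simp add: power2_eq_square)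
  finally show ?thesis .
qed

end

section \<open>A one-sided law of large numbers for U-statistics\<close>

text \<open>
The truncated square \<open>M min (1, (v / M)\<^sup>2)\<close>. It bounds at once \<open>M\<close> times the indicator of
\<open>v > M\<close>, the price of truncating at level \<open>M\<close>, and the normalised second moment \<open>v\<^sup>2 / M\<close> of
what is left.
\<close>

definition quad_cap :: "ennreal \<Rightarrow> ennreal \<Rightarrow> ennreal" where
  "quad_cap M v = (if v \<le> M then v\<^sup>2 / M else M)"

lemma quad_cap_measurable [measurable (raw)]:
  assumes [measurable]: "f \<in> borel_measurable N"
  shows "(\<lambda>x. quad_cap M (f x)) \<in> borel_measurable N"
  unfolding quad_cap_def by measurable

text \<open>
The levels below \<open>v\<close> add up to at most twice the last of them, hence to \<open>2 v\<close>; the terms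
\<open>v\<^sup>2 / M k\<close> beyond \<open>v\<close> decay geometrically and add up to at most \<open>2 v\<close>. This is where integrability
alone becomes enough for summable probabilities along geometric blocks.
\<close>

lemma suminf_quad_cap_le:
  fixes M :: "nat \<Rightarrow> real"
  assumes M0: "0 < M 0" and grow: "\<And>k. 2 * M k \<le> M (Suc k)"
  shows "(\<Sum>k. quad_cap (ennreal (M k)) v) \<le> 4 * v"
proof (cases v)
  case top
  then show ?thesis by (simp add: ennreal_mult_top)
next
  case (real r)
  have M: "0 < M k" for k
    by (induction k) (use M0 grow in \<open>auto intro: less_le_trans[OF _ grow]\<close>)
  have head: "(\<Sum>k<n. M k) \<le> M n" for n
    by (induction n) (use M0 grow in \<open>auto intro: order_trans[OF _ grow]\<close>)
  have A: "(\<Sum>k<n. if M k < r then M k else 0) \<le> 2 * r" for n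
  proof (induction n)
    case (Suc n)
    show ?case
    proof (cases "M n < r")
      case True
      have "(\<Sum>k<n. if M k < r then M k else 0) \<le> (\<Sum>k<n. M k)"
        using M by (intro sum_mono) (auto intro: less_imp_le)
      then show ?thesis using head[of n] True by simp
    qed (use Suc in simp)
  qed (use real in simp)
  \<comment> \<open>The bound by \<open>2 r\<close> alone is not inductive; the deficit \<open>2 r\<^sup>2 / M n\<close> pays for the next term.\<close>
  have B': "(\<Sum>k<n. if M k < r then 0 else r\<^sup>2 / M k) \<le> (if M n < r then 0 else 2 * r - 2 * r\<^sup>2 / M n)" for n
  proof (induction n)
    case 0
    show ?case using real M0 by (auto simp: field_simps power2_eq_square intro!: mult_left_mono)
  next
    case (Suc n)
    have *: "2 * r - 2 * r\<^sup>2 / M (Suc n) \<ge> 0" if "\<not> M (Suc n) < r"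
      using that real M[of "Suc n"] by (auto simp: field_simps power2_eq_square intro!: mult_left_mono)
    show ?case
    proof (cases "M n < r")
      case True
      then show ?thesis using Suc * by auto
    next
      case False
      have "r\<^sup>2 * (2 * M n) \<le> r\<^sup>2 * M (Suc n)" using grow by (intro mult_left_mono) auto
      then have "2 * r\<^sup>2 / M (Suc n) \<le> r\<^sup>2 / M n"
        using M[of n] M[of "Suc n"] by (simp add: field_simps)
      moreover have "\<not> M (Suc n) < r" using False grow[of n] M[of n] by linarith
      ultimately show ?thesis using Suc False by simp
    qed
  qed
  have B: "(\<Sum>k<n. if M k < r then 0 else r\<^sup>2 / M k) \<le> 2 * r" for n
    using B'[of n] real M[of n] by (auto split: if_splits intro: order_trans)
  have "(\<Sum>k<n. quad_cap (ennreal (M k)) v) \<le> 4 * v" for n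
  proof -
    have "quad_cap (ennreal (M k)) v = ennreal ((if M k < r then M k else 0) + (if M k < r then 0 else r\<^sup>2 / M k))" for k
      using M[of k] real unfolding quad_cap_def
      by (auto simp: ennreal_le_iff less_imp_le divide_ennreal ennreal_power)
    then have "(\<Sum>k<n. quad_cap (ennreal (M k)) v) =
        (\<Sum>k<n. ennreal ((if M k < r then M k else 0) + (if M k < r then 0 else r\<^sup>2 / M k)))" by simp
    also have "\<dots> = ennreal (\<Sum>k<n. (if M k < r then M k else 0) + (if M k < r then 0 else r\<^sup>2 / M k))"
      using M by (intro sum_ennreal) (auto simp: less_imp_le)
    also have "\<dots> \<le> ennreal (4 * r)"
      unfolding sum.distrib using A[of n] B[of n] by (intro ennreal_leI) simp
    also have "\<dots> = 4 * v" using real by (simp add: ennreal_mult)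
    finally show ?thesis .
  qed
  then show ?thesis by (simp add: suminf_eq_SUP SUP_least)
qed

text \<open>
Every large \<open>n\<close> lies between \<open>(n\<^sub>0 - 1) 2\<^sup>k\<close> and \<open>n\<^sub>0 2\<^sup>k\<close> for some \<open>n\<^sub>0\<close> among
\<open>m + 1, \<dots>, 2 m\<close>. So a monotone sequence that is controlled along these finitely many geometric
sequences is controlled everywhere, at the price of a factor close to \<open>1\<close>.
\<close>

lemma eventually_le_of_dyadic:
  fixes T :: "nat \<Rightarrow> ennreal"
  assumes mono: "mono T" and q: "0 \<le> q" and m: "0 < m"
    and dy: "\<And>n\<^sub>0. 0 < n\<^sub>0 \<Longrightarrow> \<forall>\<^sub>F k in sequentially. T (n\<^sub>0 * 2 ^ k) \<le> ennreal (q * (real (n\<^sub>0 * 2 ^ k))\<^sup>2)"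
  shows "\<forall>\<^sub>F n in sequentially. T n \<le> ennreal (q * (1 + 1 / real m)\<^sup>2 * (real n)\<^sup>2)"
proof -
  have "\<forall>\<^sub>F k in sequentially. \<forall>n\<^sub>0\<in>{m+1..2*m}. T (n\<^sub>0 * 2 ^ k) \<le> ennreal (q * (real (n\<^sub>0 * 2 ^ k))\<^sup>2)"
    by (intro eventually_ball_finite ballI dy) auto
  then obtain K where K: "\<And>k n\<^sub>0. K \<le> k \<Longrightarrow> n\<^sub>0 \<in> {m+1..2*m} \<Longrightarrow>
      T (n\<^sub>0 * 2 ^ k) \<le> ennreal (q * (real (n\<^sub>0 * 2 ^ k))\<^sup>2)"
    unfolding eventually_sequentially by blast
  show ?thesis
  proof (rule eventually_sequentiallyI)
    fix n assume n: "2 * m * 2 ^ K \<le> n"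
    have ex: "\<exists>k. n < 2 * m * 2 ^ k"
    proof
      have "n < 2 ^ n" by simp
      also have "\<dots> \<le> 2 * m * 2 ^ n" using m by simp
      finally show "n < 2 * m * 2 ^ n" .
    qed
    \<comment> \<open>The exponent with \<open>m 2\<^sup>k \<le> n < 2 m 2\<^sup>k\<close>.\<close>
    define k where "k = (LEAST k. n < 2 * m * 2 ^ k)"
    have k1: "n < 2 * m * 2 ^ k" unfolding k_def by (rule LeastI_ex[OF ex])
    have "2 ^ K < (2::nat) ^ k" using le_less_trans[OF n k1] m by simp
    then have Kk: "K < k" by (rule power_less_imp_less_exp[rotated]) simp
    then obtain k' where k': "k = Suc k'" by (cases k) auto
    have "\<not> n < 2 * m * 2 ^ k'" unfolding k_def using k' not_less_Least k_def by (metis lessI)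
    then have k2: "m * 2 ^ k \<le> n" by (simp add: k')
    define n\<^sub>0 where "n\<^sub>0 = n div 2 ^ k + 1"
    have n0: "m \<le> n div 2 ^ k" "n div 2 ^ k < 2 * m"
      using k1 k2 by (auto simp: less_eq_div_iff_mult_less_eq div_less_iff_less_mult)
    have lo: "(n\<^sub>0 - 1) * 2 ^ k \<le> n" and hi: "n \<le> n\<^sub>0 * 2 ^ k"
      unfolding n\<^sub>0_def using div_times_less_eq_dividend[of n "2^k"] dividend_less_div_times[of "2^k" n] by auto
    have "T n \<le> T (n\<^sub>0 * 2 ^ k)" using mono hi by (simp add: mono_def)
    also have "\<dots> \<le> ennreal (q * (real (n\<^sub>0 * 2 ^ k))\<^sup>2)"
      using Kk n0 by (intro K) (auto simp: n\<^sub>0_def)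
    also have "\<dots> \<le> ennreal (q * ((1 + 1 / real m) * real n)\<^sup>2)"
    proof (intro ennreal_leI mult_left_mono q power_mono)
      have "real n\<^sub>0 \<le> (1 + 1 / real m) * real (n\<^sub>0 - 1)"
        unfolding n\<^sub>0_def using n0(1) m by (simp add: field_simps)
      then have "real n\<^sub>0 * 2 ^ k \<le> (1 + 1 / real m) * real (n\<^sub>0 - 1) * 2 ^ k" by (intro mult_right_mono) auto
      also have "\<dots> = (1 + 1 / real m) * real ((n\<^sub>0 - 1) * 2 ^ k)" by simp
      also have "\<dots> \<le> (1 + 1 / real m) * real n"
        using lo by (intro mult_left_mono of_nat_mono) auto
      finally show "real (n\<^sub>0 * 2 ^ k) \<le> (1 + 1 / real m) * real n" by simp
    qed simp
    finally show "T n \<le> ennreal (q * (1 + 1 / real m)\<^sup>2 * (real n)\<^sup>2)" by (simp add: power_mult_distrib mult.assoc)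
  qed
qed

context iid_sequence begin

text \<open>
Let \<open>g z = \<integral> k (z, z') d\<gamma>(z')\<close>. Truncating the kernel where \<open>k > n\<^sup>2\<close> and where \<open>g > n\<close> at one of the
two points keeps the mean at most \<open>e\<close>. The event that the truncation changes the sum over pairs below \<open>n\<close> is
estimated by a union bound over \<open>n\<^sup>2\<close> pairs and \<open>n\<close> points, the deviation of the truncated sum by
its second moment.
\<close>

lemma emeasure_pair_sum_exceeds_le:
  fixes k :: "'z \<times> 'z \<Rightarrow> ennreal" and e \<epsilon> :: real and n :: nat
  assumes k [measurable]: "k \<in> borel_measurable (N \<Otimes>\<^sub>M N)" and sym: "\<And>z z'. k (z, z') = k (z', z)"
    and e: "(\<integral>\<^sup>+ p. k p \<partial>(\<gamma> \<Otimes>\<^sub>M \<gamma>)) \<le> ennreal e" "0 \<le> e" and \<epsilon>: "0 < \<epsilon>" and n: "0 < n"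
  shows "emeasure M {\<omega> \<in> space M. ennreal (e * card (off_diagonal n) + \<epsilon> * (real n)\<^sup>2) <
        (\<Sum>(i, j)\<in>off_diagonal n. k (Z i \<omega>, Z j \<omega>))}
    \<le> ennreal (1 + 4 / \<epsilon>\<^sup>2) * ((\<integral>\<^sup>+ p. quad_cap (ennreal ((real n)\<^sup>2)) (k p) \<partial>(\<gamma> \<Otimes>\<^sub>M \<gamma>)) +
        (\<integral>\<^sup>+ z. quad_cap (ennreal (real n)) (\<integral>\<^sup>+ z'. k (z, z') \<partial>\<gamma>) \<partial>\<gamma>))"
proof -
  interpret G: prob_space \<gamma> by (rule prob_space_law)
  interpret GG: pair_prob_space \<gamma> \<gamma> ..
  define g where "g z = (\<integral>\<^sup>+ z'. k (z, z') \<partial>\<gamma>)" for z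
  have g [measurable]: "g \<in> borel_measurable N" unfolding g_def by measurable
  define Q1 where "Q1 = (\<integral>\<^sup>+ p. quad_cap (ennreal ((real n)\<^sup>2)) (k p) \<partial>(\<gamma> \<Otimes>\<^sub>M \<gamma>))"
  define Q2 where "Q2 = (\<integral>\<^sup>+ z. quad_cap (ennreal (real n)) (g z) \<partial>\<gamma>)"
  let ?I = "off_diagonal n"
  define f where "f p = (if k p \<le> ennreal ((real n)\<^sup>2) \<and> g (fst p) \<le> ennreal (real n) \<and> g (snd p) \<le> ennreal (real n)
    then enn2real (k p) else 0)" for p
  have f [measurable]: "f \<in> borel_measurable (N \<Otimes>\<^sub>M N)" unfolding f_def by measurable
  have f0: "0 \<le> f p" for p by (simp add: f_def)
  have fB: "f p \<le> (real n)\<^sup>2" for p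
    by (auto simp: f_def intro: enn2real_leI)
  have fsym: "f (z, z') = f (z', z)" for z z' unfolding f_def using sym by auto
  have fk: "ennreal (f p) \<le> k p" for p
    by (auto simp: f_def ennreal_enn2real_if top_unique)
  have fk2: "ennreal ((f p)\<^sup>2) \<le> ennreal ((real n)\<^sup>2) * quad_cap (ennreal ((real n)\<^sup>2)) (k p)" for p
  proof (cases "k p \<le> ennreal ((real n)\<^sup>2)")
    case True
    have "ennreal ((f p)\<^sup>2) \<le> (k p)\<^sup>2" using fk[of p] f0[of p] by (simp add: ennreal_power[symmetric] power_mono)
    also have "\<dots> = ennreal ((real n)\<^sup>2) * ((k p)\<^sup>2 / ennreal ((real n)\<^sup>2))"
      using n by (metis ennreal_eq_0_iff ennreal_neq_top ennreal_times_divide mult.commute mult_divide_eq_ennreal not_less of_nat_0_less_iff zero_less_power)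
    finally show ?thesis using True by (simp add: quad_cap_def)
  qed (simp add: f_def)
  define m where "m = (\<integral> p. f p \<partial>(\<gamma> \<Otimes>\<^sub>M \<gamma>))"
  define a where "a = (\<integral> p. (f p)\<^sup>2 \<partial>(\<gamma> \<Otimes>\<^sub>M \<gamma>))"
  define b where "b = (\<integral> z. (\<integral> z'. f (z, z') \<partial>\<gamma>)\<^sup>2 \<partial>\<gamma>)"
  have f2B: "(f p)\<^sup>2 \<le> ((real n)\<^sup>2)\<^sup>2" for p using f0 fB by (intro power_mono)
  have intf: "integrable (\<gamma> \<Otimes>\<^sub>M \<gamma>) f" "integrable (\<gamma> \<Otimes>\<^sub>M \<gamma>) (\<lambda>p. (f p)\<^sup>2)"
    by (rule GG.P.integrable_const_bound[of _ "(real n)\<^sup>2"] GG.P.integrable_const_bound[of _ "((real n)\<^sup>2)\<^sup>2"];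
      use f0 fB f2B in \<open>simp del: power2_less_eq_zero_iff\<close>)+
  have m_le: "m \<le> e"
  proof -
    have "ennreal m = (\<integral>\<^sup>+ p. f p \<partial>(\<gamma> \<Otimes>\<^sub>M \<gamma>))"
      unfolding m_def using intf f0 by (intro nn_integral_eq_integral[symmetric]) auto
    also have "\<dots> \<le> (\<integral>\<^sup>+ p. k p \<partial>(\<gamma> \<Otimes>\<^sub>M \<gamma>))" by (intro nn_integral_mono fk)
    finally show ?thesis using e by (metis order_trans ennreal_le_iff)
  qed
  have a_le: "ennreal (a / (real n)\<^sup>2) \<le> Q1"
  proof -
    have "ennreal a = (\<integral>\<^sup>+ p. ennreal ((f p)\<^sup>2) \<partial>(\<gamma> \<Otimes>\<^sub>M \<gamma>))"
      unfolding a_def using intf by (intro nn_integral_eq_integral[symmetric]) auto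
    also have "\<dots> \<le> (\<integral>\<^sup>+ p. ennreal ((real n)\<^sup>2) * quad_cap (ennreal ((real n)\<^sup>2)) (k p) \<partial>(\<gamma> \<Otimes>\<^sub>M \<gamma>))"
      by (intro nn_integral_mono fk2)
    also have "\<dots> = ennreal ((real n)\<^sup>2) * Q1" unfolding Q1_def by (intro nn_integral_cmult) measurable
    finally have "ennreal (1 / (real n)\<^sup>2) * ennreal a \<le> ennreal (1 / (real n)\<^sup>2) * (ennreal ((real n)\<^sup>2) * Q1)"
      by (intro mult_left_mono) auto
    then show ?thesis using n by (simp add: mult.assoc[symmetric] ennreal_mult'[symmetric])
  qed
  have b_le: "ennreal (b / real n) \<le> Q2"
  proof -
    have pt: "ennreal ((\<integral> z'. f (z, z') \<partial>\<gamma>)\<^sup>2) \<le> ennreal (real n) * quad_cap (ennreal (real n)) (g z)"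
      if "z \<in> space \<gamma>" for z
    proof -
      have [measurable]: "(\<lambda>z'. f (z, z')) \<in> borel_measurable N"
        using that sets_eq_imp_space_eq[OF sets_law] by simp
      have i: "integrable \<gamma> (\<lambda>z'. f (z, z'))"
        using f0 fB by (intro G.integrable_const_bound[of _ "(real n)\<^sup>2"]) auto
      show ?thesis
      proof (cases "g z \<le> ennreal (real n)")
        case True
        have "ennreal (\<integral> z'. f (z, z') \<partial>\<gamma>) = (\<integral>\<^sup>+ z'. f (z, z') \<partial>\<gamma>)"
          using i f0 by (intro nn_integral_eq_integral[symmetric]) auto
        also have "\<dots> \<le> g z" unfolding g_def by (intro nn_integral_mono fk)
        finally have "ennreal ((\<integral> z'. f (z, z') \<partial>\<gamma>)\<^sup>2) \<le> (g z)\<^sup>2"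
          using f0 by (simp add: ennreal_power[symmetric] power_mono)
        also have "\<dots> = ennreal (real n) * ((g z)\<^sup>2 / ennreal (real n))"
          using n by (metis ennreal_eq_0_iff ennreal_neq_top ennreal_times_divide mult.commute mult_divide_eq_ennreal not_less of_nat_0_less_iff)
        finally show ?thesis using True by (simp add: quad_cap_def)
      next
        case False
        then have "(\<integral> z'. f (z, z') \<partial>\<gamma>) = 0" by (simp add: f_def)
        then show ?thesis by simp
      qed
    qed
    \<comment> \<open>A Bochner integral is \<open>0\<close> if it diverges, and so is \<open>enn2real \<infinity>\<close>: the bound needs no integrability.\<close>
    have "b = enn2real (\<integral>\<^sup>+ z. ennreal ((\<integral> z'. f (z, z') \<partial>\<gamma>)\<^sup>2) \<partial>\<gamma>)"
      unfolding b_def by (intro integral_eq_nn_integral) auto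
    then have "ennreal b \<le> (\<integral>\<^sup>+ z. ennreal ((\<integral> z'. f (z, z') \<partial>\<gamma>)\<^sup>2) \<partial>\<gamma>)"
      by (simp add: ennreal_enn2real_if)
    also have "\<dots> \<le> (\<integral>\<^sup>+ z. ennreal (real n) * quad_cap (ennreal (real n)) (g z) \<partial>\<gamma>)"
      by (intro nn_integral_mono pt)
    also have "\<dots> = ennreal (real n) * Q2" unfolding Q2_def by (intro nn_integral_cmult) measurable
    finally have "ennreal (1 / real n) * ennreal b \<le> ennreal (1 / real n) * (ennreal (real n) * Q2)"
      by (intro mult_left_mono) auto
    then show ?thesis using n by (simp add: mult.assoc[symmetric] ennreal_mult'[symmetric])
  qed
  define Y where "Y \<omega> = (\<Sum>(i, j)\<in>?I. f (Z i \<omega>, Z j \<omega>) - m)" for \<omega>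
  have Y [measurable]: "Y \<in> borel_measurable M" unfolding Y_def case_prod_beta by measurable
  let ?A = "{\<omega> \<in> space M. ennreal (e * card ?I + \<epsilon> * (real n)\<^sup>2) < (\<Sum>(i, j)\<in>?I. k (Z i \<omega>, Z j \<omega>))}"
  define B1 where "B1 = (\<Union>(i, j)\<in>?I. {\<omega> \<in> space M. ennreal ((real n)\<^sup>2) < k (Z i \<omega>, Z j \<omega>)})"
  define B2 where "B2 = (\<Union>i\<in>{..<n}. {\<omega> \<in> space M. ennreal (real n) < g (Z i \<omega>)})"
  define B3 where "B3 = {\<omega> \<in> space M. (\<epsilon> * (real n)\<^sup>2)\<^sup>2 \<le> (Y \<omega>)\<^sup>2}"
  have [measurable]: "B1 \<in> sets M" "B2 \<in> sets M" "B3 \<in> sets M"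
    unfolding B1_def B2_def B3_def case_prod_beta by measurable
  have m0: "0 \<le> m" unfolding m_def using f0 by simp
  have sub: "?A \<subseteq> B1 \<union> B2 \<union> B3"
  proof
    fix \<omega> assume A: "\<omega> \<in> ?A"
    show "\<omega> \<in> B1 \<union> B2 \<union> B3"
    proof (cases "\<omega> \<in> B1 \<union> B2")
      case False
      have "k (Z i \<omega>, Z j \<omega>) = ennreal (f (Z i \<omega>, Z j \<omega>))" if "(i, j) \<in> ?I" for i j
      proof -
        have "\<omega> \<in> B1" if "ennreal ((real n)\<^sup>2) < k (Z i \<omega>, Z j \<omega>)"
          unfolding B1_def using that \<open>(i, j) \<in> ?I\<close> A by (intro UN_I[of "(i, j)"]) auto
        then have "k (Z i \<omega>, Z j \<omega>) \<le> ennreal ((real n)\<^sup>2)"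
          using False by (auto simp: not_less[symmetric])
        moreover have "g (Z i \<omega>) \<le> ennreal (real n)" "g (Z j \<omega>) \<le> ennreal (real n)"
          using False A that by (auto simp: B2_def off_diagonal_def not_less)
        ultimately show ?thesis by (auto simp: f_def ennreal_enn2real_if top_unique)
      qed
      then have "(\<Sum>(i, j)\<in>?I. k (Z i \<omega>, Z j \<omega>)) = (\<Sum>(i, j)\<in>?I. ennreal (f (Z i \<omega>, Z j \<omega>)))"
        by (intro sum.cong) auto
      also have "\<dots> = ennreal (\<Sum>(i, j)\<in>?I. f (Z i \<omega>, Z j \<omega>))"
        unfolding case_prod_beta using f0 by (intro sum_ennreal) auto
      finally have "e * card ?I + \<epsilon> * (real n)\<^sup>2 < (\<Sum>(i, j)\<in>?I. f (Z i \<omega>, Z j \<omega>))"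
        using A e(2) \<epsilon> by (simp add: ennreal_less_iff del: ennreal_plus)
      moreover have "Y \<omega> = (\<Sum>(i, j)\<in>?I. f (Z i \<omega>, Z j \<omega>)) - card ?I * m"
        unfolding Y_def case_prod_beta by (simp add: sum_subtractf)
      moreover have "card ?I * m \<le> card ?I * e" using m_le by (intro mult_left_mono) auto
      ultimately have "\<epsilon> * (real n)\<^sup>2 \<le> Y \<omega>" by (simp add: mult.commute)
      then have "(\<epsilon> * (real n)\<^sup>2)\<^sup>2 \<le> (Y \<omega>)\<^sup>2" using \<epsilon> by (intro power_mono) auto
      then show ?thesis using A by (simp add: B3_def)
    qed auto
  qed
  have e1: "emeasure M B1 \<le> Q1"
  proof -
    have "emeasure M B1 \<le> (\<Sum>p\<in>?I. emeasure M {\<omega> \<in> space M. ennreal ((real n)\<^sup>2) < k (Z (fst p) \<omega>, Z (snd p) \<omega>)})"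
      unfolding B1_def case_prod_beta by (intro emeasure_subadditive_finite) auto
    also have "\<dots> = (\<Sum>p\<in>?I. \<integral>\<^sup>+ q. indicator {q. ennreal ((real n)\<^sup>2) < k q} q \<partial>(\<gamma> \<Otimes>\<^sub>M \<gamma>))"
    proof (intro sum.cong refl)
      fix p assume "p \<in> ?I"
      then have ne: "fst p \<noteq> snd p" by (auto simp: off_diagonal_def)
      have "(\<integral>\<^sup>+ q. indicator {q. ennreal ((real n)\<^sup>2) < k q} q \<partial>(\<gamma> \<Otimes>\<^sub>M \<gamma>)) =
          (\<integral>\<^sup>+ \<omega>. indicator {q. ennreal ((real n)\<^sup>2) < k q} (Z (fst p) \<omega>, Z (snd p) \<omega>) \<partial>M)"
        by (intro nn_integral_pair[symmetric] ne) measurable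
      also have "\<dots> = (\<integral>\<^sup>+ \<omega>. indicator {\<omega> \<in> space M. ennreal ((real n)\<^sup>2) < k (Z (fst p) \<omega>, Z (snd p) \<omega>)} \<omega> \<partial>M)"
        by (intro nn_integral_cong) (auto simp: indicator_def)
      finally show "emeasure M {\<omega> \<in> space M. ennreal ((real n)\<^sup>2) < k (Z (fst p) \<omega>, Z (snd p) \<omega>)} =
          (\<integral>\<^sup>+ q. indicator {q. ennreal ((real n)\<^sup>2) < k q} q \<partial>(\<gamma> \<Otimes>\<^sub>M \<gamma>))" by simp
    qed
    also have "\<dots> = ennreal (card ?I) * (\<integral>\<^sup>+ q. indicator {q. ennreal ((real n)\<^sup>2) < k q} q \<partial>(\<gamma> \<Otimes>\<^sub>M \<gamma>))"
      by (simp add: ennreal_of_nat_eq_real_of_nat)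
    also have "\<dots> \<le> ennreal ((real n)\<^sup>2) * (\<integral>\<^sup>+ q. indicator {q. ennreal ((real n)\<^sup>2) < k q} q \<partial>(\<gamma> \<Otimes>\<^sub>M \<gamma>))"
    proof (intro mult_right_mono ennreal_leI)
      have "real (n * (n - 1)) \<le> real (n * n)" by (intro of_nat_mono mult_left_mono) auto
      then show "real (card ?I) \<le> (real n)\<^sup>2" by (simp add: card_off_diagonal power2_eq_square)
    qed auto
    also have "\<dots> = (\<integral>\<^sup>+ q. ennreal ((real n)\<^sup>2) * indicator {q. ennreal ((real n)\<^sup>2) < k q} q \<partial>(\<gamma> \<Otimes>\<^sub>M \<gamma>))"
      by (intro nn_integral_cmult[symmetric]) measurable
    also have "\<dots> \<le> Q1"
      unfolding Q1_def by (intro nn_integral_mono) (auto simp: quad_cap_def indicator_def)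
    finally show ?thesis .
  qed
  have e2: "emeasure M B2 \<le> Q2"
  proof -
    have "emeasure M B2 \<le> (\<Sum>i<n. emeasure M {\<omega> \<in> space M. ennreal (real n) < g (Z i \<omega>)})"
      unfolding B2_def by (intro emeasure_subadditive_finite) auto
    also have "\<dots> = (\<Sum>i<n. \<integral>\<^sup>+ z. indicator {z. ennreal (real n) < g z} z \<partial>\<gamma>)"
    proof (intro sum.cong refl)
      fix i
      have "(\<integral>\<^sup>+ z. indicator {z. ennreal (real n) < g z} z \<partial>\<gamma>) =
          (\<integral>\<^sup>+ \<omega>. indicator {z. ennreal (real n) < g z} (Z i \<omega>) \<partial>M)"
        by (intro nn_integral_single[symmetric]) measurable
      also have "\<dots> = (\<integral>\<^sup>+ \<omega>. indicator {\<omega> \<in> space M. ennreal (real n) < g (Z i \<omega>)} \<omega> \<partial>M)"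
        by (intro nn_integral_cong) (auto simp: indicator_def)
      finally show "emeasure M {\<omega> \<in> space M. ennreal (real n) < g (Z i \<omega>)} =
          (\<integral>\<^sup>+ z. indicator {z. ennreal (real n) < g z} z \<partial>\<gamma>)" by simp
    qed
    also have "\<dots> = ennreal (real n) * (\<integral>\<^sup>+ z. indicator {z. ennreal (real n) < g z} z \<partial>\<gamma>)"
      by (simp add: ennreal_of_nat_eq_real_of_nat)
    also have "\<dots> = (\<integral>\<^sup>+ z. ennreal (real n) * indicator {z. ennreal (real n) < g z} z \<partial>\<gamma>)"
      by (intro nn_integral_cmult[symmetric]) measurable
    also have "\<dots> \<le> Q2"
      unfolding Q2_def by (intro nn_integral_mono) (auto simp: quad_cap_def indicator_def)
    finally show ?thesis .
  qed
  have e3: "emeasure M B3 \<le> ennreal (4 / \<epsilon>\<^sup>2) * (Q1 + Q2)"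
  proof -
    have Yb: "\<bar>Y \<omega>\<bar> \<le> card ?I * ((real n)\<^sup>2 + e)" for \<omega>
    proof -
      have "\<bar>f p - m\<bar> \<le> (real n)\<^sup>2 + e" for p
        using f0[of p] fB[of p] m0 m_le by (auto simp: abs_if)
      then have "(\<Sum>p\<in>?I. \<bar>f (Z (fst p) \<omega>, Z (snd p) \<omega>) - m\<bar>) \<le> (\<Sum>p\<in>?I. (real n)\<^sup>2 + e)"
        by (intro sum_mono)
      then show ?thesis unfolding Y_def case_prod_beta by (intro order_trans[OF sum_abs]) simp
    qed
    have Y2: "integrable M (\<lambda>\<omega>. (Y \<omega>)\<^sup>2)"
      using power_mono[OF Yb abs_ge_zero, of _ 2]
      by (intro integrable_const_bound[of _ "(card ?I * ((real n)\<^sup>2 + e))\<^sup>2"]) auto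
    have c0: "0 < (\<epsilon> * (real n)\<^sup>2)\<^sup>2" using \<epsilon> n by simp
    have "emeasure M B3 \<le> ennreal (1 / (\<epsilon> * (real n)\<^sup>2)\<^sup>2 * (\<integral> \<omega>. (Y \<omega>)\<^sup>2 \<partial>M))"
      unfolding B3_def using Y2 c0 by (intro integral_Markov_inequality) auto
    also have "\<dots> \<le> ennreal (1 / (\<epsilon> * (real n)\<^sup>2)\<^sup>2 * ((real n)\<^sup>2 * (2 * a + 4 * real n * b)))"
      unfolding Y_def a_def b_def m_def
      by (intro ennreal_leI mult_left_mono second_moment_pair_sum[OF f f0 fB fsym]) auto
    also have "1 / (\<epsilon> * (real n)\<^sup>2)\<^sup>2 * ((real n)\<^sup>2 * (2 * a + 4 * real n * b)) =
        2 / \<epsilon>\<^sup>2 * (a / (real n)\<^sup>2) + 4 / \<epsilon>\<^sup>2 * (b / real n)"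
      using n \<epsilon> by (simp add: field_simps power2_eq_square)
    also have "ennreal \<dots> \<le> ennreal (4 / \<epsilon>\<^sup>2 * (a / (real n)\<^sup>2 + b / real n))"
    proof -
      have "0 \<le> a / (real n)\<^sup>2" unfolding a_def by simp
      then have "2 / \<epsilon>\<^sup>2 * (a / (real n)\<^sup>2) \<le> 4 / \<epsilon>\<^sup>2 * (a / (real n)\<^sup>2)"
        by (intro mult_right_mono divide_right_mono) auto
      then show ?thesis by (intro ennreal_leI) (simp add: distrib_left)
    qed
    also have "\<dots> = ennreal (4 / \<epsilon>\<^sup>2) * (ennreal (a / (real n)\<^sup>2) + ennreal (b / real n))"
      by (subst ennreal_mult') (auto simp: a_def b_def)
    also have "\<dots> \<le> ennreal (4 / \<epsilon>\<^sup>2) * (Q1 + Q2)"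
      by (intro mult_left_mono add_mono a_le b_le) auto
    finally show ?thesis .
  qed
  have "emeasure M ?A \<le> emeasure M (B1 \<union> B2 \<union> B3)"
    using sub by (intro emeasure_mono) auto
  also have "\<dots> \<le> emeasure M B1 + emeasure M B2 + emeasure M B3"
    by (intro order_trans[OF emeasure_subadditive] add_mono emeasure_subadditive) auto
  also have "\<dots> \<le> Q1 + Q2 + ennreal (4 / \<epsilon>\<^sup>2) * (Q1 + Q2)"
    by (intro add_mono e1 e2 e3)
  also have "\<dots> = ennreal (1 + 4 / \<epsilon>\<^sup>2) * (Q1 + Q2)"
    by (subst ennreal_plus) (auto simp: distrib_right)
  finally show ?thesis unfolding Q1_def Q2_def g_def .
qed

text \<open>
Along \<open>n = n\<^sub>0 2\<^sup>r\<close> both levels \<open>n\<^sup>2\<close> and \<open>n\<close> at least double, so the bounds of \<open>emeasure_pair_sum_exceeds_le\<close>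
are summable, with sum at most a constant times \<open>\<integral> k\<close>, and Borel-Cantelli applies.
\<close>

lemma AE_eventually_dyadic_pair_sum_le:
  fixes k :: "'z \<times> 'z \<Rightarrow> ennreal" and e \<epsilon> :: real and n\<^sub>0 :: nat
  assumes k [measurable]: "k \<in> borel_measurable (N \<Otimes>\<^sub>M N)" and sym: "\<And>z z'. k (z, z') = k (z', z)"
    and e: "(\<integral>\<^sup>+ p. k p \<partial>(\<gamma> \<Otimes>\<^sub>M \<gamma>)) \<le> ennreal e" "0 \<le> e" and \<epsilon>: "0 < \<epsilon>" and n0: "0 < n\<^sub>0"
  shows "AE \<omega> in M. \<forall>\<^sub>F r in sequentially. (\<Sum>(i, j)\<in>off_diagonal (n\<^sub>0 * 2 ^ r). k (Z i \<omega>, Z j \<omega>))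
    \<le> ennreal ((e + \<epsilon>) * (real (n\<^sub>0 * 2 ^ r))\<^sup>2)"
proof -
  interpret G: prob_space \<gamma> by (rule prob_space_law)
  interpret GG: pair_prob_space \<gamma> \<gamma> ..
  let ?n = "\<lambda>r. n\<^sub>0 * 2 ^ r"
  define A where "A r = {\<omega> \<in> space M. ennreal (e * card (off_diagonal (?n r)) + \<epsilon> * (real (?n r))\<^sup>2) <
        (\<Sum>(i, j)\<in>off_diagonal (?n r). k (Z i \<omega>, Z j \<omega>))}" for r
  have A [measurable]: "A r \<in> sets M" for r
    unfolding A_def case_prod_beta by measurable
  define g where "g z = (\<integral>\<^sup>+ z'. k (z, z') \<partial>\<gamma>)" for z
  have g [measurable]: "g \<in> borel_measurable N" unfolding g_def by measurable
  have "(\<Sum>r. emeasure M (A r)) \<le> (\<Sum>r. ennreal (1 + 4 / \<epsilon>\<^sup>2) * ((\<integral>\<^sup>+ p. quad_cap (ennreal ((real (?n r))\<^sup>2)) (k p) \<partial>(\<gamma> \<Otimes>\<^sub>M \<gamma>)) +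
        (\<integral>\<^sup>+ z. quad_cap (ennreal (real (?n r))) (g z) \<partial>\<gamma>)))"
    unfolding A_def g_def using n0 by (intro suminf_le emeasure_pair_sum_exceeds_le[OF k sym e \<epsilon>]) auto
  also have "\<dots> = ennreal (1 + 4 / \<epsilon>\<^sup>2) * ((\<integral>\<^sup>+ p. (\<Sum>r. quad_cap (ennreal ((real (?n r))\<^sup>2)) (k p)) \<partial>(\<gamma> \<Otimes>\<^sub>M \<gamma>)) +
        (\<integral>\<^sup>+ z. (\<Sum>r. quad_cap (ennreal (real (?n r))) (g z)) \<partial>\<gamma>))"
    by (subst (1 2) nn_integral_suminf) (auto simp: suminf_add)
  also have "\<dots> \<le> ennreal (1 + 4 / \<epsilon>\<^sup>2) * ((\<integral>\<^sup>+ p. 4 * k p \<partial>(\<gamma> \<Otimes>\<^sub>M \<gamma>)) + (\<integral>\<^sup>+ z. 4 * g z \<partial>\<gamma>))"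
    using n0 by (intro mult_left_mono add_mono nn_integral_mono suminf_quad_cap_le) (auto simp: power2_eq_square)
  also have "\<dots> = ennreal (1 + 4 / \<epsilon>\<^sup>2) * (4 * (\<integral>\<^sup>+ p. k p \<partial>(\<gamma> \<Otimes>\<^sub>M \<gamma>)) + 4 * (\<integral>\<^sup>+ p. k p \<partial>(\<gamma> \<Otimes>\<^sub>M \<gamma>)))"
    unfolding g_def by (simp add: nn_integral_cmult G.nn_integral_fst)
  also have "\<dots> < \<infinity>"
    using le_less_trans[OF e(1) ennreal_less_top] by (simp add: ennreal_mult_less_top del: ennreal_plus)
  finally have "(\<Sum>r. ennreal (measure M (A r))) \<noteq> top"
    by (simp add: emeasure_eq_measure)
  then have "summable (\<lambda>r. measure M (A r))" by (intro summable_suminf_not_top) auto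
  then have "AE \<omega> in M. \<forall>\<^sub>F r in sequentially. \<omega> \<in> space M - A r"
    by (intro borel_cantelli_AE1) (auto simp: emeasure_eq_measure)
  then show ?thesis
  proof eventually_elim
    case (elim \<omega>)
    then show ?case
    proof eventually_elim
      case (elim r)
      then have "(\<Sum>(i, j)\<in>off_diagonal (?n r). k (Z i \<omega>, Z j \<omega>)) \<le>
          ennreal (e * card (off_diagonal (?n r)) + \<epsilon> * (real (?n r))\<^sup>2)" by (auto simp: A_def)
      also have "\<dots> \<le> ennreal ((e + \<epsilon>) * (real (?n r))\<^sup>2)"
      proof (intro ennreal_leI)
        have "real (?n r * (?n r - 1)) \<le> real (?n r * ?n r)" by (intro of_nat_mono mult_left_mono) auto
        then have "e * card (off_diagonal (?n r)) \<le> e * (real (?n r))\<^sup>2"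
          unfolding card_off_diagonal power2_eq_square of_nat_mult[symmetric] using e(2) by (intro mult_left_mono)
        then show "e * card (off_diagonal (?n r)) + \<epsilon> * (real (?n r))\<^sup>2 \<le> (e + \<epsilon>) * (real (?n r))\<^sup>2"
          by (simp add: distrib_right)
      qed
      finally show ?case .
    qed
  qed
qed

text \<open>
The upper half of the strong law for U-statistics of order two with a nonnegative integrable
kernel. Pair sums of a nonnegative kernel increase with \<open>n\<close>, so the dyadic blocks suffice.
\<close>

theorem U_statistic_upper_law:
  fixes k :: "'z \<times> 'z \<Rightarrow> ennreal" and e :: real
  assumes k [measurable]: "k \<in> borel_measurable (N \<Otimes>\<^sub>M N)" and sym: "\<And>z z'. k (z, z') = k (z', z)"
    and e: "(\<integral>\<^sup>+ p. k p \<partial>(\<gamma> \<Otimes>\<^sub>M \<gamma>)) \<le> ennreal e" "0 \<le> e"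
  shows "AE \<omega> in M. \<forall>e'>e. \<forall>\<^sub>F n in sequentially.
    (\<Sum>(i, j)\<in>off_diagonal n. k (Z i \<omega>, Z j \<omega>)) \<le> ennreal (e' * card (off_diagonal n))"
proof -
  have "AE \<omega> in M. \<forall>m n\<^sub>0. \<forall>\<^sub>F r in sequentially. (\<Sum>(i, j)\<in>off_diagonal (Suc n\<^sub>0 * 2 ^ r). k (Z i \<omega>, Z j \<omega>))
    \<le> ennreal ((e + 1 / real (Suc m)) * (real (Suc n\<^sub>0 * 2 ^ r))\<^sup>2)"
    unfolding AE_all_countable by (intro allI AE_eventually_dyadic_pair_sum_le[OF k sym e]) auto
  then show ?thesis
  proof eventually_elim
    case (elim \<omega>)
    show ?case
    proof (intro allI impI)
      fix e' assume "e < e'"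
      \<comment> \<open>The error \<open>1 / (m + 1)\<close> of the block bound and the factor from filling the gaps vanish together.\<close>
      have "(\<lambda>m. (e + 1 / real (Suc m)) * (1 + 1 / real (Suc m))\<^sup>2) \<longlonglongrightarrow> (e + 0) * (1 + 0)\<^sup>2"
        using LIMSEQ_inverse_real_of_nat unfolding inverse_eq_divide by (intro tendsto_intros)
      then have "\<forall>\<^sub>F m in sequentially. (e + 1 / real (Suc m)) * (1 + 1 / real (Suc m))\<^sup>2 < e'"
        using \<open>e < e'\<close> by (intro order_tendstoD) auto
      then obtain m where m: "(e + 1 / real (Suc m)) * (1 + 1 / real (Suc m))\<^sup>2 < e'" (is "?q < e'")
        unfolding eventually_sequentially by blast
      have "\<forall>\<^sub>F n in sequentially. (\<Sum>(i, j)\<in>off_diagonal n. k (Z i \<omega>, Z j \<omega>)) \<le> ennreal (?q * (real n)\<^sup>2)"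
      proof (rule eventually_le_of_dyadic)
        show "mono (\<lambda>n. \<Sum>(i, j)\<in>off_diagonal n. k (Z i \<omega>, Z j \<omega>))"
          by (intro monoI sum_mono2 off_diagonal_mono) auto
        show "\<forall>\<^sub>F r in sequentially. (\<Sum>(i, j)\<in>off_diagonal (n\<^sub>0 * 2 ^ r). k (Z i \<omega>, Z j \<omega>))
          \<le> ennreal ((e + 1 / real (Suc m)) * (real (n\<^sub>0 * 2 ^ r))\<^sup>2)" if "0 < n\<^sub>0" for n\<^sub>0
          using elim[rule_format, of "n\<^sub>0 - 1" m] that by simp
      qed (use e in auto)
      moreover have "\<forall>\<^sub>F n in sequentially. ?q * real n \<le> e' * (real n - 1)"
      proof -
        have "filterlim (\<lambda>n. (e' - ?q) * real n) at_top sequentially"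
          using m by (intro filterlim_tendsto_pos_mult_at_top[OF tendsto_const] filterlim_real_sequentially) auto
        then have "\<forall>\<^sub>F n in sequentially. e' \<le> (e' - ?q) * real n" by (auto simp: filterlim_at_top)
        then show ?thesis by eventually_elim (simp add: algebra_simps)
      qed
      ultimately show "\<forall>\<^sub>F n in sequentially. (\<Sum>(i, j)\<in>off_diagonal n. k (Z i \<omega>, Z j \<omega>)) \<le> ennreal (e' * card (off_diagonal n))"
        using eventually_gt_at_top[of 0]
      proof eventually_elim
        case (elim n)
        note elim(1)
        also have "ennreal (?q * (real n)\<^sup>2) \<le> ennreal (e' * card (off_diagonal n))"
        proof (intro ennreal_leI)
          have "real n * (?q * real n) \<le> real n * (e' * (real n - 1))" using elim by (intro mult_left_mono) auto
          then show "?q * (real n)\<^sup>2 \<le> e' * card (off_diagonal n)"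
            using elim by (simp add: card_off_diagonal power2_eq_square algebra_simps of_nat_diff)
        qed
        finally show ?case .
      qed
    qed
  qed
qed

end

section \<open>The law of large numbers for test functions\<close>

lemma ennreal_divide_of_nat_eq: "(x :: ennreal) / of_nat N = ennreal (1 / real N) * x" if "0 < N"
proof -
  have "inverse (of_nat N :: ennreal) = ennreal (1 / real N)"
    using that by (simp add: ennreal_of_nat_eq_real_of_nat inverse_ennreal inverse_eq_divide)
  then show ?thesis by (simp add: divide_ennreal_def mult.commute)
qed

lemma nn_integral_average:
  assumes m: "\<And>i. i < N \<Longrightarrow> sets (m i) = sets borel" and f: "f \<in> borel_measurable borel"
  shows "(\<integral>\<^sup>+ x. f x \<partial>(average N m)) = (\<Sum>i<N. \<integral>\<^sup>+ x. f x \<partial>(m i)) / of_nat N"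
  using f
proof (induction rule: borel_measurable_induct)
  case (cong f g)
  then show ?case by (metis (no_types, lifting) ext space_borel UNIV_I)
next
  case (set A)
  then show ?case using emeasure_average[OF m] m by simp
next
  case (mult u c)
  have "u \<in> borel_measurable (average N m)" "\<And>i. i < N \<Longrightarrow> u \<in> borel_measurable (m i)"
    using mult(2) m by (simp_all cong: measurable_cong_sets)
  then show ?case using mult by (simp add: nn_integral_cmult sum_distrib_left[symmetric] ennreal_times_divide)
next
  case (add u v)
  have "u \<in> borel_measurable (average N m)" "\<And>i. i < N \<Longrightarrow> u \<in> borel_measurable (m i)"
    "v \<in> borel_measurable (average N m)" "\<And>i. i < N \<Longrightarrow> v \<in> borel_measurable (m i)"
    using add m by (simp_all cong: measurable_cong_sets)
  then show ?case using add by (simp add: nn_integral_add sum.distrib add_divide_distrib_ennreal)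
next
  case (seq U)
  have *: "U k \<in> borel_measurable (average N m)" "\<And>i. i < N \<Longrightarrow> U k \<in> borel_measurable (m i)" for k
    using seq m by (simp_all cong: measurable_cong_sets)
  have int: "(\<integral>\<^sup>+ x. (SUP k. U k) x \<partial>M) = (SUP k. \<integral>\<^sup>+ x. U k x \<partial>M)" if "\<And>k. U k \<in> borel_measurable M" for M
    unfolding SUP_apply using seq(3) that by (intro nn_integral_monotone_convergence_SUP)
  have "(\<Sum>i<N. \<integral>\<^sup>+ x. (SUP k. U k) x \<partial>(m i)) = (\<Sum>i<N. SUP k. \<integral>\<^sup>+ x. U k x \<partial>(m i))"
    using int * by simp
  also have "\<dots> = (SUP k. \<Sum>i<N. \<integral>\<^sup>+ x. U k x \<partial>(m i))"
    using seq(3) by (intro ennreal_SUP_sum[symmetric]) (auto simp: incseq_def le_fun_def intro!: nn_integral_mono)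
  finally show ?case
    using int[of "average N m"] * seq(5) by (simp add: divide_ennreal_def SUP_mult_right_ennreal)
qed

lemma integral_empirical:
  fixes g :: "'a::topological_space \<Rightarrow> real"
  assumes g: "g \<in> borel_measurable borel" and g0: "\<And>x. 0 \<le> g x" and N: "0 < N"
  shows "(\<integral> u. g u \<partial>(empirical N x)) = (\<Sum>i<N. g (x i)) / real N"
proof -
  have "(\<integral>\<^sup>+ u. ennreal (g u) \<partial>(empirical N x)) = (\<Sum>i<N. ennreal (g (x i))) / of_nat N"
    unfolding empirical_def using g by (subst nn_integral_average) (auto simp: nn_integral_return)
  also have "\<dots> = ennreal ((\<Sum>i<N. g (x i)) / real N)"
    using g0 by (simp add: ennreal_divide_of_nat_eq[OF N] ennreal_mult[symmetric] sum_nonneg)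
  finally have "(\<integral>\<^sup>+ u. ennreal (g u) \<partial>(empirical N x)) = ennreal ((\<Sum>i<N. g (x i)) / real N)" .
  moreover have "g \<in> borel_measurable (empirical N x)"
    using g by (simp add: empirical_def cong: measurable_cong_sets)
  ultimately show ?thesis
    using g0 by (simp add: integral_eq_nn_integral sum_nonneg)
qed

context iid_sequence begin

text \<open>
An average is a U-statistic: summing \<open>(f z + f z') / 2\<close> over the ordered pairs of distinct indices below \<open>n\<close>
gives \<open>n - 1\<close> times the sum of \<open>f\<close>.
\<close>

lemma AE_eventually_average_le:
  fixes f :: "'z \<Rightarrow> real"
  assumes f [measurable]: "f \<in> borel_measurable N" and f0: "\<And>z. 0 \<le> f z" and fB: "\<And>z. f z \<le> B"
  shows "AE \<omega> in M. \<forall>e > (\<integral> z. f z \<partial>\<gamma>). \<forall>\<^sub>F n in sequentially. (\<Sum>i<n. f (Z i \<omega>)) / real n \<le> e"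
proof -
  interpret G: prob_space \<gamma> by (rule prob_space_law)
  interpret GG: pair_prob_space \<gamma> \<gamma> ..
  define k where "k p = (ennreal (f (fst p)) + ennreal (f (snd p))) / 2" for p
  have k [measurable]: "k \<in> borel_measurable (N \<Otimes>\<^sub>M N)" unfolding k_def divide_ennreal_def by measurable
  have int: "(\<integral>\<^sup>+ z. ennreal (f z) \<partial>\<gamma>) = ennreal (\<integral> z. f z \<partial>\<gamma>)"
    using f0 fB by (intro nn_integral_eq_integral G.integrable_const_bound[of _ B]) auto
  have e0: "0 \<le> (\<integral> z. f z \<partial>\<gamma>)" using f0 by simp
  have "(\<integral>\<^sup>+ p. k p \<partial>(\<gamma> \<Otimes>\<^sub>M \<gamma>)) = (\<integral>\<^sup>+ z. \<integral>\<^sup>+ z'. k (z, z') \<partial>\<gamma> \<partial>\<gamma>)"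
    by (intro G.nn_integral_fst[symmetric]) measurable
  also have "\<dots> = ((\<integral>\<^sup>+ z. ennreal (f z) \<partial>\<gamma>) + (\<integral>\<^sup>+ z. ennreal (f z) \<partial>\<gamma>)) / 2"
    unfolding k_def divide_ennreal_def by (simp add: nn_integral_add nn_integral_multc G.emeasure_space_1)
  also have "\<dots> = ennreal (\<integral> z. f z \<partial>\<gamma>)" by (simp only: ennreal_half_double int)
  finally have "(\<integral>\<^sup>+ p. k p \<partial>(\<gamma> \<Otimes>\<^sub>M \<gamma>)) \<le> ennreal (\<integral> z. f z \<partial>\<gamma>)" by simp
  from U_statistic_upper_law[OF k _ this e0]
  have "AE \<omega> in M. \<forall>e > (\<integral> z. f z \<partial>\<gamma>). \<forall>\<^sub>F n in sequentially.
      (\<Sum>(i, j)\<in>off_diagonal n. k (Z i \<omega>, Z j \<omega>)) \<le> ennreal (e * card (off_diagonal n))"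
    by (simp add: k_def add.commute)
  then show ?thesis
  proof eventually_elim
    case (elim \<omega>)
    show ?case
    proof (intro allI impI)
      fix e assume e: "(\<integral> z. f z \<partial>\<gamma>) < e"
      show "\<forall>\<^sub>F n in sequentially. (\<Sum>i<n. f (Z i \<omega>)) / real n \<le> e"
        using elim[rule_format, OF e] eventually_gt_at_top[of 1]
      proof eventually_elim
        case (elim n)
        have "(\<Sum>(i, j)\<in>off_diagonal n. k (Z i \<omega>, Z j \<omega>)) =
            (\<Sum>i<n. \<Sum>j\<in>{..<n} - {i}. (ennreal (f (Z i \<omega>)) + ennreal (f (Z j \<omega>))) / 2 + 0)"
          unfolding off_diagonal_eq_Sigma by (subst sum.Sigma) (auto simp: k_def)
        also have "\<dots> = of_nat (n - 1) * (\<Sum>i<n. ennreal (f (Z i \<omega>)))"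
          unfolding sum_off_diagonal_pairs by simp
        also have "\<dots> = ennreal (real (n - 1) * (\<Sum>i<n. f (Z i \<omega>)))"
          using f0 by (simp add: ennreal_mult sum_nonneg ennreal_of_nat_eq_real_of_nat del: of_nat_diff)
        finally have "real (n - 1) * (\<Sum>i<n. f (Z i \<omega>)) \<le> e * card (off_diagonal n)"
          using elim e e0 by (simp add: ennreal_le_iff)
        also have "\<dots> = real (n - 1) * (e * real n)" by (simp add: card_off_diagonal)
        finally have "(\<Sum>i<n. f (Z i \<omega>)) \<le> e * real n"
          using elim by (subst (asm) mult_le_cancel_left_pos) auto
        then show ?case using elim by (simp add: pos_divide_le_eq)
      qed
    qed
  qed
qed

text \<open>
The upper bound for \<open>B - f\<close> is the lower bound for \<open>f\<close>.
\<close>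

lemma AE_average_tendsto:
  fixes f :: "'z \<Rightarrow> real"
  assumes f [measurable]: "f \<in> borel_measurable N" and f0: "\<And>z. 0 \<le> f z" and fB: "\<And>z. f z \<le> B"
  shows "AE \<omega> in M. (\<lambda>n. (\<Sum>i<n. f (Z i \<omega>)) / real n) \<longlonglongrightarrow> (\<integral> z. f z \<partial>\<gamma>)"
proof -
  interpret G: prob_space \<gamma> by (rule prob_space_law)
  have int: "integrable \<gamma> f" using f0 fB by (intro G.integrable_const_bound[of _ B]) auto
  have "AE \<omega> in M. \<forall>e > (\<integral> z. B - f z \<partial>\<gamma>). \<forall>\<^sub>F n in sequentially. (\<Sum>i<n. B - f (Z i \<omega>)) / real n \<le> e"
    using f0 fB by (intro AE_eventually_average_le[of _ B]) auto
  with AE_eventually_average_le[OF f f0 fB] show ?thesis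
  proof eventually_elim
    case (elim \<omega>)
    have int_diff: "(\<integral> z. B - f z \<partial>\<gamma>) = B - (\<integral> z. f z \<partial>\<gamma>)" using int by (simp add: G.prob_space)
    show ?case
    proof (rule order_tendstoI)
      fix a assume "a < (\<integral> z. f z \<partial>\<gamma>)"
      then obtain b where b: "a < b" "b < (\<integral> z. f z \<partial>\<gamma>)" using dense by blast
      then have "\<forall>\<^sub>F n in sequentially. (\<Sum>i<n. B - f (Z i \<omega>)) / real n \<le> B - b"
        using elim(2) int_diff by simp
      then show "\<forall>\<^sub>F n in sequentially. a < (\<Sum>i<n. f (Z i \<omega>)) / real n"
        using eventually_gt_at_top[of 0]
      proof eventually_elim
        case (elim n)
        have "(\<Sum>i<n. B - f (Z i \<omega>)) / real n = B - (\<Sum>i<n. f (Z i \<omega>)) / real n"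
          using elim(2) by (simp add: sum_subtractf diff_divide_distrib)
        then show ?case using elim(1) b by simp
      qed
    next
      fix a assume "(\<integral> z. f z \<partial>\<gamma>) < a"
      then obtain b where b: "b < a" "(\<integral> z. f z \<partial>\<gamma>) < b" using dense by blast
      then have "\<forall>\<^sub>F n in sequentially. (\<Sum>i<n. f (Z i \<omega>)) / real n \<le> b" using elim(1) by simp
      then show "\<forall>\<^sub>F n in sequentially. (\<Sum>i<n. f (Z i \<omega>)) / real n < a"
        by eventually_elim (use b in simp)
    qed
  qed
qed

end

lemma AE_test_averages_tendsto:
  fixes Z :: "nat \<Rightarrow> 'w \<Rightarrow> 'z::polish_space"
  assumes "iid_sequence M borel \<gamma> Z"
  shows "AE \<omega> in M. \<forall>g\<in>test_functions. (\<lambda>n. (\<Sum>i<n. g (Z i \<omega>)) / real n) \<longlonglongrightarrow> (\<integral> z. g z \<partial>\<gamma>)"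
proof -
  interpret iid_sequence M borel \<gamma> Z by fact
  show ?thesis
  proof (rule AE_ball_countable'[OF _ countable_test_functions])
    fix g :: "'z \<Rightarrow> real" assume g: "g \<in> test_functions"
    obtain B where "\<And>x. 0 \<le> g x" "\<And>x. g x \<le> B" using test_function_bounded_Lipschitz[OF g] by metis
    then show "AE \<omega> in M. (\<lambda>n. (\<Sum>i<n. g (Z i \<omega>)) / real n) \<longlonglongrightarrow> (\<integral> z. g z \<partial>\<gamma>)"
      using borel_measurable_continuous_onI[OF test_function_continuous[OF g]] by (intro AE_average_tendsto)
  qed
qed

lemma empirical_test_integrals_tendsto:
  fixes x :: "nat \<Rightarrow> 'z::polish_space"
  assumes g: "g \<in> test_functions" and lim: "(\<lambda>n. (\<Sum>i<n. g (x i)) / real n) \<longlonglongrightarrow> l"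
  shows "(\<lambda>n. \<integral> u. g u \<partial>(empirical n x)) \<longlonglongrightarrow> l"
proof (rule Lim_transform_eventually[OF lim])
  show "\<forall>\<^sub>F n in sequentially. (\<Sum>i<n. g (x i)) / real n = (\<integral> u. g u \<partial>(empirical n x))"
    using eventually_gt_at_top[of 0]
    by eventually_elim
      (use borel_measurable_continuous_onI[OF test_function_continuous[OF g]] test_function_nonneg[OF g]
        in \<open>simp add: integral_empirical\<close>)
qed

lemma empirical_Prob:
  assumes "0 < N"
  shows "empirical N x \<in> Prob"
proof -
  have "emeasure (empirical N x) (space (empirical N x)) = of_nat N / of_nat N"
    by (simp add: empirical_def emeasure_average)
  also have "\<dots> = 1" using assms by (intro ennreal_divide_self) (auto simp: of_nat_less_top)
  finally have "prob_space (empirical N x)" by (rule prob_spaceI)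
  then show ?thesis by (simp add: space_prob_algebra empirical_def)
qed

section \<open>Actions for a given sample of types\<close>

lemma atomless_singleton_null:
  fixes \<mu> :: "'a::t1_space measure"
  assumes "atomless \<mu>" "sets \<mu> = sets borel"
  shows "emeasure \<mu> {x} = 0"
proof (rule ccontr)
  assume "emeasure \<mu> {x} \<noteq> 0"
  then have "0 < emeasure \<mu> {x}" by (simp add: zero_less_iff_neq_zero)
  then obtain B where "B \<subseteq> {x}" "0 < emeasure \<mu> B" "emeasure \<mu> B < emeasure \<mu> {x}"
    using assms unfolding atomless_def by (metis borel_singleton sets.empty_sets)
  then show False by (auto simp: subset_singleton_iff)
qed

text \<open>
Without atoms, two independent variables with the same law coincide with probability zero.
\<close>

lemma AE_iid_inj:
  fixes X :: "nat \<Rightarrow> 'w \<Rightarrow> 'a::polish_space"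
  assumes "iid_sequence P borel \<mu> X" "atomless \<mu>"
  shows "AE \<omega> in P. inj (\<lambda>i. X i \<omega>)"
proof -
  interpret iid_sequence P borel \<mu> X by fact
  interpret G: prob_space \<mu> by (rule prob_space_law)
  have "AE \<omega> in P. X i \<omega> \<noteq> X j \<omega>" if "i \<noteq> j" for i j
  proof -
    let ?D = "{p :: 'a \<times> 'a. fst p = snd p}"
    have "closed ?D" by (intro closed_Collect_eq continuous_intros)
    then have "?D \<in> sets borel" by (rule borel_closed)
    then have D: "?D \<in> sets (borel \<Otimes>\<^sub>M borel)" by (simp only: borel_prod)
    have "(\<integral>\<^sup>+ \<omega>. indicator ?D (X i \<omega>, X j \<omega>) \<partial>P) = (\<integral>\<^sup>+ p. indicator ?D p \<partial>(\<mu> \<Otimes>\<^sub>M \<mu>))"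
      using D by (intro nn_integral_pair that) simp
    also have "\<dots> = (\<integral>\<^sup>+ z. \<integral>\<^sup>+ z'. indicator ?D (z, z') \<partial>\<mu> \<partial>\<mu>)"
      using D by (intro G.nn_integral_fst[symmetric]) (simp cong: measurable_cong_sets sets_pair_measure_cong)
    also have "\<dots> = (\<integral>\<^sup>+ z. \<integral>\<^sup>+ z'. indicator {z} z' \<partial>\<mu> \<partial>\<mu>)"
      by (intro nn_integral_cong) (auto simp: indicator_def)
    also have "\<dots> = 0"
      using atomless_singleton_null[OF assms(2) sets_law] sets_law by simp
    finally have "AE \<omega> in P. indicator ?D (X i \<omega>, X j \<omega>) = (0 :: ennreal)"
      using D by (subst (asm) nn_integral_0_iff_AE) measurable
    then show ?thesis by eventually_elim (auto simp: indicator_def)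
  qed
  then have "AE \<omega> in P. \<forall>i j. i \<noteq> j \<longrightarrow> X i \<omega> \<noteq> X j \<omega>" by (simp add: AE_all_countable)
  then show ?thesis by eventually_elim (auto simp: inj_def)
qed

text \<open>
The projection of a measurable set need not be Borel. But a set of full measure contains, up to
measure zero, a countable union of compact sets, and the continuous image of a compact set is compact.
\<close>

lemma AE_projection:
  fixes Q :: "'z::polish_space measure" and \<pi> :: "'z \<Rightarrow> 'x::t2_space"
  assumes "prob_space Q" and sets: "sets Q = sets borel" and \<pi>: "continuous_on UNIV \<pi>"
    and R: "AE z in Q. R z"
  shows "AE x in distr Q borel \<pi>. \<exists>z. \<pi> z = x \<and> R z"
proof -
  interpret prob_space Q by fact
  have [measurable]: "\<pi> \<in> borel_measurable Q"
    using borel_measurable_continuous_onI[OF \<pi>] sets by (simp cong: measurable_cong_sets)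
  have sp: "space Q = UNIV" using sets_eq_imp_space_eq[OF sets] by simp
  interpret D: prob_space "distr Q borel \<pi>" by (rule prob_space_distr) measurable
  obtain E where E: "{z \<in> space Q. \<not> R z} \<subseteq> E" "E \<in> sets Q" "emeasure Q E = 0"
    using R by (auto elim: AE_E)
  define G where "G = space Q - E"
  have G: "G \<in> sets Q" "emeasure Q G = 1"
    using E unfolding G_def by (auto simp: emeasure_compl emeasure_space_1)
  have GR: "R z" if "z \<in> G" for z using that E sp by (auto simp: G_def)
  have SUP: "(SUP K\<in>{K. K \<subseteq> G \<and> compact K}. emeasure Q K) = 1"
    using inner_regular[of Q G] sets G by simp
  have "\<exists>K. K \<subseteq> G \<and> compact K \<and> ennreal (1 - 1 / real (Suc n)) < emeasure Q K" for n
  proof -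
    have "ennreal (1 - 1 / real (Suc n)) < 1" by (subst ennreal_1[symmetric], subst ennreal_less_iff) auto
    then show ?thesis unfolding SUP[symmetric] less_SUP_iff by blast
  qed
  then obtain K where K: "\<And>n. K n \<subseteq> G" "\<And>n. compact (K n)" "\<And>n. ennreal (1 - 1 / real (Suc n)) < emeasure Q (K n)"
    by metis
  define A where "A = (\<Union>n. \<pi> ` K n)"
  have "closed (\<pi> ` K n)" for n
    using K(2) continuous_on_subset[OF \<pi>] by (intro compact_imp_closed compact_continuous_image) auto
  then have "range (\<lambda>n. \<pi> ` K n) \<subseteq> sets borel" by (auto intro: borel_closed)
  then have A [measurable]: "A \<in> sets borel" unfolding A_def by (rule sets.countable_nat_UN)
  have "1 \<le> emeasure (distr Q borel \<pi>) A"
  proof (rule LIMSEQ_le_const2)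
    show "(\<lambda>n. ennreal (1 - 1 / real (Suc n))) \<longlonglongrightarrow> 1"
      using tendsto_diff[OF tendsto_const LIMSEQ_inverse_real_of_nat, of 1]
      by (subst ennreal_1[symmetric]) (intro tendsto_ennrealI, simp add: inverse_eq_divide)
    have "ennreal (1 - 1 / real (Suc n)) \<le> emeasure (distr Q borel \<pi>) A" for n
    proof -
      have "\<pi> -` A \<inter> space Q \<in> sets Q" by measurable
      moreover have "K n \<subseteq> \<pi> -` A \<inter> space Q" by (auto simp: A_def sp)
      ultimately have "emeasure Q (K n) \<le> emeasure Q (\<pi> -` A \<inter> space Q)" by (rule emeasure_mono[rotated])
      then show ?thesis using K(3)[of n] by (simp add: emeasure_distr)
    qed
    then show "\<exists>N. \<forall>n\<ge>N. ennreal (1 - 1 / real (Suc n)) \<le> emeasure (distr Q borel \<pi>) A" by blast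
  qed
  then have "emeasure (distr Q borel \<pi>) A = 1"
    using D.emeasure_space_1 emeasure_space[of "distr Q borel \<pi>" A] by (simp add: antisym)
  then have "AE x in distr Q borel \<pi>. x \<in> A"
    by (simp add: D.AE_in_set_eq_1 measure_def)
  then show ?thesis
  proof eventually_elim
    case (elim x)
    then show ?case using K(1) GR by (auto simp: A_def)
  qed
qed

text \<open>
On the countable power of a law, the coordinates are a sample from it.
\<close>

lemma iid_sequence_coordinates:
  fixes \<gamma> :: "'z::topological_space measure"
  assumes \<gamma>: "\<gamma> \<in> Prob"
  shows "iid_sequence (PiM UNIV (\<lambda>_. \<gamma>)) borel \<gamma> (\<lambda>i z. z i)"
proof -
  have [measurable_cong]: "sets \<gamma> = sets borel" and "prob_space \<gamma>" using \<gamma> by (auto simp: space_prob_algebra)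
  interpret product_prob_space "\<lambda>_. \<gamma>" UNIV
    using \<open>prob_space \<gamma>\<close> by (simp add: product_prob_spaceI)
  have law: "distr (PiM UNIV (\<lambda>_. \<gamma>)) borel (\<lambda>z. z i) = \<gamma>" for i
  proof -
    have "distr (PiM UNIV (\<lambda>_. \<gamma>)) borel (\<lambda>z. z i) = distr (PiM UNIV (\<lambda>_. \<gamma>)) \<gamma> (\<lambda>z. z i)"
      by (intro distr_cong) (auto simp: \<open>sets \<gamma> = sets borel\<close>)
    then show ?thesis using PiM_component[of i] by simp
  qed
  have "indep_vars (\<lambda>_. borel) (\<lambda>i z. z i) UNIV"
  proof (subst indep_vars_iff_distr_eq_PiM)
    have "distr (PiM UNIV (\<lambda>_. \<gamma>)) (PiM UNIV (\<lambda>_. borel)) (\<lambda>z. z) = distr (PiM UNIV (\<lambda>_. \<gamma>)) (PiM UNIV (\<lambda>_. \<gamma>)) (\<lambda>z. z)"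
      by (intro distr_cong sets_PiM_cong) (auto simp: \<open>sets \<gamma> = sets borel\<close>)
    then show "distr (PiM UNIV (\<lambda>_. \<gamma>)) (PiM UNIV (\<lambda>_. borel)) (\<lambda>z. restrict (\<lambda>i. z i) UNIV) =
        PiM UNIV (\<lambda>i. distr (PiM UNIV (\<lambda>_. \<gamma>)) borel (\<lambda>z. z i))"
      by (simp add: law distr_id2 restrict_def)
  qed auto
  then show ?thesis
    by (intro iid_sequence.intro iid_sequence_axioms.intro law) unfold_locales
qed

lemma law_of_sequence:
  fixes X :: "nat \<Rightarrow> 'w \<Rightarrow> 'a::second_countable_topology"
  assumes "prob_space P" "prob_space.indep_vars P (\<lambda>_. borel) X UNIV" "\<And>i. distr P borel (X i) = \<mu>"
  shows "distr P borel (\<lambda>\<omega> i. X i \<omega>) = PiM UNIV (\<lambda>_. \<mu>)"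
proof -
  interpret prob_space P by fact
  have rv: "X i \<in> borel_measurable P" for i using assms(2) by (simp add: indep_vars_def)
  have "distr P (PiM UNIV (\<lambda>_. borel)) (\<lambda>\<omega>. restrict (\<lambda>i. X i \<omega>) UNIV) = PiM UNIV (\<lambda>i. distr P borel (X i))"
    using assms(2) rv by (subst (asm) indep_vars_iff_distr_eq_PiM) auto
  moreover have "distr P borel (\<lambda>\<omega> i. X i \<omega>) = distr P (PiM UNIV (\<lambda>_. borel)) (\<lambda>\<omega> i. X i \<omega>)"
    by (intro distr_cong) (auto simp: sets_PiM_equal_borel)
  ultimately show ?thesis by (simp add: assms(3) restrict_def)
qed

text \<open>
A property of almost every sequence of pairs can be arranged, for almost every realisation of the given first
coordinates, by a choice of the second ones. No measurable dependence on \<open>\<omega>\<close> is claimed.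
\<close>

lemma AE_choose_second_coordinates:
  fixes X :: "nat \<Rightarrow> 'w \<Rightarrow> 'a::polish_space" and \<gamma> :: "('a \<times> 'b::polish_space) measure"
  assumes P: "prob_space P" "prob_space.indep_vars P (\<lambda>_. borel) X UNIV" "\<And>i. distr P borel (X i) = \<mu>"
    and \<gamma>: "\<gamma> \<in> Prob_marginal \<mu>"
    and R: "AE z in PiM UNIV (\<lambda>_::nat. \<gamma>). R z"
  shows "AE \<omega> in P. \<exists>y. R (\<lambda>i. (X i \<omega>, y i))"
proof -
  interpret prob_space P by (rule P(1))
  let ?Q = "PiM UNIV (\<lambda>_::nat. \<gamma>)"
  have \<gamma>P: "\<gamma> \<in> Prob" and marg: "distr \<gamma> borel fst = \<mu>" using \<gamma> by (auto simp: Prob_marginal_def)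
  have sets: "sets \<gamma> = sets borel" using \<gamma>P by (simp add: space_prob_algebra)
  interpret Q: iid_sequence ?Q borel \<gamma> "\<lambda>i z. z i" by (rule iid_sequence_coordinates[OF \<gamma>P])
  let ?\<pi> = "\<lambda>(z :: nat \<Rightarrow> 'a \<times> 'b) i. fst (z i)"
  have fst_m: "fst \<in> borel_measurable (borel :: ('a \<times> 'b) measure)"
    by (intro borel_measurable_continuous_onI continuous_on_fst continuous_on_id)
  have "distr ?Q borel ?\<pi> = PiM UNIV (\<lambda>_. \<mu>)"
  proof (rule law_of_sequence)
    show "Q.indep_vars (\<lambda>_. borel) (\<lambda>i z. fst (z i)) UNIV"
      using Q.indep_vars_compose2[OF Q.indep, of "\<lambda>_. fst" "\<lambda>_. borel"] fst_m by simp
    have "distr ?Q borel (\<lambda>z. fst (z i)) = distr (distr ?Q borel (\<lambda>z. z i)) borel fst" for i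
      using fst_m by (subst distr_distr) (auto simp: comp_def)
    then show "distr ?Q borel (\<lambda>z. fst (z i)) = \<mu>" for i using Q.law marg by simp
  qed unfold_locales
  then have law: "distr P borel (\<lambda>\<omega> i. X i \<omega>) = distr ?Q borel ?\<pi>"
    using law_of_sequence[OF P] by simp
  have "sets ?Q = sets borel"
    using sets_PiM_cong[OF refl, of UNIV "\<lambda>_. \<gamma>" "\<lambda>_. borel"] sets sets_PiM_equal_borel by auto
  moreover have "continuous_on UNIV ?\<pi>"
    by (intro continuous_on_coordinatewise_then_product continuous_on_fst continuous_on_product_coordinates)
  ultimately have "AE x in distr ?Q borel ?\<pi>. \<exists>z. ?\<pi> z = x \<and> R z"
    by (intro AE_projection R) unfold_locales
  then have "AE x in distr P borel (\<lambda>\<omega> i. X i \<omega>). \<exists>y. R (\<lambda>i. (x i, y i))"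
    unfolding law
  proof eventually_elim
    case (elim x)
    then obtain z where z: "?\<pi> z = x" "R z" by blast
    have "(\<lambda>i. (x i, snd (z i))) = z" unfolding z(1)[symmetric] by auto
    then show ?case using z(2) by (intro exI[of _ "\<lambda>i. snd (z i)"]) simp
  qed
  moreover have "(\<lambda>\<omega> i. X i \<omega>) \<in> borel_measurable P"
  proof -
    have "X i \<in> borel_measurable P" for i using P(2) by (simp add: indep_vars_def)
    then have "(\<lambda>\<omega> i. X i \<omega>) \<in> measurable P (PiM UNIV (\<lambda>_. borel))"
      by (intro measurable_PiM_single') auto
    then show ?thesis using measurable_cong_sets[OF refl sets_PiM_equal_borel] by auto
  qed
  ultimately show ?thesis by (rule AE_distrD[rotated])
qed

section \<open>The potentials as pair energies\<close>

definition individual_cost :: "('a \<times> 'b \<Rightarrow> ennreal) \<Rightarrow> ('b \<Rightarrow> ennreal) \<Rightarrow> 'a \<times> 'b \<Rightarrow> ennreal" where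
  "individual_cost c L z = c z + L (snd z)"

text \<open>
The individual costs are split evenly between the two players of a pair, which makes the kernel symmetric.
\<close>

definition pair_kernel :: "('a \<times> 'b \<Rightarrow> ennreal) \<Rightarrow> ('b \<Rightarrow> ennreal) \<Rightarrow> ('b \<times> 'b \<Rightarrow> ennreal) \<Rightarrow>
    ('a \<times> 'b) \<times> ('a \<times> 'b) \<Rightarrow> ennreal" where
  "pair_kernel c L H p = (individual_cost c L (fst p) + individual_cost c L (snd p)) / 2 + H (snd (fst p), snd (snd p))"

lemma lower_semicontinuous_pair_kernel:
  fixes c :: "'a::polish_space \<times> 'b::polish_space \<Rightarrow> ennreal"
  assumes "lower_semicontinuous c" "lower_semicontinuous L" "lower_semicontinuous H"
  shows "lower_semicontinuous (pair_kernel c L H)"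
proof -
  have f: "lower_semicontinuous (individual_cost c L)"
    unfolding individual_cost_def[abs_def]
    using assms by (intro lower_semicontinuous_add lower_semicontinuous_compose[of L snd] continuous_intros)
  show ?thesis
    unfolding pair_kernel_def[abs_def]
    by (intro lower_semicontinuous_add lower_semicontinuous_half lower_semicontinuous_compose[OF f]
        lower_semicontinuous_compose[OF assms(3)] continuous_intros)
qed

lemma return_pair_Prob:
  fixes x :: "'a::second_countable_topology" and \<nu> :: "'b::second_countable_topology measure"
  assumes "\<nu> \<in> Prob"
  shows "return borel x \<Otimes>\<^sub>M \<nu> \<in> Prob"
proof -
  interpret N: prob_space \<nu> using assms ProbD by auto
  interpret R: prob_space "return borel x" by (rule prob_space_return) simp
  interpret pair_prob_space "return borel x" \<nu> ..
  show ?thesis using sets_return_pair[OF assms] P.prob_space_axioms by (simp add: space_prob_algebra)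
qed

lemma distr_snd_return_pair:
  fixes x :: "'a::second_countable_topology" and \<nu> :: "'b::second_countable_topology measure"
  assumes \<nu>: "\<nu> \<in> Prob"
  shows "distr (return borel x \<Otimes>\<^sub>M \<nu>) borel snd = \<nu>"
proof (rule measure_eqI)
  show "sets (distr (return borel x \<Otimes>\<^sub>M \<nu>) borel snd) = sets \<nu>" using ProbD[OF \<nu>] by simp
  fix A assume "A \<in> sets (distr (return borel x \<Otimes>\<^sub>M \<nu>) borel snd)"
  then have A: "A \<in> sets borel" by simp
  have "UNIV \<times> A \<in> sets ((borel :: 'a measure) \<Otimes>\<^sub>M (borel :: 'b measure))" using A by (intro pair_measureI) auto
  then have UA: "UNIV \<times> A \<in> sets (borel :: ('a \<times> 'b) measure)" by (simp only: borel_prod)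
  have "snd \<in> measurable (return borel x \<Otimes>\<^sub>M \<nu>) borel"
    using measurable_snd measurable_cong_sets[OF refl ProbD(2)[OF \<nu>]] by blast
  then have "emeasure (distr (return borel x \<Otimes>\<^sub>M \<nu>) borel snd) A = emeasure (return borel x \<Otimes>\<^sub>M \<nu>) (UNIV \<times> A)"
    using A ProbD(3)[OF \<nu>] by (subst emeasure_distr) (auto simp: space_pair_measure intro!: arg_cong[of _ _ "emeasure _"])
  also have "\<dots> = emeasure \<nu> A"
    using emeasure_return_pair[OF \<nu> UA] by (simp add: vimage_def)
  finally show "emeasure (distr (return borel x \<Otimes>\<^sub>M \<nu>) borel snd) A = emeasure \<nu> A" .
qed

lemma mixed_profile_Prob_marginal:
  fixes x :: "nat \<Rightarrow> 'a::polish_space" and \<nu> :: "nat \<Rightarrow> 'b::polish_space measure"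
  assumes \<nu>: "\<And>i. i < N \<Longrightarrow> \<nu> i \<in> Prob" and N: "0 < N"
  shows "mixed_profile N x \<nu> \<in> Prob_marginal (empirical N x)"
proof -
  have sets: "sets (mixed_profile N x \<nu>) = sets borel" by (simp add: mixed_profile_def)
  have em: "emeasure (mixed_profile N x \<nu>) (A \<times> UNIV) = emeasure (empirical N x) A" if A: "A \<in> sets borel" for A
  proof -
    have "A \<times> (UNIV :: 'b set) \<in> sets (borel \<Otimes>\<^sub>M borel)" using A by (intro pair_measureI) auto
    then have "A \<times> (UNIV :: 'b set) \<in> sets borel" by (simp only: borel_prod)
    then have "emeasure (mixed_profile N x \<nu>) (A \<times> UNIV) = (\<Sum>i<N. emeasure (\<nu> i) (Pair (x i) -` (A \<times> UNIV))) / of_nat N"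
      by (intro emeasure_mixed_profile \<nu>) auto
    also have "(\<Sum>i<N. emeasure (\<nu> i) (Pair (x i) -` (A \<times> UNIV))) = (\<Sum>i<N. emeasure (return borel (x i)) A)"
    proof (intro sum.cong refl)
      fix i assume "i \<in> {..<N}"
      then have "emeasure (\<nu> i) UNIV = 1"
        using prob_space.emeasure_space_1[OF ProbD(1)[OF \<nu>]] ProbD(3)[OF \<nu>] by auto
      then show "emeasure (\<nu> i) (Pair (x i) -` (A \<times> UNIV)) = emeasure (return borel (x i)) A"
        using A by (auto simp: vimage_def indicator_def)
    qed
    finally show ?thesis using A by (simp add: empirical_def emeasure_average)
  qed
  have [measurable]: "fst \<in> borel_measurable (mixed_profile N x \<nu>)"
    using borel_measurable_continuous_onI[OF continuous_on_fst[OF continuous_on_id]] measurable_cong_sets[OF sets refl] by blast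
  have "emeasure (mixed_profile N x \<nu>) (space (mixed_profile N x \<nu>)) = 1"
  proof -
    have "emeasure (mixed_profile N x \<nu>) (space (mixed_profile N x \<nu>)) = emeasure (empirical N x) UNIV"
      using em[of UNIV] by (simp add: mixed_profile_def)
    also have "\<dots> = of_nat N / of_nat N" by (simp add: empirical_def emeasure_average)
    also have "\<dots> = 1" using N by (intro ennreal_divide_self) (auto simp: of_nat_less_top)
    finally show ?thesis .
  qed
  then have "prob_space (mixed_profile N x \<nu>)" by (rule prob_spaceI)
  moreover have "distr (mixed_profile N x \<nu>) borel fst = empirical N x"
  proof (rule measure_eqI)
    fix A assume "A \<in> sets (distr (mixed_profile N x \<nu>) borel fst)"
    then have A: "A \<in> sets borel" by simp
    have "fst -` A \<inter> space (mixed_profile N x \<nu>) = A \<times> UNIV" by (auto simp: mixed_profile_def)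
    then show "emeasure (distr (mixed_profile N x \<nu>) borel fst) A = emeasure (empirical N x) A"
      using A em by (simp add: emeasure_distr)
  qed (simp add: empirical_def)
  ultimately show ?thesis using sets by (simp add: Prob_marginal_def space_prob_algebra)
qed

lemma pair_energy_average:
  fixes m :: "nat \<Rightarrow> 'z::second_countable_topology measure" and k :: "'z \<times> 'z \<Rightarrow> ennreal"
  assumes m: "\<And>i. i < N \<Longrightarrow> m i \<in> Prob" and k: "k \<in> borel_measurable borel"
  shows "pair_energy k (average N m) (average N m) = (\<Sum>i<N. (\<Sum>j<N. pair_energy k (m i) (m j)) / of_nat N) / of_nat N"
proof -
  note [measurable_cong] = ProbD(2)[OF m]
  have [measurable]: "k \<in> borel_measurable (borel \<Otimes>\<^sub>M borel)" using k by (simp only: borel_prod)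
  have inner: "(\<integral>\<^sup>+ z'. k (z, z') \<partial>(average N m)) = (\<Sum>j<N. \<integral>\<^sup>+ z'. k (z, z') \<partial>(m j)) / of_nat N" for z
    using ProbD(2)[OF m] by (intro nn_integral_average) auto
  have meas: "(\<lambda>z. \<integral>\<^sup>+ z'. k (z, z') \<partial>(m j)) \<in> borel_measurable borel" if "j < N" for j
  proof -
    interpret prob_space "m j" using m[OF that] ProbD by auto
    note [measurable_cong] = ProbD(2)[OF m[OF that]]
    show ?thesis by measurable
  qed
  have sums: "(\<lambda>z. (\<Sum>j<N. \<integral>\<^sup>+ z'. k (z, z') \<partial>(m j)) / of_nat N) \<in> borel_measurable borel"
    using meas unfolding divide_ennreal_def by (intro borel_measurable_times_ennreal borel_measurable_sum) auto
  have "pair_energy k (average N m) (average N m) =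
      (\<Sum>i<N. \<integral>\<^sup>+ z. (\<Sum>j<N. \<integral>\<^sup>+ z'. k (z, z') \<partial>(m j)) / of_nat N \<partial>(m i)) / of_nat N"
    unfolding pair_energy_def inner using ProbD(2)[OF m] sums by (intro nn_integral_average) auto
  also have "\<dots> = (\<Sum>i<N. (\<Sum>j<N. pair_energy k (m i) (m j)) / of_nat N) / of_nat N"
  proof (intro arg_cong[of _ _ "\<lambda>x. x / of_nat N"] sum.cong refl)
    fix i assume "i \<in> {..<N}"
    then have "(\<lambda>z. \<integral>\<^sup>+ z'. k (z, z') \<partial>(m j)) \<in> borel_measurable (m i)" if "j < N" for j
      using meas[OF that] ProbD(2)[OF m, of i] by (simp cong: measurable_cong_sets)
    then show "(\<integral>\<^sup>+ z. (\<Sum>j<N. \<integral>\<^sup>+ z'. k (z, z') \<partial>(m j)) / of_nat N \<partial>(m i)) = (\<Sum>j<N. pair_energy k (m i) (m j)) / of_nat N"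
      unfolding pair_energy_def
      by (subst nn_integral_divide, force intro!: borel_measurable_sum, subst nn_integral_sum, auto)
  qed
  finally show ?thesis .
qed

context
  fixes c :: "'a::polish_space \<times> 'b::polish_space \<Rightarrow> ennreal" and L :: "'b \<Rightarrow> ennreal" and H :: "'b \<times> 'b \<Rightarrow> ennreal"
  assumes c: "c \<in> borel_measurable borel" and L: "L \<in> borel_measurable borel" and H: "H \<in> borel_measurable borel"
begin

lemma snd_measurable_borel: "snd \<in> borel_measurable (borel :: ('a \<times> 'b) measure)"
  by (intro borel_measurable_continuous_onI continuous_on_snd continuous_on_id)

lemma individual_cost_measurable: "individual_cost c L \<in> borel_measurable borel"
  unfolding individual_cost_def[abs_def]
  using c measurable_compose[OF snd_measurable_borel L] by (intro borel_measurable_add) auto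

lemma H_pair_measurable: "H \<in> borel_measurable (borel \<Otimes>\<^sub>M borel)"
  using H by (simp only: borel_prod)

lemma nn_integral_individual_cost:
  assumes "\<gamma> \<in> (Prob :: ('a \<times> 'b) measure set)"
  shows "(\<integral>\<^sup>+ z. individual_cost c L z \<partial>\<gamma>) = (\<integral>\<^sup>+ z. c z \<partial>\<gamma>) + (\<integral>\<^sup>+ y. L y \<partial>(distr \<gamma> borel snd))"
proof -
  note [measurable_cong] = ProbD(2)[OF assms]
  have [measurable]: "snd \<in> borel_measurable \<gamma>" "c \<in> borel_measurable \<gamma>" "L \<in> borel_measurable borel"
    using snd_measurable_borel c L by simp_all
  show ?thesis unfolding individual_cost_def by (simp add: nn_integral_add nn_integral_distr)
qed

lemma pair_energy_pair_kernel:
  assumes \<gamma>: "\<gamma> \<in> (Prob :: ('a \<times> 'b) measure set)" and \<gamma>': "\<gamma>' \<in> (Prob :: ('a \<times> 'b) measure set)"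
  shows "pair_energy (pair_kernel c L H) \<gamma> \<gamma>' =
    ((\<integral>\<^sup>+ z. individual_cost c L z \<partial>\<gamma>) + (\<integral>\<^sup>+ z. individual_cost c L z \<partial>\<gamma>')) / 2 +
    mean_interaction H (distr \<gamma> borel snd) (distr \<gamma>' borel snd)"
proof -
  interpret G: prob_space \<gamma> using \<gamma> ProbD by auto
  interpret G': prob_space \<gamma>' using \<gamma>' ProbD by auto
  note [measurable_cong] = ProbD(2)[OF \<gamma>] ProbD(2)[OF \<gamma>']
  note [measurable] = individual_cost_measurable H_pair_measurable
  have [measurable]: "snd \<in> borel_measurable \<gamma>" "snd \<in> borel_measurable \<gamma>'"
    using snd_measurable_borel by simp_all
  interpret D': prob_space "distr \<gamma>' borel snd" by (rule G'.prob_space_distr) measurable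
  let ?f = "individual_cost c L" and ?\<nu> = "distr \<gamma> borel snd" and ?\<nu>' = "distr \<gamma>' borel snd"
  have inner: "(\<integral>\<^sup>+ z'. pair_kernel c L H (z, z') \<partial>\<gamma>') =
      (?f z + (\<integral>\<^sup>+ z. ?f z \<partial>\<gamma>')) / 2 + (\<integral>\<^sup>+ y'. H (snd z, y') \<partial>?\<nu>')" for z
    unfolding pair_kernel_def divide_ennreal_def
    by (simp add: nn_integral_add nn_integral_multc nn_integral_distr G'.emeasure_space_1)
  have "pair_energy (pair_kernel c L H) \<gamma> \<gamma>' =
      ((\<integral>\<^sup>+ z. ?f z \<partial>\<gamma>) + (\<integral>\<^sup>+ z. ?f z \<partial>\<gamma>')) / 2 + (\<integral>\<^sup>+ y. \<integral>\<^sup>+ y'. H (y, y') \<partial>?\<nu>' \<partial>?\<nu>)"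
    unfolding pair_energy_def inner divide_ennreal_def
    by (simp add: nn_integral_add nn_integral_multc nn_integral_distr G.emeasure_space_1)
  also have "(\<integral>\<^sup>+ y. \<integral>\<^sup>+ y'. H (y, y') \<partial>?\<nu>' \<partial>?\<nu>) = mean_interaction H ?\<nu> ?\<nu>'"
    unfolding mean_interaction_def by (intro D'.nn_integral_fst) measurable
  finally show ?thesis .
qed

lemma limit_potential_eq_pair_energy:
  assumes "\<gamma> \<in> Prob_marginal \<mu>"
  shows "limit_potential \<mu> c L H \<gamma> = pair_energy (pair_kernel c L H) \<gamma> \<gamma>"
  using assms nn_integral_individual_cost pair_energy_pair_kernel
  by (simp add: limit_potential_def Prob_marginal_def ennreal_half_double Let_def)

text \<open>
For pairwise distinct types the strategies recovered from a profile are the given ones.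
\<close>

lemma mixed_potential_mixed_profile:
  fixes x :: "nat \<Rightarrow> 'a" and \<nu> :: "nat \<Rightarrow> 'b measure"
  assumes inj: "inj_on x {..<N}" and N: "0 < N" and \<nu>: "\<And>i. i < N \<Longrightarrow> \<nu> i \<in> Prob"
  shows "mixed_potential c L H x N (mixed_profile N x \<nu>) =
    (\<Sum>i<N. \<integral>\<^sup>+ z. individual_cost c L z \<partial>(return borel (x i) \<Otimes>\<^sub>M \<nu> i)) / of_nat N +
    (\<Sum>i<N. \<Sum>j\<in>{..<N} - {i}. mean_interaction H (\<nu> i) (\<nu> j)) / (of_nat N)\<^sup>2"
proof -
  let ?\<gamma> = "mixed_profile N x \<nu>" and ?\<nu>' = "strategies N x (mixed_profile N x \<nu>)"
  have "\<exists>\<nu>'. (\<forall>i<N. \<nu>' i \<in> Prob) \<and> ?\<gamma> = mixed_profile N x \<nu>'" using \<nu> by blast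
  from someI_ex[OF this] have s: "\<And>i. i < N \<Longrightarrow> ?\<nu>' i \<in> Prob" "?\<gamma> = mixed_profile N x ?\<nu>'"
    unfolding strategies_def[symmetric] by blast+
  have eq: "?\<nu>' i = \<nu> i" if "i < N" for i
    using strategies_unique[OF inj \<nu> s(1) s(2) that] by simp
  have "(\<integral>\<^sup>+ z. c z \<partial>?\<gamma>) = (\<Sum>i<N. \<integral>\<^sup>+ z. c z \<partial>(return borel (x i) \<Otimes>\<^sub>M \<nu> i)) / of_nat N"
    unfolding mixed_profile_def using \<nu> c by (intro nn_integral_average sets_return_pair) auto
  moreover have "(\<integral>\<^sup>+ z. individual_cost c L z \<partial>(return borel (x i) \<Otimes>\<^sub>M \<nu> i)) =
      (\<integral>\<^sup>+ z. c z \<partial>(return borel (x i) \<Otimes>\<^sub>M \<nu> i)) + (\<integral>\<^sup>+ y. L y \<partial>\<nu> i)" if "i < N" for i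
    using nn_integral_individual_cost[OF return_pair_Prob[OF \<nu>[OF that]], of "x i"] distr_snd_return_pair[OF \<nu>[OF that], of "x i"]
    by simp
  ultimately show ?thesis
    using mixed_profile_Prob_marginal[of N \<nu> x, OF \<nu> N] eq
    by (simp add: mixed_potential_def Let_def sum.distrib add_divide_distrib_ennreal add.assoc)
qed

text \<open>
The energy of an average of \<open>N\<close> measures is a double sum. Off the diagonal \<open>\<kappa>\<close> is bounded by the
pair kernel, and the \<open>N\<close> diagonal terms, of weight \<open>1 / N\<^sup>2\<close> each, contribute at most \<open>B / N\<close>. The
off-diagonal sum counts every individual cost \<open>N - 1\<close> times instead of \<open>N\<close>, which only makes it smaller.
\<close>

lemma mixed_potential_ge_pair_energy:
  fixes x :: "nat \<Rightarrow> 'a" and \<kappa> :: "('a \<times> 'b) \<times> ('a \<times> 'b) \<Rightarrow> real"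
  assumes inj: "inj_on x {..<N}" and N: "0 < N" and \<zeta>: "\<zeta> \<in> Prob_marginal (empirical N x)"
    and \<kappa>: "\<kappa> \<in> borel_measurable borel" and le: "\<And>p. ennreal (\<kappa> p) \<le> pair_kernel c L H p" and B: "\<And>p. \<kappa> p \<le> B" "0 \<le> B"
  shows "pair_energy (\<lambda>p. ennreal (\<kappa> p)) \<zeta> \<zeta> \<le> mixed_potential c L H x N \<zeta> + ennreal (B / real N)"
proof -
  obtain \<nu> where \<nu>: "\<And>i. i < N \<Longrightarrow> \<nu> i \<in> Prob" and \<zeta>_eq: "\<zeta> = mixed_profile N x \<nu>"
    using strategies_exist[OF inj N \<zeta>] by blast
  define m where "m i = return borel (x i) \<Otimes>\<^sub>M \<nu> i" for i
  have m: "m i \<in> Prob" "distr (m i) borel snd = \<nu> i" if "i < N" for i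
    unfolding m_def using return_pair_Prob distr_snd_return_pair \<nu>[OF that] by blast+
  define a where "a i = (\<integral>\<^sup>+ z. individual_cost c L z \<partial>(m i))" for i
  define h where "h i j = mean_interaction H (\<nu> i) (\<nu> j)" for i j
  define E where "E i j = pair_energy (\<lambda>p. ennreal (\<kappa> p)) (m i) (m j)" for i j
  define t where "t = ennreal (1 / real N)"
  have tN: "t * of_nat N = 1" using N by (simp add: t_def ennreal_of_nat_eq_real_of_nat ennreal_mult[symmetric])
  have over_N: "y / of_nat N = t * y" for y :: ennreal unfolding t_def by (rule ennreal_divide_of_nat_eq[OF N])
  have over_N2: "y / (of_nat N)\<^sup>2 = t * t * y" for y :: ennreal
    using ennreal_divide_of_nat_eq[of "N\<^sup>2" y] N by (simp add: t_def ennreal_mult[symmetric] power2_eq_square)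
  have E_off: "E i j \<le> (a i + a j) / 2 + h i j" if "i < N" "j < N" for i j
  proof -
    have "E i j \<le> pair_energy (pair_kernel c L H) (m i) (m j)"
      unfolding E_def pair_energy_def by (intro nn_integral_mono le)
    then show ?thesis using pair_energy_pair_kernel[OF m(1) m(1)] m(2) that by (simp add: a_def h_def)
  qed
  have E_diag: "E i i \<le> ennreal B" if "i < N" for i
  proof -
    interpret prob_space "m i" using m(1)[OF that] ProbD by auto
    have "E i i \<le> (\<integral>\<^sup>+ z. \<integral>\<^sup>+ z'. ennreal B \<partial>(m i) \<partial>(m i))"
      unfolding E_def pair_energy_def by (intro nn_integral_mono ennreal_leI B)
    then show ?thesis by (simp add: emeasure_space_1)
  qed
  have "pair_energy (\<lambda>p. ennreal (\<kappa> p)) \<zeta> \<zeta> = t * t * (\<Sum>i<N. \<Sum>j<N. E i j)"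
    unfolding \<zeta>_eq mixed_profile_def m_def[symmetric] using m(1) \<kappa>
    by (subst pair_energy_average) (auto simp: over_N E_def sum_distrib_left mult.assoc)
  also have "(\<Sum>i<N. \<Sum>j<N. E i j) \<le> (\<Sum>i<N. ennreal B + (\<Sum>j\<in>{..<N} - {i}. (a i + a j) / 2 + h i j))"
  proof (intro sum_mono)
    fix i assume i: "i \<in> {..<N}"
    have "(\<Sum>j<N. E i j) = E i i + (\<Sum>j\<in>{..<N} - {i}. E i j)" using i by (intro sum.remove) auto
    also have "\<dots> \<le> ennreal B + (\<Sum>j\<in>{..<N} - {i}. (a i + a j) / 2 + h i j)"
      using i by (intro add_mono E_diag sum_mono E_off) auto
    finally show "(\<Sum>j<N. E i j) \<le> ennreal B + (\<Sum>j\<in>{..<N} - {i}. (a i + a j) / 2 + h i j)" .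
  qed
  also have "\<dots> = of_nat N * ennreal B + (of_nat (N - 1) * (\<Sum>i<N. a i) + (\<Sum>i<N. \<Sum>j\<in>{..<N} - {i}. h i j))"
    unfolding sum.distrib[of _ _ "{..<N}"] sum_off_diagonal_pairs by simp
  also have "\<dots> \<le> of_nat N * ennreal B + (of_nat N * (\<Sum>i<N. a i) + (\<Sum>i<N. \<Sum>j\<in>{..<N} - {i}. h i j))"
    by (intro add_mono mult_right_mono) auto
  also have "t * t * \<dots> = (t * of_nat N) * t * ennreal B + ((t * of_nat N) * t * (\<Sum>i<N. a i) + t * t * (\<Sum>i<N. \<Sum>j\<in>{..<N} - {i}. h i j))"
    by (simp add: distrib_left mult_ac)
  also have "\<dots> = mixed_potential c L H x N \<zeta> + t * ennreal B"
  proof -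
    have "mixed_potential c L H x N \<zeta> = t * (\<Sum>i<N. a i) + t * t * (\<Sum>i<N. \<Sum>j\<in>{..<N} - {i}. h i j)"
      unfolding \<zeta>_eq using mixed_potential_mixed_profile[OF inj N, of \<nu>, OF \<nu>]
      by (simp add: over_N over_N2 a_def h_def m_def)
    then show ?thesis unfolding tN by (simp only: mult_1_left ac_simps)
  qed
  also have "t * ennreal B = ennreal (B / real N)"
    using B(2) by (simp add: t_def ennreal_mult[symmetric])
  finally show ?thesis by (simp add: mult_left_mono)
qed

text \<open>
Averaging the pair kernel over the \<open>N (N - 1)\<close> ordered pairs gives the individual costs their exact
weight \<open>1 / N\<close> and the interactions a weight slightly larger than \<open>1 / N\<^sup>2\<close>, so the average
dominates the potential.
\<close>

lemma pure_potential_le: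
  fixes x :: "nat \<Rightarrow> 'a" and y :: "nat \<Rightarrow> 'b" and e :: real
  assumes inj: "inj_on x {..<N}" and N: "1 < N" and e: "0 \<le> e"
    and le: "(\<Sum>(i, j)\<in>off_diagonal N. pair_kernel c L H ((x i, y i), (x j, y j))) \<le> ennreal (e * card (off_diagonal N))"
  shows "pure_potential c L H x N (empirical N (\<lambda>i. (x i, y i))) \<le> ennreal e"
proof -
  define a where "a i = individual_cost c L (x i, y i)" for i
  define h where "h i j = H (y i, y j)" for i j
  have N0: "0 < N" using N by simp
  have ret: "return borel u \<in> Prob" for u :: "'u::topological_space"
    by (simp add: space_prob_algebra prob_space_return)
  have pair: "return borel u \<Otimes>\<^sub>M return borel v = return borel (u, v)"
    for u :: "'u::second_countable_topology" and v :: "'v::second_countable_topology"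
  proof (rule measure_eqI)
    show "sets (return borel u \<Otimes>\<^sub>M return borel v) = sets (return borel (u, v))"
      using sets_return_pair[OF ret] by simp
    fix A assume "A \<in> sets (return borel u \<Otimes>\<^sub>M return borel v)"
    then have A: "A \<in> sets borel" using sets_return_pair[OF ret] by blast
    then have "A \<in> sets (borel \<Otimes>\<^sub>M borel)" by (simp only: borel_prod)
    then have "Pair u -` A \<in> sets borel" by (rule sets_Pair1)
    then show "emeasure (return borel u \<Otimes>\<^sub>M return borel v) A = emeasure (return borel (u, v)) A"
      using A emeasure_return_pair[OF ret A] by (simp add: indicator_def)
  qed
  have profile: "empirical N (\<lambda>i. (x i, y i)) = mixed_profile N x (\<lambda>i. return borel (y i))"
    unfolding empirical_def mixed_profile_def pair ..
  have int_a: "(\<integral>\<^sup>+ z. individual_cost c L z \<partial>(return borel (x i) \<Otimes>\<^sub>M return borel (y i))) = a i" for i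
    unfolding pair a_def by (intro nn_integral_return individual_cost_measurable) simp
  have int_h: "mean_interaction H (return borel (y i)) (return borel (y j)) = h i j" for i j
    unfolding mean_interaction_def pair h_def by (intro nn_integral_return H) simp
  have "pure_potential c L H x N (empirical N (\<lambda>i. (x i, y i))) =
      (\<Sum>i<N. a i) / of_nat N + (\<Sum>i<N. \<Sum>j\<in>{..<N} - {i}. h i j) / (of_nat N)\<^sup>2"
  proof -
    have "empirical N (\<lambda>i. (x i, y i)) \<in> pure_profiles N x" by (auto simp: pure_profiles_def)
    then show ?thesis
      unfolding pure_potential_def using mixed_potential_mixed_profile[OF inj N0, of "\<lambda>i. return borel (y i)", OF ret]
      by (simp add: profile int_a int_h)
  qed
  also have "\<dots> \<le> ennreal e"
  proof -
    define A where "A = (\<Sum>i<N. a i)"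
    define D where "D = (\<Sum>i<N. \<Sum>j\<in>{..<N} - {i}. h i j)"
    have "(\<Sum>(i, j)\<in>off_diagonal N. pair_kernel c L H ((x i, y i), (x j, y j))) =
        (\<Sum>i<N. \<Sum>j\<in>{..<N} - {i}. (a i + a j) / 2 + h i j)"
      unfolding off_diagonal_eq_Sigma by (subst sum.Sigma) (auto simp: pair_kernel_def a_def h_def)
    then have le': "of_nat (N - 1) * A + D \<le> ennreal (e * real (N * (N - 1)))"
      using le by (simp add: sum_off_diagonal_pairs A_def D_def card_off_diagonal)
    have "of_nat (N - 1) * A < top" "D < top"
      using le_less_trans[OF le' ennreal_less_top] by auto
    moreover have "(of_nat (N - 1) :: ennreal) \<noteq> 0" using N by simp
    ultimately have "A < top" "D < top" by (auto simp: ennreal_mult_less_top)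
    then obtain A' D' where A': "A = ennreal A'" "0 \<le> A'" and D': "D = ennreal D'" "0 \<le> D'"
      by (cases A; cases D) auto
    have "ennreal (real (N - 1) * A' + D') \<le> ennreal (e * real (N * (N - 1)))"
      using le' A' D' by (simp add: ennreal_of_nat_eq_real_of_nat ennreal_mult)
    then have real_le: "real (N - 1) * A' + D' \<le> e * real (N * (N - 1))"
      using e by (subst (asm) ennreal_le_iff) auto
    have "A / of_nat N + D / (of_nat N)\<^sup>2 = ennreal (A' / real N + D' / (real N)\<^sup>2)"
    proof -
      have "D / (of_nat N)\<^sup>2 = ennreal (1 / (real N)\<^sup>2) * D" using ennreal_divide_of_nat_eq[of "N\<^sup>2" D] N by simp
      then show ?thesis using ennreal_divide_of_nat_eq[OF N0, of A] A' D' by (simp add: ennreal_mult[symmetric])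
    qed
    also have "\<dots> \<le> ennreal e"
    proof (intro ennreal_leI)
      have N1: "0 < real N - 1" using N by simp
      have "D' / (real N)\<^sup>2 \<le> D' / (real N * (real N - 1))"
        using D' N1 N by (intro divide_left_mono) (auto simp: power2_eq_square)
      moreover have "A' / real N = ((real N - 1) * A') / (real N * (real N - 1))"
        using N1 by simp
      moreover have "((real N - 1) * A') / (real N * (real N - 1)) + D' / (real N * (real N - 1)) \<le> e"
      proof -
        define p where "p = real N * (real N - 1)"
        have "0 < p" using N1 N by (simp add: p_def)
        moreover have "(real N - 1) * A' + D' \<le> e * p"
          using real_le N by (simp add: p_def of_nat_diff)
        ultimately have "((real N - 1) * A' + D') / p \<le> e" by (simp only: pos_divide_le_eq)
        then show ?thesis unfolding p_def add_divide_distrib .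
      qed
      ultimately show "A' / real N + D' / (real N)\<^sup>2 \<le> e" by linarith
    qed
    finally show ?thesis by (simp add: A_def D_def)
  qed
  finally show ?thesis .
qed

end

lemma mixed_potential_le_pure: "mixed_potential c L H x N \<gamma> \<le> pure_potential c L H x N \<gamma>"
  by (simp add: pure_potential_def)

section \<open>The lower bound\<close>

text \<open>
Along the indices at which the first marginal is the empirical measure, the integrals of
\<open>g \<circ> fst\<close> and of \<open>g\<close> agree; both converge along the whole sequence, so their limits agree.
\<close>

lemma marginal_of_limit:
  fixes \<zeta> :: "nat \<Rightarrow> ('a::polish_space \<times> 'b::polish_space) measure"
  assumes \<zeta>: "range \<zeta> \<subseteq> Prob" and lim: "limitin narrow_topology \<zeta> \<gamma> sequentially" and \<mu>: "\<mu> \<in> Prob"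
    and x: "\<And>g. g \<in> test_functions \<Longrightarrow> (\<lambda>n. \<integral> u. g u \<partial>(empirical n x)) \<longlonglongrightarrow> (\<integral> u. g u \<partial>\<mu>)"
    and freq: "\<exists>\<^sub>F N in sequentially. \<zeta> N \<in> Prob_marginal (empirical N x)"
  shows "\<gamma> \<in> Prob_marginal \<mu>"
proof -
  have \<gamma>: "\<gamma> \<in> Prob" using lim unfolding limitin_narrow_topology[OF \<zeta>] by simp
  have fst_m: "fst \<in> borel_measurable M" if "M \<in> (Prob :: ('a \<times> 'b) measure set)" for M
    using borel_measurable_continuous_onI[OF continuous_on_fst[OF continuous_on_id]]
      measurable_cong_sets[OF ProbD(2)[OF that] refl] by blast
  have "distr \<gamma> borel fst \<in> Prob"
    using prob_space.prob_space_distr[OF ProbD(1)[OF \<gamma>] fst_m[OF \<gamma>]] by (simp add: space_prob_algebra)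
  moreover have "(\<integral> u. g u \<partial>(distr \<gamma> borel fst)) = (\<integral> u. g u \<partial>\<mu>)" if g: "g \<in> test_functions" for g
  proof (rule ccontr)
    have gm: "g \<in> borel_measurable borel"
      using borel_measurable_continuous_onI[OF test_function_continuous[OF g]] .
    have "continuous_on UNIV (\<lambda>p. g (fst p))" "bounded (range (\<lambda>p :: 'a \<times> 'b. g (fst p)))"
      using test_function_bounded[OF g]
      by (auto intro!: continuous_on_compose2[OF test_function_continuous[OF g]] continuous_intros simp: bounded_iff)
    then have "(\<lambda>N. \<integral> p. g (fst p) \<partial>(\<zeta> N)) \<longlonglongrightarrow> (\<integral> p. g (fst p) \<partial>\<gamma>)"
      using lim unfolding limitin_narrow_topology[OF \<zeta>] by blast
    then have "(\<lambda>N. (\<integral> p. g (fst p) \<partial>(\<zeta> N)) - (\<integral> u. g u \<partial>(empirical N x))) \<longlonglongrightarrow> (\<integral> p. g (fst p) \<partial>\<gamma>) - (\<integral> u. g u \<partial>\<mu>)"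
      by (rule tendsto_diff[OF _ x[OF g]])
    moreover assume "(\<integral> u. g u \<partial>(distr \<gamma> borel fst)) \<noteq> (\<integral> u. g u \<partial>\<mu>)"
    then have "(\<integral> p. g (fst p) \<partial>\<gamma>) - (\<integral> u. g u \<partial>\<mu>) \<noteq> 0"
      using gm fst_m[OF \<gamma>] by (simp add: integral_distr)
    ultimately have "\<forall>\<^sub>F N in sequentially. (\<integral> p. g (fst p) \<partial>(\<zeta> N)) - (\<integral> u. g u \<partial>(empirical N x)) \<noteq> 0"
      by (rule tendsto_imp_eventually_ne)
    with freq have "\<exists>\<^sub>F N in sequentially. \<zeta> N \<in> Prob_marginal (empirical N x) \<and>
        (\<integral> p. g (fst p) \<partial>(\<zeta> N)) - (\<integral> u. g u \<partial>(empirical N x)) \<noteq> 0"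
      by (rule frequently_eventually_frequently)
    then obtain N where N: "\<zeta> N \<in> Prob_marginal (empirical N x)"
        "(\<integral> p. g (fst p) \<partial>(\<zeta> N)) \<noteq> (\<integral> u. g u \<partial>(empirical N x))"
      by (auto dest: frequently_ex)
    have "(\<integral> u. g u \<partial>(distr (\<zeta> N) borel fst)) = (\<integral> p. g (fst p) \<partial>(\<zeta> N))"
      using gm \<zeta> by (intro integral_distr fst_m) auto
    then show False using N by (simp add: Prob_marginal_def)
  qed
  ultimately have "distr \<gamma> borel fst = \<mu>" by (intro Prob_eqI_test_functions \<mu>)
  then show ?thesis using \<gamma> by (simp add: Prob_marginal_def)
qed

text \<open>
If the first marginals are the empirical measures only finitely often, the potentials are eventually infinite.
Otherwise the limit has marginal \<open>\<mu>\<close>; then the lower bound holds at every index, trivially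
where the marginal is wrong.
\<close>

lemma limit_potential_le_liminf:
  fixes c :: "'a::polish_space \<times> 'b::polish_space \<Rightarrow> ennreal"
  assumes c: "lower_semicontinuous c" and L: "lower_semicontinuous L" and H: "lower_semicontinuous H"
    and inj: "inj x" and \<mu>: "\<mu> \<in> Prob"
    and x: "\<And>g. g \<in> test_functions \<Longrightarrow> (\<lambda>n. \<integral> u. g u \<partial>(empirical n x)) \<longlonglongrightarrow> (\<integral> u. g u \<partial>\<mu>)"
    and \<zeta>: "range \<zeta> \<subseteq> Prob" and lim: "limitin narrow_topology \<zeta> \<gamma> sequentially"
  shows "limit_potential \<mu> c L H \<gamma> \<le> liminf (\<lambda>N. mixed_potential c L H x N (\<zeta> N))"
proof (cases "\<exists>\<^sub>F N in sequentially. \<zeta> N \<in> Prob_marginal (empirical N x)")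
  case False
  then have "\<forall>\<^sub>F N in sequentially. \<zeta> N \<notin> Prob_marginal (empirical N x)" by (simp add: not_frequently)
  then have "\<forall>\<^sub>F N in sequentially. \<infinity> \<le> mixed_potential c L H x N (\<zeta> N)"
    by eventually_elim (simp add: mixed_potential_def)
  then have "\<infinity> \<le> liminf (\<lambda>N. mixed_potential c L H x N (\<zeta> N))" by (rule Liminf_bounded)
  then show ?thesis by (simp add: top_unique)
next
  case True
  note m = lower_semicontinuous_measurable[OF c] lower_semicontinuous_measurable[OF L] lower_semicontinuous_measurable[OF H]
  have "\<gamma> \<in> Prob_marginal \<mu>" by (rule marginal_of_limit[OF \<zeta> lim \<mu> x True])
  then have "limit_potential \<mu> c L H \<gamma> = pair_energy (pair_kernel c L H) \<gamma> \<gamma>"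
    by (rule limit_potential_eq_pair_energy[OF m])
  also have "\<dots> \<le> liminf (\<lambda>N. mixed_potential c L H x N (\<zeta> N))"
    unfolding pair_energy_def
  proof (rule pair_energy_liminf[OF \<zeta> lim lower_semicontinuous_pair_kernel[OF c L H]])
    fix \<kappa> :: "('a \<times> 'b) \<times> ('a \<times> 'b) \<Rightarrow> real" and B
    assume \<kappa>: "\<kappa> \<in> test_functions" and le: "\<And>p. ennreal (\<kappa> p) \<le> pair_kernel c L H p" and B: "\<And>p. \<kappa> p \<le> B"
    have B0: "0 \<le> B" using order_trans[OF test_function_nonneg[OF \<kappa>] B] .
    have \<kappa>m: "\<kappa> \<in> borel_measurable borel"
      using borel_measurable_continuous_onI[OF test_function_continuous[OF \<kappa>]] .
    show "\<forall>\<^sub>F N in sequentially. (\<integral>\<^sup>+ z. \<integral>\<^sup>+ z'. \<kappa> (z, z') \<partial>(\<zeta> N) \<partial>(\<zeta> N)) \<le> mixed_potential c L H x N (\<zeta> N) + ennreal (B / real N)"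
      using eventually_gt_at_top[of 0]
    proof eventually_elim
      case (elim N)
      show ?case
      proof (cases "\<zeta> N \<in> Prob_marginal (empirical N x)")
        case True
        have "inj_on x {..<N}" using inj by (rule inj_on_subset) simp
        from mixed_potential_ge_pair_energy[OF m this elim True \<kappa>m le B B0]
        show ?thesis by (simp add: pair_energy_def)
      qed (simp add: mixed_potential_def)
    qed
  qed
  finally show ?thesis .
qed

section \<open>Recovery sequences\<close>

text \<open>
What a recovery sequence needs from a sample of types with actions: empirical convergence, and an
upper bound for the averages of \<open>K\<close> over pairs.
\<close>

definition good_sample :: "('z::polish_space \<times> 'z \<Rightarrow> ennreal) \<Rightarrow> 'z measure \<Rightarrow> (nat \<Rightarrow> 'z) \<Rightarrow> bool" where
  "good_sample K \<gamma> z \<longleftrightarrow>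
    (\<forall>g\<in>test_functions. (\<lambda>n. (\<Sum>i<n. g (z i)) / real n) \<longlonglongrightarrow> (\<integral> u. g u \<partial>\<gamma>)) \<and>
    (\<forall>e. pair_energy K \<gamma> \<gamma> < ennreal e \<longrightarrow>
      (\<forall>\<^sub>F n in sequentially. (\<Sum>(i, j)\<in>off_diagonal n. K (z i, z j)) \<le> ennreal (e * card (off_diagonal n))))"

lemma AE_good_sample:
  fixes \<gamma> :: "'z::polish_space measure"
  assumes \<gamma>: "\<gamma> \<in> Prob" and K: "K \<in> borel_measurable borel" and sym: "\<And>z z'. K (z, z') = K (z', z)"
    and fin: "pair_energy K \<gamma> \<gamma> < \<infinity>"
  shows "AE z in PiM UNIV (\<lambda>_::nat. \<gamma>). good_sample K \<gamma> z"
proof -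
  interpret iid_sequence "PiM UNIV (\<lambda>_::nat. \<gamma>)" borel \<gamma> "\<lambda>i z. z i" by (rule iid_sequence_coordinates[OF \<gamma>])
  interpret G: prob_space \<gamma> using \<gamma> ProbD by auto
  have K' [measurable]: "K \<in> borel_measurable (borel \<Otimes>\<^sub>M borel)" using K by (simp only: borel_prod)
  have int: "(\<integral>\<^sup>+ p. K p \<partial>(\<gamma> \<Otimes>\<^sub>M \<gamma>)) = pair_energy K \<gamma> \<gamma>"
    unfolding pair_energy_def by (intro G.nn_integral_fst[symmetric]) measurable
  obtain e0 where e0: "pair_energy K \<gamma> \<gamma> = ennreal e0" "0 \<le> e0"
    using fin by (cases "pair_energy K \<gamma> \<gamma>") auto
  have "AE z in PiM UNIV (\<lambda>_::nat. \<gamma>). \<forall>e>e0. \<forall>\<^sub>F n in sequentially.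
      (\<Sum>(i, j)\<in>off_diagonal n. K (z i, z j)) \<le> ennreal (e * card (off_diagonal n))"
    by (intro U_statistic_upper_law[OF K' sym _ e0(2)]) (simp add: int e0)
  with AE_test_averages_tendsto[OF iid_sequence_axioms] show ?thesis
    by eventually_elim (use e0 in \<open>simp add: good_sample_def ennreal_less_iff\<close>)
qed

text \<open>
Any subset of a separable metric space is separable, in particular the graph of \<open>J\<close> over its finite
part. Density in the graph, not just in the domain, keeps the energies close although \<open>J\<close> is not
continuous.
\<close>

lemma countable_energy_dense_subset:
  fixes J :: "'z::polish_space measure \<Rightarrow> ennreal" and S :: "'z measure set"
  assumes fin: "\<And>\<gamma>. \<gamma> \<in> S \<Longrightarrow> J \<gamma> < \<infinity>"
  obtains D where "countable D" "D \<subseteq> S"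
    "\<And>\<gamma> \<epsilon>::real. \<gamma> \<in> S \<Longrightarrow> 0 < \<epsilon> \<Longrightarrow> \<exists>\<gamma>'\<in>D. dist (test_vector \<gamma>') (test_vector \<gamma>) < \<epsilon> \<and> J \<gamma>' < J \<gamma> + ennreal \<epsilon>"
proof -
  let ?\<Psi> = "\<lambda>\<gamma>. (test_vector \<gamma>, enn2real (J \<gamma>))"
  obtain T where T: "countable T" "T \<subseteq> ?\<Psi> ` S" "?\<Psi> ` S \<subseteq> closure T"
    using separable[of "?\<Psi> ` S"] by blast
  obtain D where D: "countable D" "D \<subseteq> S" "T = ?\<Psi> ` D"
    using T(1,2) countable_subset_image[of T ?\<Psi> S] by blast
  show ?thesis
  proof (rule that[OF D(1,2)])
    fix \<gamma> and \<epsilon> :: real assume \<gamma>: "\<gamma> \<in> S" and \<epsilon>: "0 < \<epsilon>"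
    have "?\<Psi> \<gamma> \<in> closure T" using T(3) \<gamma> by blast
    then obtain \<gamma>' where \<gamma>': "\<gamma>' \<in> D" "dist (?\<Psi> \<gamma>') (?\<Psi> \<gamma>) < \<epsilon>"
      using \<epsilon> unfolding closure_approachable D(3) by blast
    have "dist (test_vector \<gamma>') (test_vector \<gamma>) < \<epsilon>"
      using le_less_trans[OF dist_fst_le \<gamma>'(2)] by simp
    moreover have "dist (enn2real (J \<gamma>')) (enn2real (J \<gamma>)) < \<epsilon>"
      using le_less_trans[OF dist_snd_le \<gamma>'(2)] by simp
    then have "enn2real (J \<gamma>') < enn2real (J \<gamma>) + \<epsilon>" by (simp add: dist_real_def)
    then have "ennreal (enn2real (J \<gamma>')) < ennreal (enn2real (J \<gamma>) + \<epsilon>)" by (simp add: ennreal_less_iff)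
    then have "J \<gamma>' < J \<gamma> + ennreal \<epsilon>"
      using fin[OF \<gamma>] fin[of \<gamma>'] \<gamma>'(1) D(2) \<epsilon> by (auto simp: ennreal_enn2real)
    ultimately show "\<exists>\<gamma>'\<in>D. dist (test_vector \<gamma>') (test_vector \<gamma>) < \<epsilon> \<and> J \<gamma>' < J \<gamma> + ennreal \<epsilon>"
      using \<gamma>'(1) by blast
  qed
qed

text \<open>
At stage \<open>N\<close> take the best precision \<open>1 / (m + 1)\<close> with \<open>m \<le> N\<close> that can be reached.
\<close>

lemma eventually_choose_diagonal:
  assumes ex: "\<And>\<epsilon>::real. 0 < \<epsilon> \<Longrightarrow> \<forall>\<^sub>F N::nat in sequentially. \<exists>y. Q \<epsilon> N y"
    and mono: "\<And>\<epsilon> \<epsilon>' N y. \<epsilon> \<le> \<epsilon>' \<Longrightarrow> Q \<epsilon> N y \<Longrightarrow> Q \<epsilon>' N y"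
  shows "\<exists>Y. \<forall>\<epsilon>>0. \<forall>\<^sub>F N in sequentially. Q \<epsilon> N (Y N)"
proof -
  define S where "S N = {m. m \<le> N \<and> (\<exists>y. Q (1 / real (Suc m)) N y)}" for N
  have fin: "finite (S N)" for N unfolding S_def by (rule finite_subset[of _ "{..N}"]) auto
  define Y where "Y N = (SOME y. Q (1 / real (Suc (Max (S N)))) N y)" for N
  have "\<forall>\<^sub>F N in sequentially. Q \<epsilon> N (Y N)" if \<epsilon>: "0 < \<epsilon>" for \<epsilon>
  proof -
    obtain m where m: "1 / real (Suc m) < \<epsilon>" using nat_approx_posE[OF \<epsilon>] by blast
    have "\<forall>\<^sub>F N in sequentially. \<exists>y. Q (1 / real (Suc m)) N y" by (rule ex) simp
    then show ?thesis using eventually_ge_at_top[of m]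
    proof eventually_elim
      case (elim N)
      then have mS: "m \<in> S N" by (simp add: S_def)
      then have "Max (S N) \<in> S N" using fin by (intro Max_in) auto
      then have "\<exists>y. Q (1 / real (Suc (Max (S N)))) N y" by (simp add: S_def)
      then have "Q (1 / real (Suc (Max (S N)))) N (Y N)" unfolding Y_def by (rule someI_ex)
      moreover have "1 / real (Suc (Max (S N))) \<le> \<epsilon>"
      proof -
        have "1 / real (Suc (Max (S N))) \<le> 1 / real (Suc m)"
          using Max_ge[OF fin mS] by (intro divide_left_mono) auto
        then show ?thesis using m by simp
      qed
      ultimately show ?case using mono by blast
    qed
  qed
  then show ?thesis by blast
qed

text \<open>
For each precision, a good sample for some \<open>\<gamma>'\<close> close to \<open>\<gamma>\<close> in measure and in energy provides
pure profiles at all large \<open>N\<close>; the diagonal choice lets the precision tend to zero with \<open>N\<close>.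
\<close>

lemma recovery_sequence:
  fixes c :: "'a::polish_space \<times> 'b::polish_space \<Rightarrow> ennreal" and x :: "nat \<Rightarrow> 'a"
  assumes c: "c \<in> borel_measurable borel" and L: "L \<in> borel_measurable borel" and H: "H \<in> borel_measurable borel"
    and inj: "inj x" and \<gamma>: "\<gamma> \<in> Prob"
    and approx: "\<And>\<epsilon>::real. 0 < \<epsilon> \<Longrightarrow> \<exists>\<gamma>'\<in>Prob. dist (test_vector \<gamma>') (test_vector \<gamma>) < \<epsilon> \<and>
        pair_energy (pair_kernel c L H) \<gamma>' \<gamma>' < J + ennreal \<epsilon> \<and>
        (\<exists>y. good_sample (pair_kernel c L H) \<gamma>' (\<lambda>i. (x i, y i)))"
  shows "\<exists>\<zeta>. range \<zeta> \<subseteq> Prob \<and> limitin narrow_topology \<zeta> \<gamma> sequentially \<and>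
    limsup (\<lambda>N. pure_potential c L H x N (\<zeta> N)) \<le> J"
proof (cases "J = \<infinity>")
  case True
  have "limitin narrow_topology (\<lambda>_. \<gamma>) \<gamma> sequentially"
    using \<gamma> by (simp add: limitin_const topspace_narrow_topology)
  then show ?thesis using True \<gamma> by (intro exI[of _ "\<lambda>_. \<gamma>"]) auto
next
  case False
  let ?K = "pair_kernel c L H" and ?emp = "\<lambda>N y. empirical N (\<lambda>i. (x i, y i))"
  define Q where "Q \<epsilon> N y \<longleftrightarrow> dist (test_vector (?emp N y)) (test_vector \<gamma>) < \<epsilon> \<and>
    pure_potential c L H x N (?emp N y) \<le> J + ennreal \<epsilon>" for \<epsilon> N y
  have "\<forall>\<^sub>F N in sequentially. \<exists>y. Q \<epsilon> N y" if \<epsilon>: "0 < \<epsilon>" for \<epsilon>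
  proof -
    obtain \<gamma>' y where \<gamma>': "\<gamma>' \<in> Prob" "dist (test_vector \<gamma>') (test_vector \<gamma>) < \<epsilon> / 2"
      "pair_energy ?K \<gamma>' \<gamma>' < J + ennreal (\<epsilon> / 2)" and y: "good_sample ?K \<gamma>' (\<lambda>i. (x i, y i))"
      using approx[of "\<epsilon> / 2"] \<epsilon> by auto
    define e where "e = enn2real J + \<epsilon>"
    have e: "ennreal e = J + ennreal \<epsilon>" "0 \<le> e" using False \<epsilon> by (auto simp: e_def ennreal_enn2real_if top.not_eq_extremum)
    have "pair_energy ?K \<gamma>' \<gamma>' < ennreal e"
      unfolding e(1) using \<gamma>'(3) \<epsilon> by (elim less_le_trans) (intro add_left_mono ennreal_leI, simp)
    then have ev1: "\<forall>\<^sub>F n in sequentially. (\<Sum>(i, j)\<in>off_diagonal n. ?K ((x i, y i), (x j, y j))) \<le> ennreal (e * card (off_diagonal n))"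
      using y by (simp add: good_sample_def)
    \<comment> \<open>The shift skips the empty sample, whose empirical measure is zero.\<close>
    have "(\<lambda>n. test_vector (?emp (Suc n) y)) \<longlonglongrightarrow> test_vector \<gamma>'"
    proof (rule limitin_narrow_iff_test_vector[THEN iffD1])
      show "range (\<lambda>n. ?emp (Suc n) y) \<subseteq> Prob" using empirical_Prob by blast
      show "limitin narrow_topology (\<lambda>n. ?emp (Suc n) y) \<gamma>' sequentially"
      proof (rule narrow_limitI)
        fix g :: "'a \<times> 'b \<Rightarrow> real" assume g: "g \<in> test_functions"
        have "(\<lambda>n. \<integral> u. g u \<partial>(?emp n y)) \<longlonglongrightarrow> (\<integral> u. g u \<partial>\<gamma>')"
          using y g by (intro empirical_test_integrals_tendsto) (auto simp: good_sample_def)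
        then have "(\<lambda>n. \<integral> u. g u \<partial>(?emp (Suc n) y)) \<longlonglongrightarrow> (\<integral> u. g u \<partial>\<gamma>')" by (rule LIMSEQ_Suc)
        then have "(\<lambda>n. \<integral>\<^sup>+ u. ennreal (g u) \<partial>(?emp (Suc n) y)) \<longlonglongrightarrow> (\<integral>\<^sup>+ u. ennreal (g u) \<partial>\<gamma>')"
          using g \<gamma>' empirical_Prob[of "Suc _"] by (subst (1 2) test_function_nn_integral) (auto intro!: tendsto_ennrealI)
        then show "(\<integral>\<^sup>+ u. ennreal (g u) \<partial>\<gamma>') \<le> liminf (\<lambda>n. \<integral>\<^sup>+ u. ennreal (g u) \<partial>(?emp (Suc n) y))"
          by (simp add: lim_imp_Liminf)
      qed (use \<gamma>' empirical_Prob in auto)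
    qed (use \<gamma>' in auto)
    then have "(\<lambda>n. test_vector (?emp n y)) \<longlonglongrightarrow> test_vector \<gamma>'" by (rule LIMSEQ_imp_Suc)
    then have "\<forall>\<^sub>F n in sequentially. dist (test_vector (?emp n y)) (test_vector \<gamma>') < \<epsilon> / 2"
      using \<epsilon> by (intro tendstoD) auto
    then show ?thesis using ev1 eventually_gt_at_top[of 1]
    proof eventually_elim
      case (elim N)
      have "dist (test_vector (?emp N y)) (test_vector \<gamma>) < \<epsilon>"
        using dist_triangle[of "test_vector (?emp N y)" "test_vector \<gamma>" "test_vector \<gamma>'"] elim(1) \<gamma>'(2) by simp
      moreover have "pure_potential c L H x N (?emp N y) \<le> ennreal e"
        using inj elim e(2) by (intro pure_potential_le[OF c L H]) (auto intro: inj_on_subset)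
      ultimately show ?case unfolding Q_def e(1) by blast
    qed
  qed
  moreover have "Q \<epsilon>' N y" if "\<epsilon> \<le> \<epsilon>'" "Q \<epsilon> N y" for \<epsilon> \<epsilon>' N y
    using that unfolding Q_def by (auto intro: order_trans[OF _ add_left_mono[OF ennreal_leI]])
  ultimately obtain Y where Y: "\<And>\<epsilon>. 0 < \<epsilon> \<Longrightarrow> \<forall>\<^sub>F N in sequentially. Q \<epsilon> N (Y N)"
    using eventually_choose_diagonal[of Q] by blast
  \<comment> \<open>The empirical measure of an empty sample is not a probability measure.\<close>
  define \<zeta> where "\<zeta> N = (if N = 0 then \<gamma> else ?emp N (Y N))" for N
  have \<zeta>P: "range \<zeta> \<subseteq> Prob" using \<gamma> empirical_Prob by (auto simp: \<zeta>_def)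
  have ev: "\<forall>\<^sub>F N in sequentially. dist (test_vector (\<zeta> N)) (test_vector \<gamma>) < \<epsilon> \<and>
      pure_potential c L H x N (\<zeta> N) \<le> J + ennreal \<epsilon>" if "0 < \<epsilon>" for \<epsilon>
    using Y[OF that] eventually_gt_at_top[of 0] by eventually_elim (simp add: Q_def \<zeta>_def)
  have "(\<lambda>N. test_vector (\<zeta> N)) \<longlonglongrightarrow> test_vector \<gamma>"
    by (intro tendstoI eventually_mono[OF ev]) auto
  then have "limitin narrow_topology \<zeta> \<gamma> sequentially"
    by (simp add: limitin_narrow_iff_test_vector[OF \<zeta>P \<gamma>])
  moreover have "limsup (\<lambda>N. pure_potential c L H x N (\<zeta> N)) \<le> J"
  proof (rule ennreal_le_epsilon)
    fix \<epsilon> :: real assume "0 < \<epsilon>"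
    then show "limsup (\<lambda>N. pure_potential c L H x N (\<zeta> N)) \<le> J + ennreal \<epsilon>"
      by (intro Limsup_bounded eventually_mono[OF ev]) auto
  qed
  ultimately show ?thesis using \<zeta>P by blast
qed

section \<open>Gamma-convergence\<close>

theorem theorem4p12:
  fixes \<mu> :: "'a::polish_space measure"
    and c :: "'a \<times> 'b::polish_space \<Rightarrow> ennreal"
    and L :: "'b \<Rightarrow> ennreal"
    and H :: "'b \<times> 'b \<Rightarrow> ennreal"
    and P :: "'w measure"
    and X :: "nat \<Rightarrow> 'w \<Rightarrow> 'a"
  assumes "\<mu> \<in> Prob" and "atomless \<mu>"
    and "lower_semicontinuous c" and "lower_semicontinuous L" and "lower_semicontinuous H"
    and "\<And>y y'. H (y, y') = H (y', y)"
    and "\<And>\<kappa>::real. \<kappa> > 0 \<Longrightarrow> compact {y. L y \<le> ennreal \<kappa>}"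
    and "prob_space P"
    and "prob_space.indep_vars P (\<lambda>_. borel) X UNIV"
    and "\<And>i. distr P borel (X i) = \<mu>"
  shows "AE \<omega> in P.
      gamma_converges narrow_topology
        (\<lambda>N. mixed_potential c L H (\<lambda>i. X i \<omega>) N) (limit_potential \<mu> c L H) \<and>
      gamma_converges narrow_topology
        (\<lambda>N. pure_potential c L H (\<lambda>i. X i \<omega>) N) (limit_potential \<mu> c L H)"
proof -
  note \<mu> = assms(1) and c = assms(3) and L = assms(4) and H = assms(5)
  note m = lower_semicontinuous_measurable[OF c] lower_semicontinuous_measurable[OF L] lower_semicontinuous_measurable[OF H]
  interpret iid_sequence P borel \<mu> X
    by (rule iid_sequence.intro[OF assms(8)]) (rule iid_sequence_axioms.intro[OF assms(9,10)])
  let ?K = "pair_kernel c L H"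
  have K: "?K \<in> borel_measurable borel"
    by (intro lower_semicontinuous_measurable lower_semicontinuous_pair_kernel c L H)
  have sym: "?K (z, z') = ?K (z', z)" for z z'
    using assms(6) by (simp add: pair_kernel_def add.commute)
  define S where "S = {\<gamma> \<in> Prob_marginal \<mu>. pair_energy ?K \<gamma> \<gamma> < \<infinity>}"
  obtain D where D: "countable D" "D \<subseteq> S"
    "\<And>\<gamma> \<epsilon>::real. \<gamma> \<in> S \<Longrightarrow> 0 < \<epsilon> \<Longrightarrow> \<exists>\<gamma>'\<in>D. dist (test_vector \<gamma>') (test_vector \<gamma>) < \<epsilon> \<and>
      pair_energy ?K \<gamma>' \<gamma>' < pair_energy ?K \<gamma> \<gamma> + ennreal \<epsilon>"
    using countable_energy_dense_subset[of S "\<lambda>\<gamma>. pair_energy ?K \<gamma> \<gamma>"] unfolding S_def by blast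
  \<comment> \<open>Only the countably many couplings in \<open>D\<close> require a null set of their own.\<close>
  have "AE \<omega> in P. \<forall>\<gamma>\<in>D. \<exists>y. good_sample ?K \<gamma> (\<lambda>i. (X i \<omega>, y i))"
  proof (rule AE_ball_countable'[OF _ D(1)])
    fix \<gamma> assume "\<gamma> \<in> D"
    then have \<gamma>: "\<gamma> \<in> Prob_marginal \<mu>" "\<gamma> \<in> Prob" "pair_energy ?K \<gamma> \<gamma> < \<infinity>"
      using D(2) by (auto simp: S_def Prob_marginal_def)
    show "AE \<omega> in P. \<exists>y. good_sample ?K \<gamma> (\<lambda>i. (X i \<omega>, y i))"
      by (rule AE_choose_second_coordinates[OF assms(8-10) \<gamma>(1) AE_good_sample[OF \<gamma>(2) K sym \<gamma>(3)]])
  qed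
  moreover have "AE \<omega> in P. inj (\<lambda>i. X i \<omega>)" by (rule AE_iid_inj[OF iid_sequence_axioms assms(2)])
  moreover note AE_test_averages_tendsto[OF iid_sequence_axioms]
  ultimately show ?thesis
  proof eventually_elim
    case (elim \<omega>)
    let ?x = "\<lambda>i. X i \<omega>"
    have liminf: "limit_potential \<mu> c L H \<gamma> \<le> liminf (\<lambda>N. mixed_potential c L H ?x N (\<zeta> N))"
      if "range \<zeta> \<subseteq> Prob" "limitin narrow_topology \<zeta> \<gamma> sequentially" for \<zeta> \<gamma>
      using elim(3) by (intro limit_potential_le_liminf[OF c L H elim(2) \<mu> _ that] empirical_test_integrals_tendsto) auto
    have limsup: "\<exists>\<zeta>. range \<zeta> \<subseteq> Prob \<and> limitin narrow_topology \<zeta> \<gamma> sequentially \<and>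
        limsup (\<lambda>N. pure_potential c L H ?x N (\<zeta> N)) \<le> limit_potential \<mu> c L H \<gamma>" if \<gamma>: "\<gamma> \<in> Prob" for \<gamma>
    proof (cases "\<gamma> \<in> S")
      case True
      show ?thesis
      proof (rule recovery_sequence[OF m elim(2) \<gamma>])
        fix \<epsilon> :: real assume "0 < \<epsilon>"
        from D(3)[OF True this] obtain \<gamma>' where "\<gamma>' \<in> D" "dist (test_vector \<gamma>') (test_vector \<gamma>) < \<epsilon>"
          "pair_energy ?K \<gamma>' \<gamma>' < pair_energy ?K \<gamma> \<gamma> + ennreal \<epsilon>" by blast
        moreover have "limit_potential \<mu> c L H \<gamma> = pair_energy ?K \<gamma> \<gamma>"
          using True by (intro limit_potential_eq_pair_energy[OF m]) (simp add: S_def)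
        ultimately show "\<exists>\<gamma>'\<in>Prob. dist (test_vector \<gamma>') (test_vector \<gamma>) < \<epsilon> \<and>
            pair_energy ?K \<gamma>' \<gamma>' < limit_potential \<mu> c L H \<gamma> + ennreal \<epsilon> \<and>
            (\<exists>y. good_sample ?K \<gamma>' (\<lambda>i. (X i \<omega>, y i)))"
          using D(2) elim(1) by (intro bexI[of _ \<gamma>']) (auto simp: S_def Prob_marginal_def)
      qed
    next
      case False
      have "limit_potential \<mu> c L H \<gamma> = \<infinity>"
      proof (cases "\<gamma> \<in> Prob_marginal \<mu>")
        case True
        then show ?thesis
          using limit_potential_eq_pair_energy[OF m True] False by (simp add: S_def less_top[symmetric])
      qed (simp add: limit_potential_def)
      then show ?thesis
        using \<gamma> by (intro exI[of _ "\<lambda>_. \<gamma>"]) (auto simp: limitin_const topspace_narrow_topology)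
    qed
    have le: "mixed_potential c L H ?x N \<gamma> \<le> pure_potential c L H ?x N \<gamma>" for N \<gamma>
      by (rule mixed_potential_le_pure)
    show ?case
      unfolding gamma_converges_def topspace_narrow_topology
    proof (intro conjI allI impI ballI)
      fix \<gamma> :: "('a \<times> 'b) measure" and \<zeta>
      assume \<zeta>: "range \<zeta> \<subseteq> Prob" "limitin narrow_topology \<zeta> \<gamma> sequentially"
      show "limit_potential \<mu> c L H \<gamma> \<le> liminf (\<lambda>N. mixed_potential c L H ?x N (\<zeta> N))" by (rule liminf[OF \<zeta>])
      also have "\<dots> \<le> liminf (\<lambda>N. pure_potential c L H ?x N (\<zeta> N))"
        by (intro Liminf_mono always_eventually allI le)
      finally show "limit_potential \<mu> c L H \<gamma> \<le> liminf (\<lambda>N. pure_potential c L H ?x N (\<zeta> N))" .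
    next
      fix \<gamma> :: "('a \<times> 'b) measure" assume "\<gamma> \<in> Prob"
      from limsup[OF this] show "\<exists>\<zeta>. range \<zeta> \<subseteq> Prob \<and> limitin narrow_topology \<zeta> \<gamma> sequentially \<and>
          limsup (\<lambda>N. pure_potential c L H ?x N (\<zeta> N)) \<le> limit_potential \<mu> c L H \<gamma>" .
      then obtain \<zeta> where \<zeta>: "range \<zeta> \<subseteq> Prob" "limitin narrow_topology \<zeta> \<gamma> sequentially"
        "limsup (\<lambda>N. pure_potential c L H ?x N (\<zeta> N)) \<le> limit_potential \<mu> c L H \<gamma>" by blast
      have "limsup (\<lambda>N. mixed_potential c L H ?x N (\<zeta> N)) \<le> limsup (\<lambda>N. pure_potential c L H ?x N (\<zeta> N))"
        by (intro Limsup_mono always_eventually allI le)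
      from order_trans[OF this \<zeta>(3)] show "\<exists>\<zeta>. range \<zeta> \<subseteq> Prob \<and> limitin narrow_topology \<zeta> \<gamma> sequentially \<and>
          limsup (\<lambda>N. mixed_potential c L H ?x N (\<zeta> N)) \<le> limit_potential \<mu> c L H \<gamma>"
        using \<zeta>(1,2) by (intro exI[of _ \<zeta>] conjI)
    qed
  qed
qed

end
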